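(* Let $H$ be a Krull monoid. 1. If every $a\in H\setminus H^\times$ lies in a divisorial ideal of $H$ distinct from $H$, then $H$ is a BF-monoid. 2. Let $\varphi\colon H\to D=\mathcal F(P)$ be a divisor homomorphism, $G=\mathcal C(\varphi)$ its class group and $G_P\subset G$ the set of classes containing prime divisors. (a) Let $\widetilde{\boldsymbol\beta}\colon\mathcal F(P)\to\mathcal F(G_P)$ denote the unique homomorphism satisfying $\widetilde{\boldsymbol\beta}(p)=[p]$ for all $p\in P$. Then, for all $\alpha\in D$, we have $\widetilde{\boldsymbol\beta}(\alpha)\in\mathcal B(G_P)$ if and only if $\alpha\in\varphi(H)$, and the map $\boldsymbol\beta=\widetilde{\boldsymbol\beta}\circ\varphi\colon H\to\mathcal B(G_P)$ is a transfer homomorphism. (b) If $\mathsf D(G_P)<\infty$, then $\rho(H)<\infty$, $\Delta(H)$ is finite, and there exists some $M^*\in\mathbb N_0$ such that the Structure Theorem for Sets of Lengths holds for $H$ with parameters $M^*$ and $\Delta(H)$.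
   Context: A monoid is a cancellative semigroup with unit element satisfying the left and right Ore conditions ($Ha\cap Hb\ne\emptyset$ and $aH\cap bH\neq\emptyset$ for all $a,b\in H$); $\mathsf q(H)$ is its quotient group, $H^\times$ its group of invertible elements; $H$ is reduced if $H^\times=\{1\}$. Homomorphisms preserve $1$. For $A,B\subset\mathsf q(H)$: $(A:_lB)=\{x\in\mathsf q(H)\mid xB\subset A\}$, $(A:_rB)=\{x\in\mathsf q(H)\mid Bx\subset A\}$. An ideal of $H$ is a subset $\mathfrak a\subset H$ with $H\mathfrak a=\mathfrak a=\mathfrak aH$ (possibly empty). It is divisorial (a $v$-ideal) if $\mathfrak a=\bigl(H:_l(H:_r\mathfrak a)\bigr)=\bigl(H:_r(H:_l\mathfrak a)\bigr)$. $H$ is a Krull monoid if $(\mathfrak a:_l\mathfrak a)=(\mathfrak a:_r\mathfrak a)=H$ for all non-empty ideals $\mathfrak a$ of $H$ and $H$ satisfies the ascending chain condition on divisorial ideals of $H$. $a\mid_l b$ means $b\in aH$, $a\mid_r b$ means $b\in Ha$. A monoid homomorphism $\varphi\colon H\to D$ is a divisor homomorphism if for all $u,v\in H$, $\varphi(u)\mid_l\varphi(v)$ implies $u\mid_lv$ and $\varphi(u)\mid_r\varphi(v)$ implies $u\mid_rv$. $\mathcal F(P)$ is the (multiplicative) free abelian monoid with basis $P$; $|a|$ denotes the length (number of factors with multiplicity) of $a\in\mathcal F(P)$. The class group of $\varphi\colon H\to D=\mathcal F(P)$ is $\mathcal C(\varphi)=\mathsf q(D)/\mathsf q(\varphi(H))$,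 written additively; $[a]=a\,\mathsf q(\varphi(H))$ for $a\in\mathsf q(D)$; $G_P=\{[p]\mid p\in P\}$. For a subset $G_0$ of an additive abelian group and $S=g_1\cdots g_l\in\mathcal F(G_0)$, $\sigma(S)=g_1+\dots+g_l$; $\mathcal B(G_0)=\{S\in\mathcal F(G_0)\mid\sigma(S)=0\}$; an atom of a monoid $H$ is $a\in H\setminus H^\times$ such that $a=uv$ implies $u\in H^\times$ or $v\in H^\times$; $\mathcal A(H)$ is the set of atoms; $\mathsf D(G_0)=\sup\{|U|\mid U\in\mathcal A(\mathcal B(G_0))\}\in\mathbb N_0\cup\{\infty\}$. A transfer homomorphism is a monoid homomorphism $\theta\colon H\to B$ onto a reduced monoid $B$ such that (T1) $B=\theta(H)$ and $\theta^{-1}(1)=H^\times$; (T2) if $a\in H$, $b_1,b_2\in B$ and $\theta(a)=b_1b_2$, then there are $a_1,a_2\in H$ with $a=a_1a_2$, $\theta(a_1)=b_1$, $\theta(a_2)=b_2$. For $a\in H\setminus H^\times$, $\mathsf L(a)$ is the set of $k\in\mathbb N$ such that $a=u_1\cdots u_k$ for some atoms $u_i$ of $H$; $\mathsf L(a)=\{0\}$ for $a\in H^\times$. $H$ is atomic if all $\mathsf L(a)\ne\emptyset$, and a BF-monoid if all $\mathsf L(a)$ are finite and non-empty. $\mathcal L(H)=\{\mathsf L(a)\mid a\in H\}$. For a BF-monoid and finite non-empty $L=\{l_1<\dots<l_t\}\subset\mathbb N$: $\rho(L)=\max L/\min L$, $\Delta(L)=\{l_i-l_{i-1}\mid 2\le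 i\le t\}$; $\rho(\{0\})=1$, $\Delta(\{0\})=\emptyset$; $\rho(H)=\sup\{\rho(L)\mid L\in\mathcal L(H)\}$, $\Delta(H)=\bigcup_{L\in\mathcal L(H)}\Delta(L)$. For integers, $[a,b]=\{x\in\mathbb Z\mid a\le x\le b\}$. Let $d\in\mathbb N$, $M\in\mathbb N_0$ and $\{0,d\}\subset\mathcal D\subset[0,d]$. A set $L\subset\mathbb Z$ is an AAMP (almost arithmetical multiprogression) with difference $d$, period $\mathcal D$ and bound $M$ if $L=y+(L'\cup L^*\cup L'')\subset y+\mathcal D+d\mathbb Z$ for some $y\in\mathbb Z$, where $L^*$ is finite non-empty with $\min L^*=0$ and $L^*=(\mathcal D+d\mathbb Z)\cap[0,\max L^*]$, $L'\subset[-M,-1]$ and $L''\subset\max L^*+[1,M]$. The Structure Theorem for Sets of Lengths holds for $H$ if $H$ is atomic and there exist some $M^*\in\mathbb N_0$ and a finite non-empty set $\Delta^*\subset\mathbb N$ such that every $L\in\mathcal L(H)$ is an AAMP with some difference $d\in\Delta^*$ and bound $M^*$; in this case one says more precisely that the Structure Theorem holds with parameters $M^*$ and $\Delta^*$.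
   Formalization: In 2(b), if Δ(H) is empty (e.g. H factorial), the Structure Theorem is stated with parameters M* and {1} instead of Δ(H), because its definition requires a non-empty parameter set; for non-empty Δ(H) the claim is unchanged. *)

theory Defs
  imports
    "HOL-Algebra.Divisibility"
    "HOL-Algebra.FiniteProduct"
    "HOL-Library.Multiset"
    "HOL-Library.Extended_Nat"
    "HOL-Library.Extended_Real"
begin

section \<open>Monoids and their quotient groups\<close>

locale ore_monoid = monoid_cancel G for G (structure) +
  assumes left_ore: "\<lbrakk>a \<in> carrier G; b \<in> carrier G\<rbrakk> \<Longrightarrow> (carrier G #> a) \<inter> (carrier G #> b) \<noteq> {}"
    and right_ore: "\<lbrakk>a \<in> carrier G; b \<in> carrier G\<rbrakk> \<Longrightarrow> (a <# carrier G) \<inter> (b <# carrier G) \<noteq> {}"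

definition reduced :: "('a, 'm) monoid_scheme \<Rightarrow> bool" where
  "reduced H \<longleftrightarrow> Units H = {\<one>\<^bsub>H\<^esub>}"

text \<open>\<^term>\<open>ore_frac H a b\<close> is the formal right fraction $a b^{-1}$, as an equivalence class of pairs.
  Two fractions are multiplied by $(a b^{-1})(c d^{-1}) = (a x)(d y)^{-1}$ whenever $b x = c y$;
  such \<open>x\<close>, \<open>y\<close> exist by the Ore condition, and the class does not depend on any of the choices
  (see \<open>frac_mult\<close> below), so the union over all choices is a single class.\<close>

definition ore_frac :: "('a, 'm) monoid_scheme \<Rightarrow> 'a \<Rightarrow> 'a \<Rightarrow> ('a \<times> 'a) set" where
  "ore_frac H a b = {(c, d). c \<in> carrier H \<and> d \<in> carrier H \<and>
     (\<exists>x\<in>carrier H. \<exists>y\<in>carrier H. a \<otimes>\<^bsub>H\<^esub> x = c \<otimes>\<^bsub>H\<^esub> y \<and> b \<otimes>\<^bsub>H\<^esub> x = d \<otimes>\<^bsub>H\<^esub> y)}"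

definition quot_group :: "('a, 'm) monoid_scheme \<Rightarrow> ('a \<times> 'a) set monoid" where
  "quot_group H = \<lparr>carrier = {ore_frac H a b | a b. a \<in> carrier H \<and> b \<in> carrier H},
     monoid.mult = (\<lambda>X Y. \<Union> {ore_frac H (a \<otimes>\<^bsub>H\<^esub> x) (d \<otimes>\<^bsub>H\<^esub> y) | a b c d x y.
        (a, b) \<in> X \<and> (c, d) \<in> Y \<and> x \<in> carrier H \<and> y \<in> carrier H \<and> b \<otimes>\<^bsub>H\<^esub> x = c \<otimes>\<^bsub>H\<^esub> y}),
     one = ore_frac H \<one>\<^bsub>H\<^esub> \<one>\<^bsub>H\<^esub>\<rparr>"

text \<open>The canonical embedding of \<open>H\<close> into its quotient group.\<close>

definition quot_emb :: "('a, 'm) monoid_scheme \<Rightarrow> 'a \<Rightarrow> ('a \<times> 'a) set" where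
  "quot_emb H a = ore_frac H a \<one>\<^bsub>H\<^esub>"

context ore_monoid
begin

lemma common_right_multiple:
  assumes "a \<in> carrier G" "b \<in> carrier G"
  obtains x y where "x \<in> carrier G" "y \<in> carrier G" "a \<otimes> x = b \<otimes> y"
  using right_ore[OF assms] unfolding l_coset_def by force

lemma common_left_multiple:
  assumes "a \<in> carrier G" "b \<in> carrier G"
  obtains x y where "x \<in> carrier G" "y \<in> carrier G" "x \<otimes> a = y \<otimes> b"
  using left_ore[OF assms] unfolding r_coset_def by force

lemma mem_frac:
  assumes [simp]: "a \<in> carrier G" "b \<in> carrier G" "c \<in> carrier G" "d \<in> carrier G"
  shows "(c, d) \<in> ore_frac G a b \<longleftrightarrow>
    (\<forall>x\<in>carrier G. \<forall>y\<in>carrier G. b \<otimes> x = d \<otimes> y \<longrightarrow> a \<otimes> x = c \<otimes> y)"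
proof
  assume "(c, d) \<in> ore_frac G a b"
  then obtain x0 y0 where 0 [simp]: "x0 \<in> carrier G" "y0 \<in> carrier G"
    and e: "a \<otimes> x0 = c \<otimes> y0" "b \<otimes> x0 = d \<otimes> y0"
    unfolding ore_frac_def by auto
  show "\<forall>x\<in>carrier G. \<forall>y\<in>carrier G. b \<otimes> x = d \<otimes> y \<longrightarrow> a \<otimes> x = c \<otimes> y"
  proof (intro ballI impI)
    fix x y assume [simp]: "x \<in> carrier G" "y \<in> carrier G" and h: "b \<otimes> x = d \<otimes> y"
    obtain u v where uv [simp]: "u \<in> carrier G" "v \<in> carrier G" and k: "x0 \<otimes> u = x \<otimes> v"
      using common_right_multiple[of x0 x] by auto
    have "d \<otimes> (y0 \<otimes> u) = (b \<otimes> x0) \<otimes> u" by (simp add: e m_assoc)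
    also have "\<dots> = (b \<otimes> x) \<otimes> v" using k by (simp add: m_assoc)
    also have "\<dots> = d \<otimes> (y \<otimes> v)" by (simp add: h m_assoc)
    finally have l: "y0 \<otimes> u = y \<otimes> v" by (rule l_cancel) simp_all
    have "(a \<otimes> x) \<otimes> v = (a \<otimes> x0) \<otimes> u" using k by (simp add: m_assoc)
    also have "\<dots> = (c \<otimes> y) \<otimes> v" using l by (simp add: e m_assoc)
    finally show "a \<otimes> x = c \<otimes> y" by (rule r_cancel) simp_all
  qed
next
  assume R: "\<forall>x\<in>carrier G. \<forall>y\<in>carrier G. b \<otimes> x = d \<otimes> y \<longrightarrow> a \<otimes> x = c \<otimes> y"
  obtain x y where "x \<in> carrier G" "y \<in> carrier G" "b \<otimes> x = d \<otimes> y"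
    using common_right_multiple[of b d] by auto
  with R show "(c, d) \<in> ore_frac G a b" unfolding ore_frac_def by auto
qed

lemma frac_refl [simp]:
  "a \<in> carrier G \<Longrightarrow> b \<in> carrier G \<Longrightarrow> (a, b) \<in> ore_frac G a b"
  unfolding ore_frac_def by auto

lemma frac_sym: "(c, d) \<in> ore_frac G a b \<Longrightarrow> a \<in> carrier G \<Longrightarrow> b \<in> carrier G \<Longrightarrow> (a, b) \<in> ore_frac G c d"
  unfolding ore_frac_def by force

lemma frac_trans:
  assumes 1: "(c, d) \<in> ore_frac G a b" and 2: "(e, f) \<in> ore_frac G c d"
    and [simp]: "a \<in> carrier G" "b \<in> carrier G"
  shows "(e, f) \<in> ore_frac G a b"
proof -
  have [simp]: "c \<in> carrier G" "d \<in> carrier G" "e \<in> carrier G" "f \<in> carrier G"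
    using 1 2 by (auto simp: ore_frac_def)
  obtain x y where [simp]: "x \<in> carrier G" "y \<in> carrier G"
    and h: "a \<otimes> x = c \<otimes> y" "b \<otimes> x = d \<otimes> y"
    using 1 by (auto simp: ore_frac_def)
  obtain u v where [simp]: "u \<in> carrier G" "v \<in> carrier G" and k: "(d \<otimes> y) \<otimes> u = f \<otimes> v"
    using common_right_multiple[of "d \<otimes> y" f] by auto
  have "c \<otimes> (y \<otimes> u) = e \<otimes> v"
    using 2 k mem_frac[of c d e f] by (simp add: m_assoc)
  then have "a \<otimes> (x \<otimes> u) = e \<otimes> v" "b \<otimes> (x \<otimes> u) = f \<otimes> v"
    using h k by (simp_all add: m_assoc[symmetric])
  then show ?thesis unfolding ore_frac_def by force
qed

lemma frac_eq_iff:
  assumes [simp]: "a \<in> carrier G" "b \<in> carrier G" "c \<in> carrier G" "d \<in> carrier G"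
  shows "ore_frac G a b = ore_frac G c d \<longleftrightarrow>
    (\<exists>x\<in>carrier G. \<exists>y\<in>carrier G. a \<otimes> x = c \<otimes> y \<and> b \<otimes> x = d \<otimes> y)"
proof -
  have "ore_frac G a b = ore_frac G c d \<longleftrightarrow> (c, d) \<in> ore_frac G a b"
  proof
    assume m: "(c, d) \<in> ore_frac G a b"
    show "ore_frac G a b = ore_frac G c d"
    proof (intro equalityI subsetI)
      fix p assume p: "p \<in> ore_frac G a b"
      then show "p \<in> ore_frac G c d" by (cases p) (use frac_trans[OF frac_sym[OF m]] in auto)
    next
      fix p assume p: "p \<in> ore_frac G c d"
      then show "p \<in> ore_frac G a b" by (cases p) (use frac_trans[OF m] in auto)
    qed
  qed simp
  also have "\<dots> \<longleftrightarrow> (\<exists>x\<in>carrier G. \<exists>y\<in>carrier G. a \<otimes> x = c \<otimes> y \<and> b \<otimes> x = d \<otimes> y)"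
    unfolding ore_frac_def by simp
  finally show ?thesis .
qed

lemma frac_mult_welldef:
  assumes [simp]: "a \<in> carrier G" "b \<in> carrier G" "c \<in> carrier G" "d \<in> carrier G"
      "x \<in> carrier G" "y \<in> carrier G" "x' \<in> carrier G" "y' \<in> carrier G"
    and ab: "(a', b') \<in> ore_frac G a b" and cd: "(c', d') \<in> ore_frac G c d"
    and h: "b \<otimes> x = c \<otimes> y" and h': "b' \<otimes> x' = c' \<otimes> y'"
  shows "ore_frac G (a' \<otimes> x') (d' \<otimes> y') = ore_frac G (a \<otimes> x) (d \<otimes> y)"
proof -
  have [simp]: "a' \<in> carrier G" "b' \<in> carrier G" "c' \<in> carrier G" "d' \<in> carrier G"
    using ab cd by (auto simp: ore_frac_def)
  obtain p q where [simp]: "p \<in> carrier G" "q \<in> carrier G"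
    and k: "(d \<otimes> y) \<otimes> p = (d' \<otimes> y') \<otimes> q"
    using common_right_multiple[of "d \<otimes> y" "d' \<otimes> y'"] by auto
  have "c \<otimes> (y \<otimes> p) = c' \<otimes> (y' \<otimes> q)"
    using cd k by (simp add: mem_frac m_assoc)
  then have "b \<otimes> (x \<otimes> p) = b' \<otimes> (x' \<otimes> q)"
    using h h' by (simp add: m_assoc[symmetric])
  then have "a \<otimes> (x \<otimes> p) = a' \<otimes> (x' \<otimes> q)"
    using ab by (simp add: mem_frac)
  then have "(a' \<otimes> x') \<otimes> q = (a \<otimes> x) \<otimes> p" by (simp add: m_assoc)
  with k[symmetric] show ?thesis
    using \<open>p \<in> carrier G\<close> \<open>q \<in> carrier G\<close> by (subst frac_eq_iff) (simp, simp, simp, simp, rule bexI[of _ q], rule bexI[of _ p], simp_all)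
qed

lemma frac_mult:
  assumes [simp]: "a \<in> carrier G" "b \<in> carrier G" "c \<in> carrier G" "d \<in> carrier G"
      "x \<in> carrier G" "y \<in> carrier G"
    and h: "b \<otimes> x = c \<otimes> y"
  shows "ore_frac G a b \<otimes>\<^bsub>quot_group G\<^esub> ore_frac G c d = ore_frac G (a \<otimes> x) (d \<otimes> y)"
proof -
  have "{ore_frac G (a' \<otimes> x') (d' \<otimes> y') | a' b' c' d' x' y'. (a', b') \<in> ore_frac G a b \<and>
      (c', d') \<in> ore_frac G c d \<and> x' \<in> carrier G \<and> y' \<in> carrier G \<and> b' \<otimes> x' = c' \<otimes> y'}
    = {ore_frac G (a \<otimes> x) (d \<otimes> y)}" (is "?S = _")
  proof (intro equalityI subsetI)
    fix X assume "X \<in> ?S"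
    then obtain a' b' c' d' x' y' where X: "X = ore_frac G (a' \<otimes> x') (d' \<otimes> y')"
      "(a', b') \<in> ore_frac G a b" "(c', d') \<in> ore_frac G c d" "x' \<in> carrier G" "y' \<in> carrier G"
      "b' \<otimes> x' = c' \<otimes> y'" by blast
    show "X \<in> {ore_frac G (a \<otimes> x) (d \<otimes> y)}"
      using frac_mult_welldef[OF assms(1-6) X(4,5) X(2,3) h X(6)] X(1) by simp
  next
    fix X assume "X \<in> {ore_frac G (a \<otimes> x) (d \<otimes> y)}"
    then show "X \<in> ?S"
      using h frac_refl[of a b] frac_refl[of c d] assms(1-6) by blast
  qed
  then show ?thesis unfolding quot_group_def by simp
qed

lemma quot_group_is_group: "group (quot_group G)"
proof (rule groupI)
  have car: "X \<in> carrier (quot_group G) \<longleftrightarrow> (\<exists>a\<in>carrier G. \<exists>b\<in>carrier G. X = ore_frac G a b)" for X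
    unfolding quot_group_def by auto
  have one: "\<one>\<^bsub>quot_group G\<^esub> = ore_frac G \<one> \<one>"
    unfolding quot_group_def by simp
  show "\<one>\<^bsub>quot_group G\<^esub> \<in> carrier (quot_group G)"
    unfolding car one by blast
  fix X assume "X \<in> carrier (quot_group G)"
  then obtain a b where [simp]: "a \<in> carrier G" "b \<in> carrier G" and X: "X = ore_frac G a b"
    unfolding car by auto
  show "\<one>\<^bsub>quot_group G\<^esub> \<otimes>\<^bsub>quot_group G\<^esub> X = X"
    unfolding X one using frac_mult[of \<one> \<one> a b a \<one>] by simp
  have "ore_frac G b a \<otimes>\<^bsub>quot_group G\<^esub> ore_frac G a b = ore_frac G b b"
    using frac_mult[of b a a b \<one> \<one>] by simp
  also have "\<dots> = ore_frac G \<one> \<one>"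
    using frac_eq_iff[of b b \<one> \<one>] by force
  finally show "\<exists>Y\<in>carrier (quot_group G). Y \<otimes>\<^bsub>quot_group G\<^esub> X = \<one>\<^bsub>quot_group G\<^esub>"
    unfolding X one car by (intro bexI[of _ "ore_frac G b a"]) (simp, unfold car, blast intro: \<open>a \<in> carrier G\<close> \<open>b \<in> carrier G\<close>)
  fix Y assume "Y \<in> carrier (quot_group G)"
  then obtain c d where [simp]: "c \<in> carrier G" "d \<in> carrier G" and Y: "Y = ore_frac G c d"
    unfolding car by auto
  obtain x y where [simp]: "x \<in> carrier G" "y \<in> carrier G" and h: "b \<otimes> x = c \<otimes> y"
    using common_right_multiple[of b c] by auto
  have XY: "X \<otimes>\<^bsub>quot_group G\<^esub> Y = ore_frac G (a \<otimes> x) (d \<otimes> y)"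
    unfolding X Y using h by (simp add: frac_mult)
  then show "X \<otimes>\<^bsub>quot_group G\<^esub> Y \<in> carrier (quot_group G)"
    unfolding car by force
  fix Z assume "Z \<in> carrier (quot_group G)"
  then obtain e f where [simp]: "e \<in> carrier G" "f \<in> carrier G" and Z: "Z = ore_frac G e f"
    unfolding car by auto
  obtain z w where [simp]: "z \<in> carrier G" "w \<in> carrier G" and k: "(d \<otimes> y) \<otimes> z = e \<otimes> w"
    using common_right_multiple[of "d \<otimes> y" e] by auto
  have YZ: "Y \<otimes>\<^bsub>quot_group G\<^esub> Z = ore_frac G (c \<otimes> (y \<otimes> z)) (f \<otimes> w)"
    unfolding Y Z using k by (simp add: frac_mult m_assoc)
  have "X \<otimes>\<^bsub>quot_group G\<^esub> Y \<otimes>\<^bsub>quot_group G\<^esub> Z = ore_frac G (a \<otimes> x \<otimes> z) (f \<otimes> w)"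
    unfolding XY unfolding Z using k by (simp add: frac_mult)
  moreover have "b \<otimes> (x \<otimes> z) = c \<otimes> (y \<otimes> z) \<otimes> \<one>"
    using h by (simp add: m_assoc[symmetric])
  then have "X \<otimes>\<^bsub>quot_group G\<^esub> (Y \<otimes>\<^bsub>quot_group G\<^esub> Z) = ore_frac G (a \<otimes> (x \<otimes> z)) (f \<otimes> w \<otimes> \<one>)"
    unfolding YZ unfolding X by (intro frac_mult) simp_all
  ultimately show "X \<otimes>\<^bsub>quot_group G\<^esub> Y \<otimes>\<^bsub>quot_group G\<^esub> Z
      = X \<otimes>\<^bsub>quot_group G\<^esub> (Y \<otimes>\<^bsub>quot_group G\<^esub> Z)"
    by (simp add: m_assoc)
qed

lemma quot_emb_hom: "quot_emb G \<in> hom G (quot_group G)"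
proof (rule homI)
  fix a b assume [simp]: "a \<in> carrier G" "b \<in> carrier G"
  show "quot_emb G a \<in> carrier (quot_group G)"
    unfolding quot_emb_def quot_group_def by force
  show "quot_emb G (a \<otimes> b) = quot_emb G a \<otimes>\<^bsub>quot_group G\<^esub> quot_emb G b"
    unfolding quot_emb_def using frac_mult[of a \<one> b \<one> b \<one>] by simp
qed

lemma quot_emb_closed: "a \<in> carrier G \<Longrightarrow> quot_emb G a \<in> carrier (quot_group G)"
  using quot_emb_hom by (auto simp: hom_def)

lemma quot_emb_mult: "a \<in> carrier G \<Longrightarrow> b \<in> carrier G \<Longrightarrow>
    quot_emb G (a \<otimes> b) = quot_emb G a \<otimes>\<^bsub>quot_group G\<^esub> quot_emb G b"
  using quot_emb_hom by (auto simp: hom_def)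

lemma quot_emb_inj: "inj_on (quot_emb G) (carrier G)"
proof (rule inj_onI)
  fix a b assume *: "a \<in> carrier G" "b \<in> carrier G" and "quot_emb G a = quot_emb G b"
  then obtain x where "x \<in> carrier G" "a \<otimes> x = b \<otimes> x"
    unfolding quot_emb_def by (auto simp: frac_eq_iff)
  with * show "a = b" by (metis r_cancel)
qed

lemma frac_eq:
  assumes [simp]: "a \<in> carrier G" "b \<in> carrier G"
  shows "ore_frac G a b = quot_emb G a \<otimes>\<^bsub>quot_group G\<^esub> inv\<^bsub>quot_group G\<^esub> quot_emb G b"
proof -
  interpret Q: group "quot_group G" by (rule quot_group_is_group)
  have car: "ore_frac G c d \<in> carrier (quot_group G)" if "c \<in> carrier G" "d \<in> carrier G" for c d
    using that unfolding quot_group_def by auto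
  have "ore_frac G a b \<otimes>\<^bsub>quot_group G\<^esub> quot_emb G b = quot_emb G a"
    unfolding quot_emb_def using frac_mult[of a b b \<one> \<one> \<one>] by simp
  then show ?thesis
    using car[of a b] quot_emb_closed[of a] quot_emb_closed[of b]
    by (metis Q.inv_solve_right assms)
qed

lemma carrier_quot_group_right:
  "carrier (quot_group G) = {quot_emb G a \<otimes>\<^bsub>quot_group G\<^esub> inv\<^bsub>quot_group G\<^esub> quot_emb G b | a b.
     a \<in> carrier G \<and> b \<in> carrier G}"
proof -
  have "carrier (quot_group G) = {ore_frac G a b | a b. a \<in> carrier G \<and> b \<in> carrier G}"
    by (simp add: quot_group_def)
  also have "\<dots> = (\<lambda>(a, b). ore_frac G a b) ` (carrier G \<times> carrier G)"
    by auto
  also have "\<dots> = (\<lambda>(a, b). quot_emb G a \<otimes>\<^bsub>quot_group G\<^esub> inv\<^bsub>quot_group G\<^esub> quot_emb G b)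
      ` (carrier G \<times> carrier G)"
    by (rule image_cong) (auto simp: frac_eq)
  finally show ?thesis by auto
qed

lemma carrier_quot_group_left:
  "carrier (quot_group G) = {inv\<^bsub>quot_group G\<^esub> quot_emb G a \<otimes>\<^bsub>quot_group G\<^esub> quot_emb G b | a b.
     a \<in> carrier G \<and> b \<in> carrier G}"
proof -
  interpret Q: group "quot_group G" by (rule quot_group_is_group)
  note cl = quot_emb_closed
  have "\<exists>c\<in>carrier G. \<exists>d\<in>carrier G. quot_emb G a \<otimes>\<^bsub>quot_group G\<^esub> inv\<^bsub>quot_group G\<^esub> quot_emb G b
      = inv\<^bsub>quot_group G\<^esub> quot_emb G c \<otimes>\<^bsub>quot_group G\<^esub> quot_emb G d"
    if [simp]: "a \<in> carrier G" "b \<in> carrier G" for a b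
  proof -
    obtain c d where [simp]: "c \<in> carrier G" "d \<in> carrier G" and h: "c \<otimes> a = d \<otimes> b"
      using common_left_multiple[of a b] by auto
    have e: "quot_emb G c \<otimes>\<^bsub>quot_group G\<^esub> quot_emb G a
        = quot_emb G d \<otimes>\<^bsub>quot_group G\<^esub> quot_emb G b"
      by (simp add: h quot_emb_mult[symmetric])
    have "quot_emb G c \<otimes>\<^bsub>quot_group G\<^esub> (quot_emb G a \<otimes>\<^bsub>quot_group G\<^esub> inv\<^bsub>quot_group G\<^esub> quot_emb G b)
        = quot_emb G d"
      by (simp add: cl e Q.m_assoc[symmetric]) (simp add: cl Q.m_assoc)
    then have "quot_emb G a \<otimes>\<^bsub>quot_group G\<^esub> inv\<^bsub>quot_group G\<^esub> quot_emb G b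
        = inv\<^bsub>quot_group G\<^esub> quot_emb G c \<otimes>\<^bsub>quot_group G\<^esub> quot_emb G d"
      by (subst Q.inv_solve_left) (simp_all add: cl)
    then show ?thesis by (metis \<open>c \<in> carrier G\<close> \<open>d \<in> carrier G\<close>)
  qed
  note * = this
  show ?thesis
  proof (intro equalityI subsetI)
    fix X assume "X \<in> carrier (quot_group G)"
    then show "X \<in> {inv\<^bsub>quot_group G\<^esub> quot_emb G a \<otimes>\<^bsub>quot_group G\<^esub> quot_emb G b | a b.
        a \<in> carrier G \<and> b \<in> carrier G}"
      using * unfolding carrier_quot_group_right by blast
  qed (auto simp: cl)
qed

end


section \<open>Krull monoids\<close>

definition lcolon :: "('a, 'm) monoid_scheme \<Rightarrow> 'a set \<Rightarrow> 'a set \<Rightarrow> 'a set" where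
  "lcolon Q A B = {x \<in> carrier Q. x <#\<^bsub>Q\<^esub> B \<subseteq> A}"

definition rcolon :: "('a, 'm) monoid_scheme \<Rightarrow> 'a set \<Rightarrow> 'a set \<Rightarrow> 'a set" where
  "rcolon Q A B = {x \<in> carrier Q. B #>\<^bsub>Q\<^esub> x \<subseteq> A}"

definition monoid_ideal :: "('a, 'm) monoid_scheme \<Rightarrow> 'a set \<Rightarrow> bool" where
  "monoid_ideal H I \<longleftrightarrow> I \<subseteq> carrier H \<and> carrier H <#>\<^bsub>H\<^esub> I = I \<and> I <#>\<^bsub>H\<^esub> carrier H = I"

definition divisorial_ideal :: "('a, 'm) monoid_scheme \<Rightarrow> 'a set \<Rightarrow> bool" where
  "divisorial_ideal H I \<longleftrightarrow> monoid_ideal H I \<and>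
     (let Q = quot_group H; H' = quot_emb H ` carrier H; I' = quot_emb H ` I in
        I' = lcolon Q H' (rcolon Q H' I') \<and> I' = rcolon Q H' (lcolon Q H' I'))"

definition krull_monoid :: "('a, 'm) monoid_scheme \<Rightarrow> bool" where
  "krull_monoid H \<longleftrightarrow> ore_monoid H \<and>
     (\<forall>I. monoid_ideal H I \<and> I \<noteq> {} \<longrightarrow>
        lcolon (quot_group H) (quot_emb H ` I) (quot_emb H ` I) = quot_emb H ` carrier H \<and>
        rcolon (quot_group H) (quot_emb H ` I) (quot_emb H ` I) = quot_emb H ` carrier H) \<and>
     (\<forall>I :: nat \<Rightarrow> 'a set. (\<forall>n. divisorial_ideal H (I n) \<and> I n \<subseteq> I (Suc n)) \<longrightarrow>
        (\<exists>n. \<forall>m\<ge>n. I m = I n))"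


section \<open>Homomorphisms, free abelian monoids and class groups\<close>

definition monoid_hom ::
    "('a, 'm) monoid_scheme \<Rightarrow> ('b, 'n) monoid_scheme \<Rightarrow> ('a \<Rightarrow> 'b) \<Rightarrow> bool" where
  "monoid_hom H D f \<longleftrightarrow> f \<in> hom H D \<and> f \<one>\<^bsub>H\<^esub> = \<one>\<^bsub>D\<^esub>"

definition ldivides :: "('a, 'm) monoid_scheme \<Rightarrow> 'a \<Rightarrow> 'a \<Rightarrow> bool" where
  "ldivides H a b \<longleftrightarrow> b \<in> a <#\<^bsub>H\<^esub> carrier H"

definition rdivides :: "('a, 'm) monoid_scheme \<Rightarrow> 'a \<Rightarrow> 'a \<Rightarrow> bool" where
  "rdivides H a b \<longleftrightarrow> b \<in> carrier H #>\<^bsub>H\<^esub> a"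

definition divisor_hom ::
    "('a, 'm) monoid_scheme \<Rightarrow> ('b, 'n) monoid_scheme \<Rightarrow> ('a \<Rightarrow> 'b) \<Rightarrow> bool" where
  "divisor_hom H D f \<longleftrightarrow> monoid_hom H D f \<and>
     (\<forall>u\<in>carrier H. \<forall>v\<in>carrier H.
        (ldivides D (f u) (f v) \<longrightarrow> ldivides H u v) \<and>
        (rdivides D (f u) (f v) \<longrightarrow> rdivides H u v))"

definition transfer_hom ::
    "('a, 'm) monoid_scheme \<Rightarrow> ('b, 'n) monoid_scheme \<Rightarrow> ('a \<Rightarrow> 'b) \<Rightarrow> bool" where
  "transfer_hom H B f \<longleftrightarrow> ore_monoid B \<and> reduced B \<and> monoid_hom H B f \<and>
     f ` carrier H = carrier B \<and> {a \<in> carrier H. f a = \<one>\<^bsub>B\<^esub>} = Units H \<and>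
     (\<forall>a\<in>carrier H. \<forall>b1\<in>carrier B. \<forall>b2\<in>carrier B. f a = b1 \<otimes>\<^bsub>B\<^esub> b2 \<longrightarrow>
        (\<exists>a1\<in>carrier H. \<exists>a2\<in>carrier H. a = a1 \<otimes>\<^bsub>H\<^esub> a2 \<and> f a1 = b1 \<and> f a2 = b2))"

definition free_monoid :: "'p set \<Rightarrow> 'p multiset monoid" where
  "free_monoid P = \<lparr>carrier = {S. set_mset S \<subseteq> P}, monoid.mult = (+), one = {#}\<rparr>"

lemma free_monoid_simps [simp]:
  "carrier (free_monoid P) = {S. set_mset S \<subseteq> P}"
  "S \<otimes>\<^bsub>free_monoid P\<^esub> T = S + T"
  "\<one>\<^bsub>free_monoid P\<^esub> = {#}"
  by (simp_all add: free_monoid_def)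

lemma comm_monoid_free_monoid: "comm_monoid (free_monoid P)"
  by (rule comm_monoidI) (auto simp: ac_simps)

lemma ore_monoid_free_monoid: "ore_monoid (free_monoid P)"
proof -
  interpret comm_monoid "free_monoid P" by (rule comm_monoid_free_monoid)
  show ?thesis
  proof unfold_locales
    fix S T assume ST: "S \<in> carrier (free_monoid P)" "T \<in> carrier (free_monoid P)"
    have "S + T \<in> carrier (free_monoid P) #>\<^bsub>free_monoid P\<^esub> S"
      "S + T \<in> carrier (free_monoid P) #>\<^bsub>free_monoid P\<^esub> T"
      "S + T \<in> S <#\<^bsub>free_monoid P\<^esub> carrier (free_monoid P)"
      "S + T \<in> T <#\<^bsub>free_monoid P\<^esub> carrier (free_monoid P)"
      using ST by (force simp: r_coset_def l_coset_def add.commute[of S T])+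
    then show "(carrier (free_monoid P) #>\<^bsub>free_monoid P\<^esub> S)
        \<inter> (carrier (free_monoid P) #>\<^bsub>free_monoid P\<^esub> T) \<noteq> {}"
      "(S <#\<^bsub>free_monoid P\<^esub> carrier (free_monoid P))
        \<inter> (T <#\<^bsub>free_monoid P\<^esub> carrier (free_monoid P)) \<noteq> {}"
      by blast+
  qed auto
qed

text \<open>The quotient group of \<open>f(H)\<close>, as a subgroup of the quotient group of \<open>D\<close>.\<close>

definition class_kernel ::
    "('a, 'm) monoid_scheme \<Rightarrow> ('b, 'n) monoid_scheme \<Rightarrow> ('a \<Rightarrow> 'b) \<Rightarrow> ('b \<times> 'b) set set" where
  "class_kernel H D f =
     {quot_emb D (f a) \<otimes>\<^bsub>quot_group D\<^esub> inv\<^bsub>quot_group D\<^esub> quot_emb D (f b) | a b.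
        a \<in> carrier H \<and> b \<in> carrier H}"

text \<open>The class group is usually written additively; here it is a (commutative) group in the
  multiplicative notation of the library, so that its zero element is \<^term>\<open>\<one>\<^bsub>class_group H P f\<^esub>\<close>.\<close>

definition class_group ::
    "('a, 'm) monoid_scheme \<Rightarrow> 'p set \<Rightarrow> ('a \<Rightarrow> 'p multiset)
      \<Rightarrow> ('p multiset \<times> 'p multiset) set set monoid" where
  "class_group H P f = quot_group (free_monoid P) Mod class_kernel H (free_monoid P) f"

lemma quot_group_free_monoid: "comm_group (quot_group (free_monoid P))"
proof -
  interpret F: ore_monoid "free_monoid P" by (rule ore_monoid_free_monoid)
  interpret Q: group "quot_group (free_monoid P)" by (rule F.quot_group_is_group)
  show ?thesis
  proof (rule Q.group_comm_groupI)
    fix X Y assume "X \<in> carrier (quot_group (free_monoid P))" "Y \<in> carrier (quot_group (free_monoid P))"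
    then obtain a b c d where *: "set_mset a \<subseteq> P" "set_mset b \<subseteq> P" "set_mset c \<subseteq> P" "set_mset d \<subseteq> P"
      "X = ore_frac (free_monoid P) a b" "Y = ore_frac (free_monoid P) c d"
      unfolding quot_group_def by auto
    then show "X \<otimes>\<^bsub>quot_group (free_monoid P)\<^esub> Y = Y \<otimes>\<^bsub>quot_group (free_monoid P)\<^esub> X"
      using F.frac_mult[of a b c d c b] F.frac_mult[of c d a b a d] by (simp add: ac_simps)
  qed
qed

lemma class_group_is_comm_group:
  assumes "monoid H" and f: "monoid_hom H (free_monoid P) f"
  shows "comm_group (class_group H P f)"
proof -
  interpret H: monoid H by fact
  interpret F: ore_monoid "free_monoid P" by (rule ore_monoid_free_monoid)
  interpret Q: comm_group "quot_group (free_monoid P)" by (rule quot_group_free_monoid)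
  let ?e = "\<lambda>a. quot_emb (free_monoid P) (f a)"
  have cl: "?e a \<in> carrier (quot_group (free_monoid P))" if "a \<in> carrier H" for a
    using that f F.quot_emb_closed unfolding monoid_hom_def hom_def by blast
  have mu: "?e (a \<otimes>\<^bsub>H\<^esub> b) = ?e a \<otimes>\<^bsub>quot_group (free_monoid P)\<^esub> ?e b"
    if "a \<in> carrier H" "b \<in> carrier H" for a b
  proof -
    have "f (a \<otimes>\<^bsub>H\<^esub> b) = f a \<otimes>\<^bsub>free_monoid P\<^esub> f b"
      "f a \<in> carrier (free_monoid P)" "f b \<in> carrier (free_monoid P)"
      using f that unfolding monoid_hom_def hom_def by blast+
    then show ?thesis using F.quot_emb_mult by metis
  qed
  have "subgroup (class_kernel H (free_monoid P) f) (quot_group (free_monoid P))"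
  proof (rule Q.subgroupI)
    show "class_kernel H (free_monoid P) f \<subseteq> carrier (quot_group (free_monoid P))"
      unfolding class_kernel_def using cl by auto
    show "class_kernel H (free_monoid P) f \<noteq> {}"
      unfolding class_kernel_def using H.one_closed by blast
  next
    fix X assume "X \<in> class_kernel H (free_monoid P) f"
    then obtain a b where ab: "a \<in> carrier H" "b \<in> carrier H"
      and X: "X = ?e a \<otimes>\<^bsub>quot_group (free_monoid P)\<^esub> inv\<^bsub>quot_group (free_monoid P)\<^esub> ?e b"
      unfolding class_kernel_def by auto
    have "inv\<^bsub>quot_group (free_monoid P)\<^esub> X
        = ?e b \<otimes>\<^bsub>quot_group (free_monoid P)\<^esub> inv\<^bsub>quot_group (free_monoid P)\<^esub> ?e a"
      unfolding X using ab cl by (simp add: Q.inv_mult_group)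
    with ab show "inv\<^bsub>quot_group (free_monoid P)\<^esub> X \<in> class_kernel H (free_monoid P) f"
      unfolding class_kernel_def by blast
  next
    fix X Y assume "X \<in> class_kernel H (free_monoid P) f" "Y \<in> class_kernel H (free_monoid P) f"
    then obtain a b c d where *: "a \<in> carrier H" "b \<in> carrier H" "c \<in> carrier H" "d \<in> carrier H"
      and X: "X = ?e a \<otimes>\<^bsub>quot_group (free_monoid P)\<^esub> inv\<^bsub>quot_group (free_monoid P)\<^esub> ?e b"
      and Y: "Y = ?e c \<otimes>\<^bsub>quot_group (free_monoid P)\<^esub> inv\<^bsub>quot_group (free_monoid P)\<^esub> ?e d"
      unfolding class_kernel_def by auto
    have "X \<otimes>\<^bsub>quot_group (free_monoid P)\<^esub> Y
        = ?e (a \<otimes>\<^bsub>H\<^esub> c) \<otimes>\<^bsub>quot_group (free_monoid P)\<^esub> inv\<^bsub>quot_group (free_monoid P)\<^esub> ?e (b \<otimes>\<^bsub>H\<^esub> d)"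
      unfolding X Y using * cl by (simp add: mu Q.inv_mult Q.m_ac)
    moreover have "a \<otimes>\<^bsub>H\<^esub> c \<in> carrier H" "b \<otimes>\<^bsub>H\<^esub> d \<in> carrier H" using * by simp_all
    ultimately show "X \<otimes>\<^bsub>quot_group (free_monoid P)\<^esub> Y \<in> class_kernel H (free_monoid P) f"
      unfolding class_kernel_def by blast
  qed
  then show ?thesis
    unfolding class_group_def by (rule Q.abelian_FactGroup)
qed

definition prime_class ::
    "('a, 'm) monoid_scheme \<Rightarrow> 'p set \<Rightarrow> ('a \<Rightarrow> 'p multiset)
      \<Rightarrow> 'p \<Rightarrow> ('p multiset \<times> 'p multiset) set set" where
  "prime_class H P f p =
     class_kernel H (free_monoid P) f #>\<^bsub>quot_group (free_monoid P)\<^esub> quot_emb (free_monoid P) {#p#}"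

definition prime_classes ::
    "('a, 'm) monoid_scheme \<Rightarrow> 'p set \<Rightarrow> ('a \<Rightarrow> 'p multiset)
      \<Rightarrow> ('p multiset \<times> 'p multiset) set set set" where
  "prime_classes H P f = prime_class H P f ` P"

definition beta_tilde ::
    "('a, 'm) monoid_scheme \<Rightarrow> 'p set \<Rightarrow> ('a \<Rightarrow> 'p multiset)
      \<Rightarrow> 'p multiset \<Rightarrow> ('p multiset \<times> 'p multiset) set set multiset" where
  "beta_tilde H P f = image_mset (prime_class H P f)"

lemma beta_tilde_hom:
  "monoid_hom (free_monoid P) (free_monoid (prime_classes H P f)) (beta_tilde H P f)"
  by (auto simp: monoid_hom_def hom_def beta_tilde_def prime_classes_def subset_iff)

lemma beta_tilde_unique:
  assumes g: "monoid_hom (free_monoid P) (free_monoid (prime_classes H P f)) g"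
    and gp: "\<And>p. p \<in> P \<Longrightarrow> g {#p#} = {#prime_class H P f p#}"
    and "S \<in> carrier (free_monoid P)"
  shows "g S = beta_tilde H P f S"
  using \<open>S \<in> carrier (free_monoid P)\<close>
proof (induction S)
  case empty
  then show ?case using g by (simp add: monoid_hom_def beta_tilde_def)
next
  case (add p S)
  have "g ({#p#} + S) = g {#p#} + g S"
    using g add.prems unfolding monoid_hom_def hom_def by (simp del: union_mset_add_mset_left)
  with add gp show ?case by (simp add: beta_tilde_def)
qed


section \<open>Zero-sum sequences\<close>

text \<open>The sum $\sigma(S) = g_1 + \dots + g_l$ of a sequence over a commutative group, which is written
  multiplicatively.\<close>

definition sigma :: "('g, 'm) monoid_scheme \<Rightarrow> 'g multiset \<Rightarrow> 'g" where
  "sigma G S = (\<Otimes>\<^bsub>G\<^esub>g\<in>set_mset S. g [^]\<^bsub>G\<^esub> count S g)"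

definition block_monoid :: "('g, 'm) monoid_scheme \<Rightarrow> 'g set \<Rightarrow> 'g multiset monoid" where
  "block_monoid G G0 = free_monoid G0
     \<lparr>carrier := {S \<in> carrier (free_monoid G0). sigma G S = \<one>\<^bsub>G\<^esub>}\<rparr>"

definition atoms :: "('a, 'm) monoid_scheme \<Rightarrow> 'a set" where
  "atoms H = {a \<in> carrier H - Units H. \<forall>u\<in>carrier H. \<forall>v\<in>carrier H.
     a = u \<otimes>\<^bsub>H\<^esub> v \<longrightarrow> u \<in> Units H \<or> v \<in> Units H}"

definition davenport :: "('g, 'm) monoid_scheme \<Rightarrow> 'g set \<Rightarrow> enat" where
  "davenport G G0 = (SUP U\<in>atoms (block_monoid G G0). enat (size U))"


section \<open>Sets of lengths\<close>

definition lengths :: "('a, 'm) monoid_scheme \<Rightarrow> 'a \<Rightarrow> nat set" where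
  "lengths H a = (if a \<in> Units H then {0}
     else {k. k \<ge> 1 \<and> (\<exists>us. length us = k \<and> set us \<subseteq> atoms H \<and>
                          a = foldr (\<otimes>\<^bsub>H\<^esub>) us \<one>\<^bsub>H\<^esub>)})"

definition atomic_monoid :: "('a, 'm) monoid_scheme \<Rightarrow> bool" where
  "atomic_monoid H \<longleftrightarrow> (\<forall>a\<in>carrier H. lengths H a \<noteq> {})"

definition bf_monoid :: "('a, 'm) monoid_scheme \<Rightarrow> bool" where
  "bf_monoid H \<longleftrightarrow> (\<forall>a\<in>carrier H. finite (lengths H a) \<and> lengths H a \<noteq> {})"

definition length_sets :: "('a, 'm) monoid_scheme \<Rightarrow> nat set set" where
  "length_sets H = lengths H ` carrier H"

definition set_elasticity :: "nat set \<Rightarrow> real" where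
  "set_elasticity L = (if L = {0} then 1 else real (Max L) / real (Min L))"

definition set_distances :: "nat set \<Rightarrow> nat set" where
  "set_distances L = {l - k | k l. k \<in> L \<and> l \<in> L \<and> k < l \<and> L \<inter> {k<..<l} = {}}"

text \<open>As usual, elasticity and set of distances are meaningful for BF-monoids only.\<close>

definition elasticity :: "('a, 'm) monoid_scheme \<Rightarrow> ereal" where
  "elasticity H = (SUP L\<in>length_sets H. ereal (set_elasticity L))"

definition distances :: "('a, 'm) monoid_scheme \<Rightarrow> nat set" where
  "distances H = (\<Union>L\<in>length_sets H. set_distances L)"

definition periodic_set :: "int set \<Rightarrow> nat \<Rightarrow> int set" where
  "periodic_set D d = {x + int d * k | x k. x \<in> D}"

definition AAMP :: "nat \<Rightarrow> int set \<Rightarrow> nat \<Rightarrow> int set \<Rightarrow> bool" where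
  "AAMP d D M L \<longleftrightarrow> d \<ge> 1 \<and> {0, int d} \<subseteq> D \<and> D \<subseteq> {0..int d} \<and>
     (\<exists>y L1 L2 L3. L = (+) y ` (L1 \<union> L2 \<union> L3) \<and> L \<subseteq> (+) y ` periodic_set D d \<and>
        finite L2 \<and> L2 \<noteq> {} \<and> Min L2 = 0 \<and> L2 = periodic_set D d \<inter> {0..Max L2} \<and>
        L1 \<subseteq> {- int M..-1} \<and> L3 \<subseteq> {Max L2 + 1..Max L2 + int M})"

definition structure_theorem_holds :: "('a, 'm) monoid_scheme \<Rightarrow> nat \<Rightarrow> nat set \<Rightarrow> bool" where
  "structure_theorem_holds H M \<Delta> \<longleftrightarrow> atomic_monoid H \<and> finite \<Delta> \<and> \<Delta> \<noteq> {} \<and> 0 \<notin> \<Delta> \<and>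
     (\<forall>L\<in>length_sets H. \<exists>d\<in>\<Delta>. \<exists>D. AAMP d D M (int ` L))"

end

theory Submission imports Defs begin

text \<open>
The BF-property. In a Krull monoid the left and the right inverse of a fractional two-sided ideal coincide,
and every fractional ideal is invertible for the product followed by the divisorial closure
\<open>v\<close>. Let \<open>J\<close> be the divisorial ideal generated by a non-unit \<open>a\<close>. If
\<open>a\<close> is a product of \<open>k\<close> elements, each inside a proper divisorial ideal, then \<open>J\<close> lies in the
\<open>v\<close>-closure of a product of \<open>k\<close> proper divisorial ideals, and it suffices to bound \<open>k\<close> in terms
of \<open>J\<close> (\<open>ideal_factor_bound\<close>). By the ascending chain condition this can be done by
induction: if \<open>M\<close> is maximal above \<open>J\<close>, then \<open>(J M\<^sup>-\<^sup>1)\<^sub>v\<close> is strictly larger than \<open>J\<close>, and cancelling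
\<open>M\<close> costs at most one of the \<open>k\<close> factors. Maximal divisorial ideals are prime, and a product
outside \<open>M\<close> satisfies \<open>P\<^sub>v \<inter> M \<subseteq> (P M)\<^sub>v\<close> (\<open>comaximal_inter\<close>); this replaces
commutativity when \<open>M\<close> has to be moved to the right end of a product. A factorization into
the largest possible number of non-units consists of atoms.

The transfer homomorphism. The sum of the class sequence of \<open>\<alpha>\<close> is the class of \<open>\<alpha>\<close>, which is trivial iff
\<open>\<alpha> \<phi>(b) = \<phi>(a)\<close> for some \<open>a, b\<close>; as \<open>\<phi>\<close> is a divisor homomorphism, this means
\<open>\<alpha> \<in> \<phi>(H)\<close>. Splitting a zero-sum sequence lifts to a splitting of \<open>\<phi>(a)\<close> and, by the same
criterion, to a splitting of \<open>a\<close>.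

Sets of lengths. Transfer homomorphisms preserve sets of lengths (\<open>transfer_hom_lengths\<close>), so one
works in the monoid of zero-sum sequences, where all atoms have length at most \<open>N\<close> although there
may be infinitely many of them. Any two factorizations of an element are linked by exchanges that
take place inside divisors of size at most \<open>N\<^sup>2\<close> (\<open>swap_chain\<close>), and a factorization can be
changed in a bounded way so as to contain a factorization of a given bounded divisor
(\<open>absorb\<close>). Hence distances are at most \<open>N\<^sup>2\<close>, and:

\<^item> If a set of lengths is wide, one can split off many disjoint bounded divisors having two lengths
  each. By the pigeonhole principle some distance \<open>d\<close> occurs often, and the product of the
  corresponding divisors is a bounded divisor whose lengths contain a long progression with
  difference \<open>d\<close> (\<open>long_progression\<close>).

\<^item> Among the bounded divisors \<open>b\<close> of \<open>S\<close> one can choose one whose lengths occupy as many residue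
  classes as possible modulo \<open>(N\<^sup>2)!\<close>. Maximality forces all residues of lengths of \<open>S\<close> to be those
  of lengths of \<open>b\<close> plus one constant (\<open>length_residues\<close>).

Multiplying \<open>b\<close>, the divisor with the long progression, and the remaining cofactor, whose lengths
have bounded gaps, one obtains every integer in the middle that is congruent to a length modulo
\<open>d\<close> (\<open>middle_periodic\<close>). This is the shape of an AAMP with difference \<open>d\<close>; sets of lengths that
are not wide are AAMPs for trivial reasons.
\<close>

section \<open>Divisorial ideals of a maximal order\<close>

locale order_in_group = group Q for Q (structure) +
  fixes H :: "'a set"
  assumes H_sub: "H \<subseteq> carrier Q"
    and one_H: "\<one> \<in> H"
    and mult_H: "x \<in> H \<Longrightarrow> y \<in> H \<Longrightarrow> x \<otimes> y \<in> H"
begin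

definition two_sided :: "'a set \<Rightarrow> bool" where
  "two_sided F \<longleftrightarrow> F \<subseteq> carrier Q \<and> F \<noteq> {} \<and> (\<forall>h\<in>H. \<forall>x\<in>F. h \<otimes> x \<in> F \<and> x \<otimes> h \<in> F)"

text \<open>The left colon set \<open>(H :\<^sub>l F)\<close>. For fractional ideals of a maximal order it is the inverse of
\<open>F\<close>, and it agrees with the right one.\<close>

definition colon :: "'a set \<Rightarrow> 'a set" where
  "colon F = {x \<in> carrier Q. \<forall>f\<in>F. x \<otimes> f \<in> H}"

abbreviation v_closure :: "'a set \<Rightarrow> 'a set" where
  "v_closure F \<equiv> colon (colon F)"

definition divisorial :: "'a set \<Rightarrow> bool" where
  "divisorial I \<longleftrightarrow> two_sided I \<and> I \<subseteq> H \<and> v_closure I = I"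

end

locale maximal_order = order_in_group +
  assumes maximal_left: "two_sided I \<Longrightarrow> I \<subseteq> H \<Longrightarrow> x \<in> carrier Q \<Longrightarrow> (\<And>i. i \<in> I \<Longrightarrow> x \<otimes> i \<in> I) \<Longrightarrow> x \<in> H"
    and maximal_right: "two_sided I \<Longrightarrow> I \<subseteq> H \<Longrightarrow> x \<in> carrier Q \<Longrightarrow> (\<And>i. i \<in> I \<Longrightarrow> i \<otimes> x \<in> I) \<Longrightarrow> x \<in> H"
begin

text \<open>Requiring a common denominator that is a two-sided ideal, in place of an element, keeps all products
two-sided.\<close>

definition fractional :: "'a set \<Rightarrow> bool" where
  "fractional F \<longleftrightarrow> two_sided F \<and>
     (\<exists>I. two_sided I \<and> I \<subseteq> H \<and> (\<forall>i\<in>I. \<forall>f\<in>F. i \<otimes> f \<in> H \<and> f \<otimes> i \<in> H))"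

lemma H_carrier: "x \<in> H \<Longrightarrow> x \<in> carrier Q"
  using H_sub by blast

lemma two_sidedD:
  assumes "two_sided F"
  shows "x \<in> F \<Longrightarrow> x \<in> carrier Q" "h \<in> H \<Longrightarrow> x \<in> F \<Longrightarrow> h \<otimes> x \<in> F" "h \<in> H \<Longrightarrow> x \<in> F \<Longrightarrow> x \<otimes> h \<in> F"
    "F \<subseteq> carrier Q" "F \<noteq> {}"
  using assms unfolding two_sided_def by auto

lemma fractionalD: "fractional F \<Longrightarrow> two_sided F"
  by (simp add: fractional_def)

lemma prodI: "x \<in> E \<Longrightarrow> y \<in> F \<Longrightarrow> x \<otimes> y \<in> E <#> F"
  unfolding set_mult_def by blast

lemma prodE:
  assumes "x \<in> E <#> F" obtains y z where "y \<in> E" "z \<in> F" "x = y \<otimes> z"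
  using assms unfolding set_mult_def by blast

lemma two_sided_prod:
  assumes E: "two_sided E" and F: "two_sided F"
  shows "two_sided (E <#> F)"
  unfolding two_sided_def
proof (intro conjI ballI)
  show "E <#> F \<subseteq> carrier Q" using E F unfolding two_sided_def by (intro set_mult_closed) auto
  show "E <#> F \<noteq> {}" using E F unfolding two_sided_def set_mult_def by blast
  fix h x assume h: "h \<in> H" and "x \<in> E <#> F"
  then obtain y z where *: "y \<in> E" "z \<in> F" "x = y \<otimes> z" by (elim prodE)
  note c = two_sidedD(1)[OF E *(1)] two_sidedD(1)[OF F *(2)] H_carrier[OF h]
  have "h \<otimes> x = (h \<otimes> y) \<otimes> z" "x \<otimes> h = y \<otimes> (z \<otimes> h)" using c *(3) by (simp_all add: m_assoc)
  then show "h \<otimes> x \<in> E <#> F" "x \<otimes> h \<in> E <#> F"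
    using prodI two_sidedD(2)[OF E h *(1)] two_sidedD(3)[OF F h *(2)] * by simp_all
qed

lemma two_sided_H: "two_sided H"
  using H_sub one_H mult_H unfolding two_sided_def by blast

lemma integral_fractional: "two_sided I \<Longrightarrow> I \<subseteq> H \<Longrightarrow> fractional I"
  using mult_H unfolding fractional_def by blast

text \<open>Multiplying a fractional ideal on the right by an ideal \<open>I\<close> that makes it integral does not
disturb left multiplication by \<open>x\<close>, so the condition on integral ideals applies.\<close>

lemma maximal_left_fractional:
  assumes F: "fractional F" and x: "x \<in> carrier Q" "\<And>f. f \<in> F \<Longrightarrow> x \<otimes> f \<in> F"
  shows "x \<in> H"
proof -
  from F obtain I where I: "two_sided I" "I \<subseteq> H" "\<And>i f. i \<in> I \<Longrightarrow> f \<in> F \<Longrightarrow> f \<otimes> i \<in> H"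
    unfolding fractional_def by blast
  note ts = fractionalD[OF F]
  show ?thesis
  proof (rule maximal_left[OF two_sided_prod[OF ts I(1)] _ x(1)])
    show "F <#> I \<subseteq> H" using I(3) by (auto elim: prodE)
    fix y assume "y \<in> F <#> I"
    then obtain f i where *: "f \<in> F" "i \<in> I" "y = f \<otimes> i" by (elim prodE)
    then have "x \<otimes> y = (x \<otimes> f) \<otimes> i" using x two_sidedD(1)[OF ts] two_sidedD(1)[OF I(1)] by (simp add: m_assoc)
    then show "x \<otimes> y \<in> F <#> I" using x(2) * prodI by simp
  qed
qed

lemma maximal_right_fractional:
  assumes F: "fractional F" and x: "x \<in> carrier Q" "\<And>f. f \<in> F \<Longrightarrow> f \<otimes> x \<in> F"
  shows "x \<in> H"
proof -
  from F obtain I where I: "two_sided I" "I \<subseteq> H" "\<And>i f. i \<in> I \<Longrightarrow> f \<in> F \<Longrightarrow> i \<otimes> f \<in> H"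
    unfolding fractional_def by blast
  note ts = fractionalD[OF F]
  show ?thesis
  proof (rule maximal_right[OF two_sided_prod[OF I(1) ts] _ x(1)])
    show "I <#> F \<subseteq> H" using I(3) by (auto elim: prodE)
    fix y assume "y \<in> I <#> F"
    then obtain i f where *: "f \<in> F" "i \<in> I" "y = i \<otimes> f" by (elim prodE)
    then have "y \<otimes> x = i \<otimes> (f \<otimes> x)" using x two_sidedD(1)[OF ts] two_sidedD(1)[OF I(1)] by (simp add: m_assoc)
    then show "y \<otimes> x \<in> I <#> F" using x(2) * prodI by simp
  qed
qed

lemma colonD: "x \<in> colon F \<Longrightarrow> x \<in> carrier Q" "x \<in> colon F \<Longrightarrow> f \<in> F \<Longrightarrow> x \<otimes> f \<in> H"
  by (auto simp: colon_def)

text \<open>The left and the right inverse of a fractional ideal coincide: if \<open>x F \<subseteq> H\<close>, then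
\<open>(f x) F \<subseteq> f H \<subseteq> F\<close> for \<open>f \<in> F\<close>, whence \<open>f x \<in> H\<close> by maximality. This is why the single
operation \<open>colon\<close> suffices.\<close>

lemma colon_right:
  assumes F: "fractional F" and x: "x \<in> carrier Q"
  shows "x \<in> colon F \<longleftrightarrow> (\<forall>f\<in>F. f \<otimes> x \<in> H)"
proof -
  note ts = two_sidedD[OF fractionalD[OF F]]
  have "f \<otimes> x \<in> H" if "x \<in> colon F" "f \<in> F" for f
  proof (rule maximal_left_fractional[OF F])
    show "f \<otimes> x \<in> carrier Q" using that(2) ts x by simp
    fix g assume "g \<in> F"
    then have "f \<otimes> (x \<otimes> g) \<in> F" using that colonD(2) ts(3) by blast
    then show "f \<otimes> x \<otimes> g \<in> F" using x ts(1) that(2) \<open>g \<in> F\<close> by (simp add: m_assoc)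
  qed
  moreover have "x \<otimes> f \<in> H" if "\<forall>g\<in>F. g \<otimes> x \<in> H" "f \<in> F" for f
  proof (rule maximal_right_fractional[OF F])
    show "x \<otimes> f \<in> carrier Q" using that(2) ts x by simp
    fix g assume "g \<in> F"
    then have "(g \<otimes> x) \<otimes> f \<in> F" using that ts(2) by blast
    then show "g \<otimes> (x \<otimes> f) \<in> F" using x ts(1) that(2) \<open>g \<in> F\<close> by (simp add: m_assoc)
  qed
  ultimately show ?thesis using x by (auto simp: colon_def)
qed

lemma fractional_colon:
  assumes F: "fractional F" shows "fractional (colon F)"
proof -
  note ts = two_sidedD[OF fractionalD[OF F]]
  from F obtain I where I: "two_sided I" "I \<subseteq> H" "\<And>i f. i \<in> I \<Longrightarrow> f \<in> F \<Longrightarrow> i \<otimes> f \<in> H \<and> f \<otimes> i \<in> H"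
    unfolding fractional_def by blast
  have "two_sided (colon F)"
    unfolding two_sided_def
  proof (intro conjI ballI)
    show "colon F \<subseteq> carrier Q" by (auto simp: colon_def)
    show "colon F \<noteq> {}" using I two_sidedD(1,5)[OF I(1)] unfolding colon_def by blast
    fix h x assume *: "h \<in> H" "x \<in> colon F"
    then show "h \<otimes> x \<in> colon F" "x \<otimes> h \<in> colon F"
      using colonD[OF *(2)] H_carrier[OF *(1)] ts mult_H by (auto simp: colon_def m_assoc)
  qed
  moreover have "two_sided (F \<inter> H)"
    unfolding two_sided_def
  proof (intro conjI ballI)
    obtain f i where "f \<in> F" "i \<in> I" using ts(5) two_sidedD(5)[OF I(1)] by blast
    then have "f \<otimes> i \<in> F \<inter> H" using I(2,3) ts(3) by blast
    then show "F \<inter> H \<noteq> {}" by blast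
  qed (use ts mult_H in auto)
  moreover have "f \<otimes> x \<in> H \<and> x \<otimes> f \<in> H" if "f \<in> F \<inter> H" "x \<in> colon F" for f x
    using that colonD colon_right[OF F colonD(1)] by blast
  ultimately show ?thesis unfolding fractional_def by blast
qed

lemma fractional_prod:
  assumes E: "fractional E" and F: "fractional F" shows "fractional (E <#> F)"
proof -
  from E obtain I where I: "two_sided I" "I \<subseteq> H" "\<And>i f. i \<in> I \<Longrightarrow> f \<in> E \<Longrightarrow> i \<otimes> f \<in> H \<and> f \<otimes> i \<in> H"
    unfolding fractional_def by blast
  from F obtain J where J: "two_sided J" "J \<subseteq> H" "\<And>i f. i \<in> J \<Longrightarrow> f \<in> F \<Longrightarrow> i \<otimes> f \<in> H \<and> f \<otimes> i \<in> H"
    unfolding fractional_def by blast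
  note E' = two_sidedD[OF fractionalD[OF E]] and F' = two_sidedD[OF fractionalD[OF F]]
    and I' = two_sidedD[OF I(1)] and J' = two_sidedD[OF J(1)]
  have "y \<otimes> x \<in> H \<and> x \<otimes> y \<in> H" if "y \<in> J <#> I" "x \<in> E <#> F" for x y
  proof -
    from that obtain j i e f where *: "j \<in> J" "i \<in> I" "y = j \<otimes> i" "e \<in> E" "f \<in> F" "x = e \<otimes> f"
      by (elim prodE)
    note c = J'(1)[OF *(1)] I'(1)[OF *(2)] E'(1)[OF *(4)] F'(1)[OF *(5)]
    have "(j \<otimes> (i \<otimes> e)) \<otimes> f \<in> H" "(e \<otimes> (f \<otimes> j)) \<otimes> i \<in> H" using * I J E'(3) J'(3) by simp_all
    then show ?thesis using * c by (simp add: m_assoc)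
  qed
  moreover have "J <#> I \<subseteq> H" using I(2) J(2) mult_H by (auto elim!: prodE)
  ultimately show ?thesis
    using two_sided_prod[OF J(1) I(1)] two_sided_prod[OF fractionalD[OF E] fractionalD[OF F]]
    unfolding fractional_def by blast
qed

lemma colon_antimono: "E \<subseteq> F \<Longrightarrow> colon F \<subseteq> colon E"
  by (auto simp: colon_def)

lemma v_mono: "E \<subseteq> F \<Longrightarrow> v_closure E \<subseteq> v_closure F"
  by (intro colon_antimono)

lemma v_ext:
  assumes F: "fractional F" shows "F \<subseteq> v_closure F"
proof
  fix f assume f: "f \<in> F"
  then have "f \<otimes> x \<in> H" if "x \<in> colon F" for x
    using colon_right[OF F colonD(1)[OF that]] that by blast
  then show "f \<in> v_closure F"
    using two_sidedD(1)[OF fractionalD[OF F] f] by (simp add: colon_def[of "colon F"])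
qed

lemma colon_v: "fractional F \<Longrightarrow> colon (v_closure F) = colon F"
  using colon_antimono[OF v_ext] v_ext[OF fractional_colon] by blast

text \<open>These two descriptions of the inverse of a product see the factors only through their own inverses,
so that factors of a product may be replaced by their divisorial closures.\<close>

lemma colon_prod:
  assumes "fractional E" "fractional F"
  shows "colon (E <#> F) = {x \<in> carrier Q. \<forall>e\<in>E. x \<otimes> e \<in> colon F}" (is "_ = ?A")
    and "colon (E <#> F) = {x \<in> carrier Q. \<forall>f\<in>F. f \<otimes> x \<in> colon E}" (is "_ = ?B")
proof -
  note ts = two_sidedD(1)[OF fractionalD[OF assms(1)]] two_sidedD(1)[OF fractionalD[OF assms(2)]]
  have "x \<in> colon (E <#> F) \<longleftrightarrow> x \<in> ?A" for x
  proof
    assume x: "x \<in> colon (E <#> F)"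
    have "x \<otimes> e \<otimes> f \<in> H" if "e \<in> E" "f \<in> F" for e f
      using colonD(2)[OF x prodI[OF that]] colonD(1)[OF x] ts that by (simp add: m_assoc)
    then show "x \<in> ?A" using colonD(1)[OF x] ts by (simp add: colon_def)
  next
    assume x: "x \<in> ?A"
    have "x \<otimes> y \<in> H" if y: "y \<in> E <#> F" for y
    proof -
      obtain e f where ef: "e \<in> E" "f \<in> F" "y = e \<otimes> f" using y by (elim prodE)
      then have "x \<otimes> e \<otimes> f \<in> H" using x colonD(2) by blast
      then show ?thesis using x ef ts by (simp add: m_assoc)
    qed
    then show "x \<in> colon (E <#> F)" using x by (simp add: colon_def)
  qed
  then show "colon (E <#> F) = ?A" by blast
  have "x \<in> colon (E <#> F) \<longleftrightarrow> x \<in> ?B" if x: "x \<in> carrier Q" for x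
  proof -
    have "x \<in> colon (E <#> F) \<longleftrightarrow> (\<forall>e\<in>E. \<forall>f\<in>F. e \<otimes> (f \<otimes> x) \<in> H)"
      unfolding colon_right[OF fractional_prod[OF assms] x]
    proof (intro iffI ballI)
      fix e f assume *: "\<forall>y\<in>E <#> F. y \<otimes> x \<in> H" "e \<in> E" "f \<in> F"
      then have "e \<otimes> f \<otimes> x \<in> H" using prodI by blast
      then show "e \<otimes> (f \<otimes> x) \<in> H" using * ts x by (simp add: m_assoc)
    next
      fix y assume *: "\<forall>e\<in>E. \<forall>f\<in>F. e \<otimes> (f \<otimes> x) \<in> H" "y \<in> E <#> F"
      then obtain e f where "e \<in> E" "f \<in> F" "y = e \<otimes> f" by (elim prodE)
      then show "y \<otimes> x \<in> H" using * ts x by (simp add: m_assoc)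
    qed
    also have "\<dots> \<longleftrightarrow> (\<forall>f\<in>F. f \<otimes> x \<in> colon E)"
      using colon_right[OF assms(1)] ts(2) x by auto
    finally show ?thesis using x by simp
  qed
  then show "colon (E <#> F) = ?B" using colonD(1) by blast
qed

lemma v_prod_left: "fractional E \<Longrightarrow> fractional F \<Longrightarrow> v_closure (v_closure E <#> F) = v_closure (E <#> F)"
  using colon_prod(2) fractional_colon colon_v by simp

lemma v_prod_right: "fractional E \<Longrightarrow> fractional F \<Longrightarrow> v_closure (E <#> v_closure F) = v_closure (E <#> F)"
  using colon_prod(1) fractional_colon colon_v by simp

lemma colon_H: "colon H = H"
proof
  show "colon H \<subseteq> H" using one_H colonD by fastforce
  show "H \<subseteq> colon H" using H_carrier mult_H by (auto simp: colon_def)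
qed

text \<open>Invertibility of fractional ideals up to divisorial closure. If \<open>x F F\<^sup>-\<^sup>1 \<subseteq> H\<close>, then
\<open>F\<^sup>-\<^sup>1 x \<subseteq> F\<^sup>-\<^sup>1\<close>, so \<open>x \<in> H\<close>; hence the inverse of \<open>F F\<^sup>-\<^sup>1\<close> is \<open>H\<close>.\<close>

lemma v_prod_colon: assumes F: "fractional F" shows "v_closure (F <#> colon F) = H"
proof -
  have "colon (F <#> colon F) = H"
  proof
    show "colon (F <#> colon F) \<subseteq> H"
      unfolding colon_prod(2)[OF F fractional_colon[OF F]]
      using maximal_right_fractional[OF fractional_colon[OF F]] by blast
    have "F <#> colon F \<subseteq> H" using colon_right[OF F] colonD by (auto elim!: prodE)
    then show "H \<subseteq> colon (F <#> colon F)" using colon_antimono colon_H by blast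
  qed
  then show ?thesis using colon_H by simp
qed

lemma colon_prod_subset: "fractional F \<Longrightarrow> F <#> colon F \<subseteq> H" "fractional F \<Longrightarrow> colon F <#> F \<subseteq> H"
  using colon_right colonD by (auto elim!: prodE)

lemma prod_H: "two_sided F \<Longrightarrow> F <#> H = F" "two_sided F \<Longrightarrow> H <#> F = F"
proof -
  assume F: "two_sided F"
  note ts = two_sidedD[OF F]
  have "x \<in> F <#> H" "x \<in> H <#> F" if "x \<in> F" for x
    using prodI[OF that one_H] prodI[OF one_H that] ts(1)[OF that] by simp_all
  then show "F <#> H = F" "H <#> F = F" using ts(2,3) by (auto elim!: prodE)
qed

lemma divisorialD: "divisorial I \<Longrightarrow> two_sided I" "divisorial I \<Longrightarrow> I \<subseteq> H" "divisorial I \<Longrightarrow> v_closure I = I"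
  "divisorial I \<Longrightarrow> fractional I"
  using integral_fractional by (auto simp: divisorial_def)

lemma divisorial_v:
  assumes "two_sided I" "I \<subseteq> H" shows "divisorial (v_closure I)"
proof -
  have "fractional I" using assms integral_fractional by blast
  moreover have "v_closure I \<subseteq> H" using v_mono[OF assms(2)] colon_H by simp
  ultimately show ?thesis unfolding divisorial_def
    using fractional_colon fractionalD colon_v by simp
qed

end

locale krull_order = maximal_order +
  assumes acc: "(\<And>n :: nat. divisorial (S n) \<and> S n \<subseteq> S (Suc n)) \<Longrightarrow> \<exists>n. \<forall>m\<ge>n. S m = S n"
begin

definition maximal_divisorial :: "'a set \<Rightarrow> bool" where
  "maximal_divisorial M \<longleftrightarrow> divisorial M \<and> M \<noteq> H \<and> (\<forall>M'. divisorial M' \<and> M \<subseteq> M' \<and> M' \<noteq> H \<longrightarrow> M' = M)"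

text \<open>The ascending chain condition in the form needed for induction: the larger ideal is the smaller
element.\<close>

lemma wf_divisorial: "wf {(I, J). divisorial I \<and> divisorial J \<and> J \<subset> I}"
  unfolding wf_iff_no_infinite_down_chain
proof
  assume "\<exists>S. \<forall>i. (S (Suc i), S i) \<in> {(I, J). divisorial I \<and> divisorial J \<and> J \<subset> I}"
  then obtain S where S: "\<And>i. divisorial (S i) \<and> S i \<subset> S (Suc i)" by blast
  then obtain n where "\<forall>m\<ge>n. S m = S n" using acc[of S] by blast
  then have "S (Suc n) = S n" using le_SucI by blast
  with S show False by blast
qed

lemma maximal_divisorial_exists:
  assumes J: "divisorial J" "J \<noteq> H"
  obtains M where "maximal_divisorial M" "J \<subseteq> M"
proof -
  define \<M> where "\<M> = {M. divisorial M \<and> J \<subseteq> M \<and> M \<noteq> H}"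
  have "J \<in> \<M>" using J by (simp add: \<M>_def)
  then obtain M where M: "M \<in> \<M>"
    and min: "\<And>M'. (M', M) \<in> {(I, J). divisorial I \<and> divisorial J \<and> J \<subset> I} \<Longrightarrow> M' \<notin> \<M>"
    by (rule wfE_min[OF wf_divisorial]) (rule that)
  have "M' = M" if M': "divisorial M'" "M \<subseteq> M'" "M' \<noteq> H" for M'
  proof (rule ccontr)
    assume "M' \<noteq> M"
    then have "M' \<notin> \<M>" using M' M min[of M'] by (auto simp: \<M>_def)
    then show False using M' M by (auto simp: \<M>_def)
  qed
  then have "maximal_divisorial M" "J \<subseteq> M"
    using M unfolding maximal_divisorial_def \<M>_def by blast+
  then show ?thesis using that by blast
qed

text \<open>Since \<open>A\<close> is not inside \<open>M\<close>, the divisorial closure of \<open>A \<union> M\<close> is \<open>H\<close>, and multiplying by \<open>B\<close>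
gives \<open>B \<subseteq> (A B \<union> M B)\<^sub>v \<subseteq> M\<close>.\<close>

lemma maximal_prime:
  assumes M: "maximal_divisorial M" and A: "two_sided A" "A \<subseteq> H" and B: "two_sided B" "B \<subseteq> H"
    and AB: "A <#> B \<subseteq> M" and "\<not> A \<subseteq> M"
  shows "B \<subseteq> M"
proof -
  have dM: "divisorial M" using M by (simp add: maximal_divisorial_def)
  note M' = divisorialD[OF dM]
  have AM: "two_sided (A \<union> M)" "A \<union> M \<subseteq> H"
    using A M'(1,2) unfolding two_sided_def by auto
  then have fr: "fractional (A \<union> M)" "fractional B" using integral_fractional B by blast+
  have "A \<union> M \<subseteq> v_closure (A \<union> M)" using v_ext fr by blast
  then have H: "v_closure (A \<union> M) = H"
    using divisorial_v[OF AM] M \<open>\<not> A \<subseteq> M\<close> unfolding maximal_divisorial_def by blast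
  have "(A \<union> M) <#> B \<subseteq> M"
    using AB two_sidedD(3)[OF M'(1)] B(2) by (auto elim!: prodE intro: prodI)
  then have "v_closure ((A \<union> M) <#> B) \<subseteq> M" using v_mono M'(3) by blast
  moreover have "v_closure ((A \<union> M) <#> B) = v_closure B"
    using v_prod_left[OF fr] H prod_H(2)[OF B(1)] by simp
  ultimately show ?thesis using v_ext[OF fr(2)] by blast
qed

text \<open>Put \<open>Y = P\<^sub>v \<inter> M\<close> and \<open>Z = P\<^sup>-\<^sup>1 Y\<close>. Then \<open>P Z \<subseteq> Y \<subseteq> M\<close>, so \<open>Z \<subseteq> M\<close> because \<open>M\<close> is prime, and
\<open>Y \<subseteq> (P Z)\<^sub>v \<subseteq> (P M)\<^sub>v\<close>. Applied to \<open>I P \<subseteq> P\<^sub>v \<inter> M\<close> with \<open>I \<subseteq> M\<close>, this moves a factor below \<open>M\<close>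
past \<open>P\<close> although the product need not be commutative.\<close>

lemma comaximal_inter:
  assumes M: "maximal_divisorial M" and P: "two_sided P" "P \<subseteq> H" "\<not> P \<subseteq> M"
  shows "v_closure P \<inter> M \<subseteq> v_closure (P <#> M)"
proof (cases "v_closure P \<inter> M = {}")
  case False
  have dM: "divisorial M" using M by (simp add: maximal_divisorial_def)
  note M' = divisorialD[OF dM]
  have fP: "fractional P" using P integral_fractional by blast
  define Y where "Y = v_closure P \<inter> M"
  have vP: "two_sided (v_closure P)" "v_closure P \<subseteq> H" using divisorialD divisorial_v[OF P(1,2)] by blast+
  have Y: "two_sided Y" "Y \<subseteq> H"
    using False M'(1,2) vP unfolding two_sided_def Y_def by auto
  then have fY: "fractional Y" using integral_fractional by blast
  note fc = fractional_colon[OF fP]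
  define Z where "Z = colon P <#> Y"
  have Z: "two_sided Z" "Z \<subseteq> H"
  proof -
    show "two_sided Z" unfolding Z_def using fractionalD fc Y(1) two_sided_prod by blast
    have "Z \<subseteq> colon (v_closure P) <#> v_closure P"
      unfolding Z_def Y_def colon_v[OF fP] by (intro mono_set_mult) auto
    then show "Z \<subseteq> H" using colon_prod_subset(2) fractional_colon fP by blast
  qed
  have PZ: "P <#> Z = (P <#> colon P) <#> Y"
    unfolding Z_def using set_mult_assoc two_sidedD(4) fractionalD fP fc fY by metis
  also have "\<dots> \<subseteq> H <#> Y" using colon_prod_subset(1)[OF fP] by (intro mono_set_mult) auto
  finally have "P <#> Z \<subseteq> M" using prod_H(2)[OF Y(1)] by (simp add: Y_def)
  then have "Z \<subseteq> M" using maximal_prime[OF M P(1,2) Z] P(3) by blast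
  then have "v_closure (P <#> Z) \<subseteq> v_closure (P <#> M)" by (intro v_mono mono_set_mult) auto
  moreover have "v_closure (P <#> Z) = v_closure Y"
    unfolding PZ using v_prod_left[OF fractional_prod[OF fP fc] fY] v_prod_colon[OF fP] prod_H(2)[OF Y(1)] by simp
  ultimately show ?thesis using v_ext[OF fY] unfolding Y_def by blast
qed auto

definition ideal_prod :: "'a set list \<Rightarrow> 'a set" where
  "ideal_prod Is = foldr (<#>) Is H"

lemma ideal_prod_simps [simp]: "ideal_prod [] = H" "ideal_prod (I # Is) = I <#> ideal_prod Is"
  by (simp_all add: ideal_prod_def)

lemma ideal_prod_integral:
  assumes "\<forall>I\<in>set Is. two_sided I \<and> I \<subseteq> H" shows "two_sided (ideal_prod Is)" "ideal_prod Is \<subseteq> H"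
proof -
  have "two_sided (ideal_prod Is) \<and> ideal_prod Is \<subseteq> H" using assms
  proof (induction Is)
    case (Cons I Is)
    have "I <#> ideal_prod Is \<subseteq> H" using Cons mult_H by (auto elim!: prodE)
    then show ?case using Cons two_sided_prod by simp
  qed (simp add: two_sided_H)
  then show "two_sided (ideal_prod Is)" "ideal_prod Is \<subseteq> H" by auto
qed

lemma ideal_prod_append:
  assumes "\<forall>I\<in>set (Is @ Js). two_sided I \<and> I \<subseteq> H"
  shows "ideal_prod (Is @ Js) = ideal_prod Is <#> ideal_prod Js"
  using assms
proof (induction Is)
  case Nil
  then show ?case using prod_H(2) ideal_prod_integral by simp
next
  case (Cons I Is)
  then have "I \<subseteq> carrier Q" "ideal_prod Is \<subseteq> carrier Q" "ideal_prod Js \<subseteq> carrier Q"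
    using H_sub ideal_prod_integral[of Is] ideal_prod_integral[of Js] by auto
  with Cons show ?case by (simp add: set_mult_assoc)
qed

lemma prime_ideal_prod:
  assumes M: "maximal_divisorial M" and Is: "\<forall>I\<in>set Is. two_sided I \<and> I \<subseteq> H" "\<forall>I\<in>set Is. \<not> I \<subseteq> M"
  shows "\<not> ideal_prod Is \<subseteq> M"
  using Is
proof (induction Is)
  case Nil
  then show ?case using M by (auto simp: maximal_divisorial_def dest: divisorialD(2))
next
  case (Cons I Is)
  then show ?case using maximal_prime[OF M, of I "ideal_prod Is"] ideal_prod_integral[of Is] by auto
qed

text \<open>Induction from larger to smaller ideals. For a maximal divisorial ideal \<open>M\<close> above \<open>J \<noteq> H\<close>, the ideal
\<open>(J M\<^sup>-\<^sup>1)\<^sub>v\<close> is strictly larger than \<open>J\<close>. If \<open>J\<close> lies in \<open>(I\<^sub>1 \<dots> I\<^sub>k)\<^sub>v\<close>, then either no factor lies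
below \<open>M\<close> and \<open>J\<close> lies in \<open>(I\<^sub>1 \<dots> I\<^sub>k M)\<^sub>v\<close>, or the last factor below \<open>M\<close> can be replaced by an \<open>M\<close> at
the right end. Cancelling \<open>M\<close> loses at most one factor.\<close>

lemma ideal_factor_bound:
  assumes "divisorial J"
  shows "\<exists>k. \<forall>Is. (\<forall>I\<in>set Is. divisorial I \<and> I \<noteq> H) \<longrightarrow> J \<subseteq> v_closure (ideal_prod Is) \<longrightarrow> length Is \<le> k"
  using assms
proof (induction J rule: wf_induct_rule[OF wf_divisorial])
  case (1 J)
  show ?case
  proof (cases "J = H")
    case True
    have "Is = []" if Is: "\<forall>I\<in>set Is. divisorial I \<and> I \<noteq> H" "J \<subseteq> v_closure (ideal_prod Is)" for Is
    proof (cases Is)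
      case (Cons I Is')
      have int: "two_sided I" "I \<subseteq> H" "I \<noteq> H" "v_closure I = I" "ideal_prod Is' \<subseteq> H"
        using Is(1) Cons ideal_prod_integral(2)[of Is'] divisorialD(1-3) by auto
      have "ideal_prod Is \<subseteq> I <#> H" unfolding Cons using int(5) by (simp add: mono_set_mult)
      then have "v_closure (ideal_prod Is) \<subseteq> I" using v_mono int(4) prod_H(1)[OF int(1)] by metis
      then show ?thesis using Is(2) True int(2,3) by blast
    qed
    then show ?thesis by (intro exI[of _ 0]) auto
  next
    case False
    then obtain M where M: "maximal_divisorial M" "J \<subseteq> M" using maximal_divisorial_exists 1(2) by blast
    have dM: "divisorial M" "M \<noteq> H" using M(1) by (auto simp: maximal_divisorial_def)
    note M' = divisorialD[OF dM(1)] and J' = divisorialD[OF 1(2)]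
    note fc = fractional_colon[OF M'(4)]
    define K where "K = J <#> colon M"
    have K: "two_sided K" "K \<subseteq> H"
    proof -
      show "two_sided K" unfolding K_def using two_sided_prod J' fractionalD fc by blast
      have "K \<subseteq> M <#> colon M" unfolding K_def using M(2) by (intro mono_set_mult) auto
      then show "K \<subseteq> H" using colon_prod_subset(1) M'(4) by blast
    qed
    have "\<one> \<in> colon M" using M'(2) H_carrier by (auto simp: colon_def)
    then have "x \<in> K" if "x \<in> J" for x
      unfolding K_def using prodI[OF that \<open>\<one> \<in> colon M\<close>] two_sidedD(1)[OF J'(1) that] by simp
    then have JK: "J \<subseteq> v_closure K" using v_ext integral_fractional K by blast
    have "J \<noteq> v_closure K"
    proof
      assume "J = v_closure K"
      have "K \<subseteq> J" using v_ext[OF integral_fractional[OF K]] \<open>J = v_closure K\<close> by simp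
      have "x \<in> H" if x: "x \<in> colon M" for x
      proof (rule maximal_right_fractional[OF J'(4) colonD(1)[OF x]])
        fix y assume "y \<in> J"
        then show "y \<otimes> x \<in> J" using prodI[OF _ x] \<open>K \<subseteq> J\<close> unfolding K_def by blast
      qed
      then have "colon M \<subseteq> H" by blast
      then have "H \<subseteq> M" using colon_antimono colon_H M'(3) by blast
      then show False using M'(2) dM(2) by blast
    qed
    then obtain k where k: "\<And>Is. \<forall>I\<in>set Is. divisorial I \<and> I \<noteq> H \<Longrightarrow>
        v_closure K \<subseteq> v_closure (ideal_prod Is) \<Longrightarrow> length Is \<le> k"
      using 1(1)[of "v_closure K"] JK divisorial_v[OF K] 1(2) by auto
    have cancel: "v_closure K \<subseteq> v_closure P" if P: "two_sided P" "P \<subseteq> H" "J \<subseteq> v_closure (P <#> M)" for P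
    proof -
      have fP: "fractional P" "fractional (P <#> M)" using P integral_fractional M'(4) fractional_prod by blast+
      have "K \<subseteq> v_closure (P <#> M) <#> colon M" unfolding K_def using P(3) by (intro mono_set_mult) auto
      then have "v_closure K \<subseteq> v_closure ((P <#> M) <#> colon M)"
        using v_mono v_prod_left[OF fP(2) fc] by metis
      also have "(P <#> M) <#> colon M = P <#> (M <#> colon M)"
        using set_mult_assoc two_sidedD(4) P(1) M'(1) fractionalD[OF fc] by blast
      also have "v_closure (P <#> (M <#> colon M)) = v_closure P"
        using v_prod_right[OF fP(1) fractional_prod[OF M'(4) fc]] v_prod_colon[OF M'(4)] prod_H(1)[OF P(1)] by simp
      finally show ?thesis .
    qed
    have "length Is \<le> Suc k" if Is: "\<forall>I\<in>set Is. divisorial I \<and> I \<noteq> H" "J \<subseteq> v_closure (ideal_prod Is)" for Is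
    proof (cases "\<exists>I\<in>set Is. I \<subseteq> M")
      case False
      have int: "\<forall>I\<in>set Is. two_sided I \<and> I \<subseteq> H" using Is(1) divisorialD by blast
      note P = ideal_prod_integral[OF int]
      have "\<not> ideal_prod Is \<subseteq> M" using prime_ideal_prod[OF M(1) int] False by blast
      then have "J \<subseteq> v_closure (ideal_prod Is <#> M)"
        using comaximal_inter[OF M(1) P] Is(2) M(2) by blast
      then show ?thesis using cancel[OF P] k[OF Is(1)] by fastforce
    next
      case True
      then obtain As I Bs where spl: "Is = As @ I # Bs" "I \<subseteq> M" "\<forall>B\<in>set Bs. \<not> B \<subseteq> M"
        using split_list_last_prop[of Is "\<lambda>I. I \<subseteq> M"] by blast
      have int: "\<forall>I\<in>set Is. two_sided I \<and> I \<subseteq> H" using Is(1) divisorialD by blast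
      have intA: "\<forall>I\<in>set As. two_sided I \<and> I \<subseteq> H" and intB: "\<forall>I\<in>set Bs. two_sided I \<and> I \<subseteq> H"
        and I: "two_sided I" "I \<subseteq> H" using int spl(1) by auto
      define PA where "PA = ideal_prod As"
      define PB where "PB = ideal_prod Bs"
      have PA: "two_sided PA" "PA \<subseteq> H" and PB: "two_sided PB" "PB \<subseteq> H"
        using ideal_prod_integral intA intB by (auto simp: PA_def PB_def)
      have fr: "fractional PA" "fractional (PB <#> M)"
        using integral_fractional PA PB M'(4) fractional_prod by blast+
      have "I <#> PB \<subseteq> M"
        using spl(2) PB(2) two_sidedD(3)[OF M'(1)] by (auto elim!: prodE)
      moreover have "I <#> PB \<subseteq> v_closure PB"
        using I(2) two_sidedD(2)[OF PB(1)] v_ext[OF integral_fractional[OF PB]] by (auto elim!: prodE)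
      moreover have "\<not> PB \<subseteq> M" using prime_ideal_prod[OF M(1) intB spl(3)] by (simp add: PB_def)
      ultimately have "I <#> PB \<subseteq> v_closure (PB <#> M)" using comaximal_inter[OF M(1) PB] by blast
      then have "PA <#> (I <#> PB) \<subseteq> PA <#> v_closure (PB <#> M)" by (intro mono_set_mult) auto
      moreover have "ideal_prod Is = PA <#> (I <#> PB)"
        using ideal_prod_append[of As "I # Bs"] int spl(1) by (simp add: PA_def PB_def)
      ultimately have "J \<subseteq> v_closure (PA <#> v_closure (PB <#> M))" using Is(2) v_mono by (metis subset_trans)
      also have "\<dots> = v_closure (PA <#> (PB <#> M))" by (rule v_prod_right[OF fr])
      also have "PA <#> (PB <#> M) = PA <#> PB <#> M"
        using set_mult_assoc[of PA PB M] two_sidedD(4) PA(1) PB(1) M'(1) by simp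
      also have "PA <#> PB = ideal_prod (As @ Bs)"
        using ideal_prod_append[of As Bs] intA intB by (auto simp: PA_def PB_def)
      finally have J: "J \<subseteq> v_closure (ideal_prod (As @ Bs) <#> M)" .
      have "\<forall>I\<in>set (As @ Bs). two_sided I \<and> I \<subseteq> H" using intA intB by auto
      then have "v_closure K \<subseteq> v_closure (ideal_prod (As @ Bs))"
        using cancel[OF ideal_prod_integral _] J by blast
      then have "length (As @ Bs) \<le> k" using k[of "As @ Bs"] Is(1) spl(1) by simp
      then show ?thesis by (simp add: spl(1))
    qed
    then show ?thesis by blast
  qed
qed

text \<open>A factorization of \<open>a\<close> puts the two-sided ideal \<open>H a H\<close> inside the product of the ideals that
contain the factors.\<close>

lemma factorization_length_bound:
  assumes a: "a \<in> H"
  shows "\<exists>k. \<forall>xs. (\<forall>x\<in>set xs. \<exists>I. divisorial I \<and> I \<noteq> H \<and> x \<in> I) \<longrightarrow>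
    foldr (\<otimes>) xs \<one> = a \<longrightarrow> length xs \<le> k"
proof -
  define A where "A = (H <#> {a}) <#> H"
  have A: "A = {g \<otimes> a \<otimes> h | g h. g \<in> H \<and> h \<in> H}" by (auto simp: A_def set_mult_def)
  have "two_sided A"
    unfolding two_sided_def A
  proof (intro conjI ballI)
    show "{g \<otimes> a \<otimes> h |g h. g \<in> H \<and> h \<in> H} \<subseteq> carrier Q" "{g \<otimes> a \<otimes> h |g h. g \<in> H \<and> h \<in> H} \<noteq> {}"
      using a H_carrier one_H by auto
    fix u x assume u: "u \<in> H" and "x \<in> {g \<otimes> a \<otimes> h |g h. g \<in> H \<and> h \<in> H}"
    then obtain g h where gh: "g \<in> H" "h \<in> H" "x = g \<otimes> a \<otimes> h" by blast
    then have "u \<otimes> x = (u \<otimes> g) \<otimes> a \<otimes> h" "x \<otimes> u = g \<otimes> a \<otimes> (h \<otimes> u)"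
      using u a H_carrier by (simp_all add: m_assoc)
    then show "u \<otimes> x \<in> {g \<otimes> a \<otimes> h |g h. g \<in> H \<and> h \<in> H}" "x \<otimes> u \<in> {g \<otimes> a \<otimes> h |g h. g \<in> H \<and> h \<in> H}"
      using u gh mult_H by blast+
  qed
  moreover have "A \<subseteq> H" using a mult_H unfolding A by blast
  ultimately have dA: "divisorial (v_closure A)" by (rule divisorial_v)
  then obtain k where k: "\<And>Is. \<forall>I\<in>set Is. divisorial I \<and> I \<noteq> H \<Longrightarrow>
      v_closure A \<subseteq> v_closure (ideal_prod Is) \<Longrightarrow> length Is \<le> k"
    using ideal_factor_bound by blast
  have "length xs \<le> k" if xs: "\<forall>x\<in>set xs. \<exists>I. divisorial I \<and> I \<noteq> H \<and> x \<in> I" "foldr (\<otimes>) xs \<one> = a" for xs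
  proof -
    from xs(1) obtain f where f: "\<And>x. x \<in> set xs \<Longrightarrow> divisorial (f x) \<and> f x \<noteq> H \<and> x \<in> f x" by metis
    define Is where "Is = map f xs"
    have Is: "\<forall>I\<in>set Is. divisorial I \<and> I \<noteq> H" using f by (auto simp: Is_def)
    have "foldr (\<otimes>) xs \<one> \<in> ideal_prod (map f xs)" using f
      by (induction xs) (auto intro: one_H prodI)
    then have a': "a \<in> ideal_prod Is" using xs(2) by (simp add: Is_def)
    have int: "two_sided (ideal_prod Is)"
      using ideal_prod_integral(1)[of Is] Is divisorialD by blast
    have "A \<subseteq> ideal_prod Is" unfolding A using a' two_sidedD(2,3)[OF int] by auto
    then have "length Is \<le> k" using k[OF Is] v_mono by blast
    then show ?thesis by (simp add: Is_def)
  qed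
  then show ?thesis by blast
qed

end

section \<open>Krull monoids and the BF-property\<close>

lemma foldr_mult_closed:
  assumes "monoid H" "set us \<subseteq> carrier H"
  shows "foldr (\<otimes>\<^bsub>H\<^esub>) us \<one>\<^bsub>H\<^esub> \<in> carrier H"
proof -
  interpret monoid H by fact
  show ?thesis using assms(2) by (induction us) auto
qed

context ore_monoid begin

lemma quot_emb_one: "\<one>\<^bsub>quot_group G\<^esub> = quot_emb G \<one>"
  by (simp add: quot_group_def quot_emb_def)

lemma order_in_quot_group: "order_in_group (quot_group G) (quot_emb G ` carrier G)"
proof -
  interpret Q: group "quot_group G" by (rule quot_group_is_group)
  show ?thesis
  proof unfold_locales
    show "quot_emb G ` carrier G \<subseteq> carrier (quot_group G)" using quot_emb_closed by blast
    show "\<one>\<^bsub>quot_group G\<^esub> \<in> quot_emb G ` carrier G" unfolding quot_emb_one by blast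
    fix x y assume "x \<in> quot_emb G ` carrier G" "y \<in> quot_emb G ` carrier G"
    then show "x \<otimes>\<^bsub>quot_group G\<^esub> y \<in> quot_emb G ` carrier G" by (auto simp: quot_emb_mult[symmetric])
  qed
qed

lemma monoid_ideal_iff:
  "monoid_ideal G I \<longleftrightarrow> I \<subseteq> carrier G \<and> (\<forall>h\<in>carrier G. \<forall>x\<in>I. h \<otimes> x \<in> I \<and> x \<otimes> h \<in> I)"
proof
  assume I: "monoid_ideal G I"
  then have "h \<otimes> x \<in> I \<and> x \<otimes> h \<in> I" if "h \<in> carrier G" "x \<in> I" for h x
    using that unfolding monoid_ideal_def set_mult_def by blast
  with I show "I \<subseteq> carrier G \<and> (\<forall>h\<in>carrier G. \<forall>x\<in>I. h \<otimes> x \<in> I \<and> x \<otimes> h \<in> I)"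
    by (simp add: monoid_ideal_def)
next
  assume I: "I \<subseteq> carrier G \<and> (\<forall>h\<in>carrier G. \<forall>x\<in>I. h \<otimes> x \<in> I \<and> x \<otimes> h \<in> I)"
  have "x \<in> carrier G <#> I" "x \<in> I <#> carrier G" if "x \<in> I" for x
  proof -
    have "\<one> \<otimes> x \<in> carrier G <#> I" "x \<otimes> \<one> \<in> I <#> carrier G"
      using that unfolding set_mult_def by blast+
    then show "x \<in> carrier G <#> I" "x \<in> I <#> carrier G" using that I by auto
  qed
  moreover have "carrier G <#> I \<subseteq> I" "I <#> carrier G \<subseteq> I" using I unfolding set_mult_def by blast+
  ultimately show "monoid_ideal G I" using I unfolding monoid_ideal_def by blast
qed

lemma two_sided_image_iff:
  assumes "I \<subseteq> carrier G"
  shows "order_in_group.two_sided (quot_group G) (quot_emb G ` carrier G) (quot_emb G ` I)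
    \<longleftrightarrow> monoid_ideal G I \<and> I \<noteq> {}"
proof -
  interpret O: order_in_group "quot_group G" "quot_emb G ` carrier G" by (rule order_in_quot_group)
  have mem: "quot_emb G x \<in> quot_emb G ` I \<longleftrightarrow> x \<in> I" if "x \<in> carrier G" for x
    using quot_emb_inj assms that by (metis inj_on_image_mem_iff)
  have "O.two_sided (quot_emb G ` I) \<longleftrightarrow> quot_emb G ` I \<subseteq> carrier (quot_group G) \<and> I \<noteq> {} \<and>
      (\<forall>h\<in>carrier G. \<forall>x\<in>I. quot_emb G (h \<otimes> x) \<in> quot_emb G ` I \<and> quot_emb G (x \<otimes> h) \<in> quot_emb G ` I)"
    unfolding O.two_sided_def using assms by (simp add: quot_emb_mult subset_iff)
  also have "\<dots> \<longleftrightarrow> monoid_ideal G I \<and> I \<noteq> {}"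
    unfolding monoid_ideal_iff using assms mem quot_emb_closed by (auto simp: subset_iff)
  finally show ?thesis .
qed

lemma image_of_subset:
  assumes "J \<subseteq> quot_emb G ` carrier G"
  obtains I where "I \<subseteq> carrier G" "J = quot_emb G ` I"
  using assms subset_imageE by metis

text \<open>Transports the definition of a Krull monoid, which speaks of ideals of the monoid itself, to
subsets of the quotient group.\<close>

lemma krull_maximal_order:
  assumes "krull_monoid G"
  shows "maximal_order (quot_group G) (quot_emb G ` carrier G)"
proof -
  interpret O: order_in_group "quot_group G" "quot_emb G ` carrier G" by (rule order_in_quot_group)
  have krull: "lcolon (quot_group G) (quot_emb G ` I) (quot_emb G ` I) = quot_emb G ` carrier G"
    "rcolon (quot_group G) (quot_emb G ` I) (quot_emb G ` I) = quot_emb G ` carrier G"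
    if "monoid_ideal G I" "I \<noteq> {}" for I
    using assms that unfolding krull_monoid_def by blast+
  show ?thesis
  proof unfold_locales
    fix J x assume J: "O.two_sided J" "J \<subseteq> quot_emb G ` carrier G" and x: "x \<in> carrier (quot_group G)"
      and l: "\<And>i. i \<in> J \<Longrightarrow> x \<otimes>\<^bsub>quot_group G\<^esub> i \<in> J"
    obtain I where I: "I \<subseteq> carrier G" "J = quot_emb G ` I" using J(2) by (rule image_of_subset)
    have "x \<in> lcolon (quot_group G) J J" using x l by (auto simp: lcolon_def l_coset_def)
    then show "x \<in> quot_emb G ` carrier G" using krull(1) two_sided_image_iff[OF I(1)] J(1) I(2) by simp
  next
    fix J x assume J: "O.two_sided J" "J \<subseteq> quot_emb G ` carrier G" and x: "x \<in> carrier (quot_group G)"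
      and r: "\<And>i. i \<in> J \<Longrightarrow> i \<otimes>\<^bsub>quot_group G\<^esub> x \<in> J"
    obtain I where I: "I \<subseteq> carrier G" "J = quot_emb G ` I" using J(2) by (rule image_of_subset)
    have "x \<in> rcolon (quot_group G) J J" using x r by (auto simp: rcolon_def r_coset_def)
    then show "x \<in> quot_emb G ` carrier G" using krull(2) two_sided_image_iff[OF I(1)] J(1) I(2) by simp
  qed
qed

text \<open>The iterated colon sets in the two conditions for a divisorial ideal all agree, since for fractional
ideals the left and the right colon set coincide.\<close>

lemma divisorial_image_iff:
  assumes krull: "krull_monoid G" and I: "I \<subseteq> carrier G"
  shows "order_in_group.divisorial (quot_group G) (quot_emb G ` carrier G) (quot_emb G ` I)
    \<longleftrightarrow> divisorial_ideal G I \<and> I \<noteq> {}"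
proof -
  interpret O: maximal_order "quot_group G" "quot_emb G ` carrier G" by (rule krull_maximal_order[OF krull])
  let ?H = "quot_emb G ` carrier G" and ?J = "quot_emb G ` I"
  have l: "lcolon (quot_group G) ?H F = O.colon F" for F
    unfolding lcolon_def l_coset_def O.colon_def by blast
  have r: "rcolon (quot_group G) ?H F = O.colon F" if "O.fractional F" for F
  proof -
    have "rcolon (quot_group G) ?H F = {x \<in> carrier (quot_group G). \<forall>f\<in>F. f \<otimes>\<^bsub>quot_group G\<^esub> x \<in> ?H}"
      unfolding rcolon_def r_coset_def by blast
    also have "\<dots> = {x \<in> carrier (quot_group G). x \<in> O.colon F}"
      using O.colon_right[OF that] by blast
    also have "\<dots> = O.colon F" using O.colonD(1) by blast
    finally show ?thesis .
  qed
  have "rcolon (quot_group G) ?H ?J = O.colon ?J" "rcolon (quot_group G) ?H (O.colon ?J) = O.colon (O.colon ?J)"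
    if "monoid_ideal G I" "I \<noteq> {}"
  proof -
    have "O.fractional ?J" using two_sided_image_iff[OF I] that O.integral_fractional I by blast
    then show "rcolon (quot_group G) ?H ?J = O.colon ?J" "rcolon (quot_group G) ?H (O.colon ?J) = O.colon (O.colon ?J)"
      using r O.fractional_colon by blast+
  qed
  then show ?thesis
    unfolding O.divisorial_def divisorial_ideal_def two_sided_image_iff[OF I] Let_def l
    using image_mono[OF I, of "quot_emb G"] by metis
qed

lemma krull_order:
  assumes krull: "krull_monoid G"
  shows "krull_order (quot_group G) (quot_emb G ` carrier G)"
proof -
  interpret O: maximal_order "quot_group G" "quot_emb G ` carrier G" by (rule krull_maximal_order[OF krull])
  show ?thesis
  proof unfold_locales
    fix S :: "nat \<Rightarrow> ('a \<times> 'a) set set" assume S: "\<And>n. O.divisorial (S n) \<and> S n \<subseteq> S (Suc n)"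
    define T where "T n = {x \<in> carrier G. quot_emb G x \<in> S n}" for n
    have T: "T n \<subseteq> carrier G" "S n = quot_emb G ` T n" for n
      using O.divisorialD(2) S by (auto simp: T_def)
    have "divisorial_ideal G (T n) \<and> T n \<subseteq> T (Suc n)" for n
    proof
      show "divisorial_ideal G (T n)" using divisorial_image_iff[OF krull T(1)] S T(2) by metis
      show "T n \<subseteq> T (Suc n)" using S by (auto simp: T_def)
    qed
    moreover have acc: "\<exists>n. \<forall>m\<ge>n. I m = I n"
      if "\<forall>n. divisorial_ideal G (I n) \<and> I n \<subseteq> I (Suc n)" for I :: "nat \<Rightarrow> 'a set"
      using spec[OF conjunct2[OF conjunct2[OF krull[unfolded krull_monoid_def]]], of I] that by (rule mp)
    ultimately obtain n where "\<forall>m\<ge>n. T m = T n" by blast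
    then show "\<exists>n. \<forall>m\<ge>n. S m = S n" using T(2) by metis
  qed
qed

lemma quot_emb_foldr:
  "set xs \<subseteq> carrier G \<Longrightarrow> quot_emb G (foldr (\<otimes>) xs \<one>)
     = foldr (\<otimes>\<^bsub>quot_group G\<^esub>) (map (quot_emb G) xs) \<one>\<^bsub>quot_group G\<^esub>"
  by (induction xs) (simp_all add: quot_emb_one quot_emb_mult foldr_mult_closed monoid_axioms)

text \<open>A factorization into the largest possible number of non-units cannot be refined, so its factors are
atoms.\<close>

lemma bf_monoid_if_bounded:
  assumes bound: "\<And>a. a \<in> carrier G - Units G \<Longrightarrow>
    \<exists>k. \<forall>xs. set xs \<subseteq> carrier G - Units G \<longrightarrow> foldr (\<otimes>) xs \<one> = a \<longrightarrow> length xs \<le> k"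
  shows "bf_monoid G"
  unfolding bf_monoid_def
proof (intro ballI)
  fix a assume a: "a \<in> carrier G"
  show "finite (lengths G a) \<and> lengths G a \<noteq> {}"
  proof (cases "a \<in> Units G")
    case True
    then show ?thesis by (simp add: lengths_def)
  next
    case False
    then obtain k where k: "\<And>xs. set xs \<subseteq> carrier G - Units G \<Longrightarrow> foldr (\<otimes>) xs \<one> = a \<Longrightarrow> length xs \<le> k"
      using bound a by blast
    have "lengths G a \<subseteq> {..k}"
      using False k by (auto simp: lengths_def atoms_def)
    then have fin: "finite (lengths G a)" by (rule finite_subset) simp
    define \<F> where "\<F> = (\<lambda>n. \<exists>xs. length xs = n \<and> set xs \<subseteq> carrier G - Units G \<and> foldr (\<otimes>) xs \<one> = a)"
    have "\<F> 1" unfolding \<F>_def using a False by (intro exI[of _ "[a]"]) simp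
    have bd: "n \<le> k" if "\<F> n" for n using that k by (auto simp: \<F>_def)
    define n where "n = Greatest \<F>"
    have n: "\<F> n" "\<And>m. \<F> m \<Longrightarrow> m \<le> n"
      unfolding n_def using GreatestI_nat[of \<F> 1 k, OF \<open>\<F> 1\<close> bd] Greatest_le_nat[of \<F> _ k, OF _ bd] by auto
    obtain xs where xs: "length xs = n" "set xs \<subseteq> carrier G - Units G" "foldr (\<otimes>) xs \<one> = a"
      using n(1) by (auto simp: \<F>_def)
    have "x \<in> atoms G" if x: "x \<in> set xs" for x
    proof (rule ccontr)
      assume "x \<notin> atoms G"
      then obtain u v where uv: "u \<in> carrier G - Units G" "v \<in> carrier G - Units G" "x = u \<otimes> v"
        using x xs(2) unfolding atoms_def by blast
      obtain ys zs where spl: "xs = ys @ x # zs" using x split_list by metis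
      have cl: "foldr (\<otimes>) zs \<one> \<in> carrier G" using spl xs(2) foldr_mult_closed[OF monoid_axioms, of zs] by auto
      have "foldr (\<otimes>) (ys @ u # v # zs) \<one> = foldr (\<otimes>) xs \<one>"
        using uv cl by (simp add: spl m_assoc)
      then have "\<F> (length (ys @ u # v # zs))"
        unfolding \<F>_def using xs uv spl by (intro exI[of _ "ys @ u # v # zs"]) auto
      then show False using n(2) xs(1) spl by fastforce
    qed
    moreover have "1 \<le> n" using n(2)[OF \<open>\<F> 1\<close>] .
    ultimately have "n \<in> lengths G a" using xs False by (auto simp: lengths_def)
    then show ?thesis using fin by blast
  qed
qed

theorem krull_bf_monoid:
  assumes krull: "krull_monoid G"
    and div: "\<And>a. a \<in> carrier G - Units G \<Longrightarrow> \<exists>I. divisorial_ideal G I \<and> I \<noteq> carrier G \<and> a \<in> I"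
  shows "bf_monoid G"
proof (rule bf_monoid_if_bounded)
  interpret O: krull_order "quot_group G" "quot_emb G ` carrier G" by (rule krull_order[OF krull])
  have div': "\<exists>J. O.divisorial J \<and> J \<noteq> quot_emb G ` carrier G \<and> quot_emb G x \<in> J"
    if x: "x \<in> carrier G - Units G" for x
  proof -
    obtain I where I: "divisorial_ideal G I" "I \<noteq> carrier G" "x \<in> I" using div[OF x] by blast
    then have "I \<subseteq> carrier G" by (simp add: divisorial_ideal_def monoid_ideal_def)
    moreover have "quot_emb G ` I \<noteq> quot_emb G ` carrier G"
      using quot_emb_inj calculation I(2) by (metis inj_on_image_eq_iff order_refl)
    ultimately show ?thesis using divisorial_image_iff[OF krull, of I] I by blast
  qed
  fix a assume a: "a \<in> carrier G - Units G"
  then obtain k where k: "\<And>ys. \<forall>y\<in>set ys. \<exists>J. O.divisorial J \<and> J \<noteq> quot_emb G ` carrier G \<and> y \<in> J \<Longrightarrow>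
     foldr (\<otimes>\<^bsub>quot_group G\<^esub>) ys \<one>\<^bsub>quot_group G\<^esub> = quot_emb G a \<Longrightarrow> length ys \<le> k"
    using O.factorization_length_bound[of "quot_emb G a"] by blast
  have "length xs \<le> k" if xs: "set xs \<subseteq> carrier G - Units G" "foldr (\<otimes>) xs \<one> = a" for xs
  proof -
    have "foldr (\<otimes>\<^bsub>quot_group G\<^esub>) (map (quot_emb G) xs) \<one>\<^bsub>quot_group G\<^esub> = quot_emb G a"
      using quot_emb_foldr[of xs] xs by auto
    then show ?thesis using k[of "map (quot_emb G) xs"] div' xs(1) by auto
  qed
  then show "\<exists>k. \<forall>xs. set xs \<subseteq> carrier G - Units G \<longrightarrow> foldr (\<otimes>) xs \<one> = a \<longrightarrow> length xs \<le> k" by blast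
qed

end

section \<open>Factorizations in saturated monoids of multisets\<close>

text \<open>The abstract form of a monoid of zero-sum sequences with finite Davenport constant: it is closed
under products and under cofactors inside the free abelian monoid, and its atoms are bounded in size.
The number of atoms may be infinite.\<close>

locale saturated_multisets =
  fixes B :: "'g multiset set" and N :: nat
  assumes empty_mem: "{#} \<in> B"
    and add_mem: "S \<in> B \<Longrightarrow> T \<in> B \<Longrightarrow> S + T \<in> B"
    and cancel_mem: "S \<in> B \<Longrightarrow> S + T \<in> B \<Longrightarrow> T \<in> B"
    and irreducible_size: "U \<in> B \<Longrightarrow> U \<noteq> {#} \<Longrightarrow>
      (\<And>S T. S \<in> B \<Longrightarrow> T \<in> B \<Longrightarrow> U = S + T \<Longrightarrow> S = {#} \<or> T = {#}) \<Longrightarrow> size U \<le> N"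
begin

definition irr :: "'g multiset set" where
  "irr = {U \<in> B. U \<noteq> {#} \<and> (\<forall>S\<in>B. \<forall>T\<in>B. U = S + T \<longrightarrow> S = {#} \<or> T = {#})}"

definition factorizations :: "'g multiset \<Rightarrow> 'g multiset multiset set" where
  "factorizations S = {z. set_mset z \<subseteq> irr \<and> \<Sum>\<^sub># z = S}"

definition length_set :: "'g multiset \<Rightarrow> nat set" where
  "length_set S = size ` factorizations S"

lemma irrD: "U \<in> irr \<Longrightarrow> U \<in> B" "U \<in> irr \<Longrightarrow> U \<noteq> {#}" "U \<in> irr \<Longrightarrow> size U \<le> N"
  using irreducible_size unfolding irr_def by auto

lemma factorizationsD: "z \<in> factorizations S \<Longrightarrow> set_mset z \<subseteq> irr" "z \<in> factorizations S \<Longrightarrow> \<Sum>\<^sub># z = S"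
  by (auto simp: factorizations_def)

lemma factorizationsI: "set_mset z \<subseteq> irr \<Longrightarrow> z \<in> factorizations (\<Sum>\<^sub># z)"
  by (simp add: factorizations_def)

lemma factorizations_add: "z \<in> factorizations S \<Longrightarrow> w \<in> factorizations T \<Longrightarrow> z + w \<in> factorizations (S + T)"
  by (auto simp: factorizations_def)

lemma length_set_add: "k \<in> length_set S \<Longrightarrow> l \<in> length_set T \<Longrightarrow> k + l \<in> length_set (S + T)"
  unfolding length_set_def by (auto intro!: image_eqI[OF _ factorizations_add])

lemma sum_irr_mem: "set_mset z \<subseteq> irr \<Longrightarrow> \<Sum>\<^sub># z \<in> B"
  by (induction z) (auto simp: empty_mem irrD(1) add_mem)

lemma diff_mem: "T \<in> B \<Longrightarrow> S \<in> B \<Longrightarrow> T \<subseteq># S \<Longrightarrow> S - T \<in> B"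
  by (metis cancel_mem subset_mset.add_diff_inverse)

lemma factorizations_nonempty: "S \<in> B \<Longrightarrow> factorizations S \<noteq> {}"
proof (induction "size S" arbitrary: S rule: less_induct)
  case less
  show ?case
  proof (cases "S = {#} \<or> S \<in> irr")
    case True
    then have "{#} \<in> factorizations S \<or> {#S#} \<in> factorizations S" by (auto simp: factorizations_def)
    then show ?thesis by blast
  next
    case False
    then obtain T U where TU: "T \<in> B" "U \<in> B" "S = T + U" "T \<noteq> {#}" "U \<noteq> {#}"
      using less.prems unfolding irr_def by blast
    then have "size T < size S" "size U < size S"
      by (simp_all add: nonempty_has_size)
    with less.hyps TU obtain z w where "z \<in> factorizations T" "w \<in> factorizations U" by blast
    with TU show ?thesis using factorizations_add by blast
  qed
qed

lemma length_set_nonempty: "S \<in> B \<Longrightarrow> length_set S \<noteq> {}"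
  by (simp add: length_set_def factorizations_nonempty)

lemma factorization_size_le:
  assumes "set_mset z \<subseteq> irr" shows "size z \<le> size (\<Sum>\<^sub># z)" "size (\<Sum>\<^sub># z) \<le> N * size z"
proof -
  have "size z \<le> size (\<Sum>\<^sub># z) \<and> size (\<Sum>\<^sub># z) \<le> N * size z"
    using assms
  proof (induction z)
    case (add U z)
    then have "size U \<ge> 1" "size U \<le> N" using irrD[of U] by (auto simp: Suc_le_eq nonempty_has_size)
    with add show ?case by (auto simp: algebra_simps)
  qed simp
  then show "size z \<le> size (\<Sum>\<^sub># z)" "size (\<Sum>\<^sub># z) \<le> N * size z" by auto
qed

lemma length_set_bounds:
  assumes "k \<in> length_set S" shows "k \<le> size S" "size S \<le> N * k"
  using assms factorization_size_le unfolding length_set_def factorizations_def by auto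

lemma finite_length_set: "finite (length_set S)"
  using length_set_bounds(1) finite_subset[of "length_set S" "{..size S}"] by auto

lemma length_set_memB: "k \<in> length_set S \<Longrightarrow> S \<in> B"
  unfolding length_set_def factorizations_def using sum_irr_mem by auto

lemma length_set_empty: "length_set {#} = {0}"
proof -
  have "0 \<in> length_set {#}" unfolding length_set_def factorizations_def by force
  moreover have "k = 0" if "k \<in> length_set {#}" for k using length_set_bounds(1)[OF that] by simp
  ultimately show ?thesis by blast
qed

lemma zero_in_length_set_iff: "0 \<in> length_set S \<longleftrightarrow> S = {#}"
  using length_set_bounds(2)[of 0 S] length_set_empty by auto

text \<open>Each element of \<open>T\<close> is covered by one member of \<open>z\<close>.\<close>

lemma cover_subset:
  assumes "T \<subseteq># \<Sum>\<^sub># (z :: 'g multiset multiset)"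
  shows "\<exists>s. s \<subseteq># z \<and> size s \<le> size T \<and> T \<subseteq># \<Sum>\<^sub># s"
  using assms
proof (induction z arbitrary: T)
  case (add U z)
  have "T - U \<subseteq># \<Sum>\<^sub># z" using add.prems by (simp add: subset_eq_diff_conv add.commute)
  from add.IH[OF this] obtain s where s: "s \<subseteq># z" "size s \<le> size (T - U)" "T - U \<subseteq># \<Sum>\<^sub># s" by blast
  show ?case
  proof (cases "T - U = T")
    case True
    then show ?thesis using s by (metis mset_subset_eq_add_right subset_mset.order_trans add_mset_add_single mset_subset_eq_add_left)
  next
    case False
    then have "T - U \<subset># T" by (simp add: subset_mset.less_le)
    then have "size (T - U) < size T" by (rule mset_subset_size)
    moreover have "T \<subseteq># U + \<Sum>\<^sub># s" using s(3) by (simp add: subset_eq_diff_conv add.commute)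
    ultimately show ?thesis using s by (intro exI[of _ "add_mset U s"]) auto
  qed
qed auto

text \<open>Let \<open>s\<close> be a part of \<open>z\<close> that covers \<open>T\<close> and has at most \<open>size T\<close> atoms. Replacing \<open>s\<close> by a
factorization \<open>u\<close> of what remains of its product after removing \<open>T\<close> leaves the rest \<open>w\<close> of \<open>z\<close>
untouched. All changes are bounded in terms of \<open>size T\<close> and \<open>N\<close>, regardless of how many atoms exist.\<close>

lemma absorb:
  assumes z: "z \<in> factorizations S" and T: "T \<in> B" "T \<subseteq># S"
  obtains s u w where "z = s + w" "size s \<le> size T" "T \<subseteq># \<Sum>\<^sub># s"
    "size (\<Sum>\<^sub># s) \<le> N * size T" "u \<in> factorizations (\<Sum>\<^sub># s - T)" "u + w \<in> factorizations (S - T)"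
proof -
  from z T obtain s where s: "s \<subseteq># z" "size s \<le> size T" "T \<subseteq># \<Sum>\<^sub># s"
    using cover_subset[of T z] by (auto simp: factorizations_def)
  define w where "w = z - s"
  have zsw: "z = s + w" using s by (simp add: w_def)
  have irr: "set_mset s \<subseteq> irr" "set_mset w \<subseteq> irr" using z zsw by (auto simp: factorizations_def)
  have "\<Sum>\<^sub># s - T \<in> B" using diff_mem s T sum_irr_mem irr by blast
  then obtain u where u: "u \<in> factorizations (\<Sum>\<^sub># s - T)" using factorizations_nonempty by blast
  have "u + w \<in> factorizations (\<Sum>\<^sub># s - T + \<Sum>\<^sub># w)" using factorizations_add u factorizationsI irr by blast
  moreover have "S = \<Sum>\<^sub># s + \<Sum>\<^sub># w" using z zsw by (simp add: factorizations_def)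
  then have "\<Sum>\<^sub># s - T + \<Sum>\<^sub># w = S - T" using s(3) by (metis subset_mset.add_diff_assoc2)
  ultimately have "u + w \<in> factorizations (S - T)" by simp
  moreover have "size (\<Sum>\<^sub># s) \<le> N * size T"
    using factorization_size_le(2)[OF irr(1)] s(2) by (meson le_trans mult_le_mono2)
  ultimately show ?thesis using that zsw s u by blast
qed

lemma length_set_diff:
  assumes "k \<in> length_set S" "T \<in> B" "T \<subseteq># S"
  obtains j where "j \<in> length_set (S - T)" "k \<le> j + size T" "j \<le> k + N * size T"
proof -
  from assms(1) obtain z where z: "z \<in> factorizations S" "k = size z" by (auto simp: length_set_def)
  from absorb[OF z(1) assms(2,3)] obtain s u w where *: "z = s + w" "size s \<le> size T" 
    "size (\<Sum>\<^sub># s) \<le> N * size T" "u \<in> factorizations (\<Sum>\<^sub># s - T)" "u + w \<in> factorizations (S - T)" by metis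
  have "size u \<le> size (\<Sum>\<^sub># s - T)" using factorization_size_le(1)[of u] factorizationsD[OF *(4)] by simp
  also have "\<dots> \<le> size (\<Sum>\<^sub># s)" by (rule size_mset_mono) simp
  finally have "size u \<le> N * size T" using *(3) by simp
  moreover have "size (u + w) \<in> length_set (S - T)" unfolding length_set_def using *(5) by (rule imageI)
  ultimately show ?thesis using that[of "size (u + w)"] z * by simp
qed

text \<open>Two factorizations of \<open>S\<close> are linked by exchanges inside divisors of size at most \<open>N\<^sup>2\<close>: absorb the
first atom \<open>V\<close> of the target, which touches at most \<open>N\<close> atoms of \<open>z\<close>, and continue with the
cofactor of \<open>V\<close>. The result is stated as an induction principle for a reflexive and transitive
relation \<open>R\<close> between lengths, since only lengths matter in the applications; the relation is
shifted by one each time an atom has been split off.\<close>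

lemma swap_chain:
  assumes "z \<in> factorizations S" "z' \<in> factorizations S" "\<And>x. R x x" "\<And>x y w. R x y \<Longrightarrow> R y w \<Longrightarrow> R x w"
    and "\<And>c s s' w. s \<in> factorizations c \<Longrightarrow> s' \<in> factorizations c \<Longrightarrow> w \<in> factorizations (S - c) \<Longrightarrow> c \<subseteq># S \<Longrightarrow>
      size c \<le> N * N \<Longrightarrow> R (size s + size w) (size s' + size w)"
  shows "R (size z) (size z')"
  using assms
proof (induction z' arbitrary: z S R)
  case empty
  then have "z = {#}" using factorization_size_le(1)[of z] by (auto simp: factorizations_def)
  with empty show ?case by simp
next
  case (add V z')
  have V: "V \<in> irr" "z' \<in> factorizations (S - V)" "V \<subseteq># S" using add.prems(2) by (auto simp: factorizations_def)
  from absorb[OF add.prems(1) irrD(1)[OF V(1)] V(3)] obtain s u w where *: "z = s + w"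
    "V \<subseteq># \<Sum>\<^sub># s" "size (\<Sum>\<^sub># s) \<le> N * size V" "u \<in> factorizations (\<Sum>\<^sub># s - V)" "u + w \<in> factorizations (S - V)" by metis
  have S: "S = \<Sum>\<^sub># s + \<Sum>\<^sub># w" and irr: "set_mset s \<subseteq> irr" "set_mset w \<subseteq> irr"
    using add.prems(1) * by (auto simp: factorizations_def)
  have "add_mset V u \<in> factorizations (\<Sum>\<^sub># s)" using *(2,4) V(1) by (auto simp: factorizations_def)
  moreover have "size (\<Sum>\<^sub># s) \<le> N * N" using *(3) irrD(3)[OF V(1)] by (meson le_trans mult_le_mono2)
  ultimately have "R (size s + size w) (size (add_mset V u) + size w)"
    using add.prems(5)[OF factorizationsI[OF irr(1)], of "add_mset V u" w] factorizationsI[OF irr(2)] S by simp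
  then have 1: "R (size z) (Suc (size (u + w)))" using * by simp
  have "R (Suc (size (u + w))) (Suc (size z'))"
  proof (rule add.IH[where S = "S - V" and R = "\<lambda>x y. R (Suc x) (Suc y)"])
    show "u + w \<in> factorizations (S - V)" "z' \<in> factorizations (S - V)" by fact+
    show "R (Suc x) (Suc x)" for x using add.prems(3) .
    show "R (Suc x) (Suc w)" if "R (Suc x) (Suc y)" "R (Suc y) (Suc w)" for x y w
      using add.prems(4) that by blast
  next
    fix c t t' v assume t: "t \<in> factorizations c" "t' \<in> factorizations c" "v \<in> factorizations (S - V - c)" "c \<subseteq># S - V" "size c \<le> N * N"
    have cS: "c \<subseteq># S" using t(4) by (meson diff_subset_eq_self subset_mset.order_trans)
    have "V + c \<subseteq># S" using t(4) V(3) by (metis mset_subset_eq_mono_add_left_cancel subset_mset.add_diff_inverse)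
    then obtain r where "S = V + c + r" by (auto simp: mset_subset_eq_exists_conv)
    then have "S - c = V + (S - V - c)" by (simp add: union_assoc union_commute[of c])
    then have "add_mset V v \<in> factorizations (S - c)" using t(3) V(1) by (auto simp: factorizations_def)
    then show "R (Suc (size t + size v)) (Suc (size t' + size v))"
      using add.prems(5)[OF t(1,2) _ cS t(5)] by fastforce
  qed
  with 1 show ?case using add.prems(4) by fastforce
qed

text \<open>No single exchange can jump over a gap longer than \<open>N\<^sup>2\<close>, so not exceeding \<open>k\<close> would be invariant
along the chain of exchanges.\<close>

lemma length_set_gap:
  assumes "k \<in> length_set S" "l \<in> length_set S" "k < l"
  shows "\<exists>y\<in>length_set S. k < y \<and> y \<le> k + N * N"
proof (rule ccontr)
  assume neg: "\<not> ?thesis"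
  from assms obtain z z' where z: "z \<in> factorizations S" "z' \<in> factorizations S" "size z = k" "size z' = l"
    by (auto simp: length_set_def)
  have "size z \<le> k \<longrightarrow> size z' \<le> k"
  proof (rule swap_chain[OF z(1,2), where R = "\<lambda>x y. x \<le> k \<longrightarrow> y \<le> k"])
    fix c s s' w assume *: "s \<in> factorizations c" "s' \<in> factorizations c" "w \<in> factorizations (S - c)" "c \<subseteq># S" "size c \<le> N * N"
    have "s' + w \<in> factorizations (c + (S - c))" using * factorizations_add by blast
    then have "size s' + size w \<in> length_set S" using *(4) by (force simp: length_set_def)
    moreover have "size s' \<le> N * N" using *(2,5) factorization_size_le(1)[of s'] by (auto simp: factorizations_def)
    ultimately show "size s + size w \<le> k \<longrightarrow> size s' + size w \<le> k"
      using neg by force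
  qed auto
  then show False using assms z by simp
qed

definition distance_set :: "nat set" where
  "distance_set = (\<Union>S\<in>B. set_distances (length_set S))"

lemma distance_set_bounds:
  assumes "d \<in> distance_set" shows "1 \<le> d" "d \<le> N * N"
proof -
  from assms obtain S k l where *: "k \<in> length_set S" "l \<in> length_set S" "k < l" "length_set S \<inter> {k<..<l} = {}" "d = l - k"
    unfolding distance_set_def set_distances_def by blast
  with length_set_gap[of k S l] obtain y where "y \<in> length_set S" "k < y" "y \<le> k + N * N" by blast
  have "l \<le> y"
  proof (rule ccontr)
    assume "\<not> l \<le> y"
    then have "y \<in> length_set S \<inter> {k<..<l}" using \<open>y \<in> length_set S\<close> \<open>k < y\<close> by simp
    with *(4) show False by blast
  qed
  then show "1 \<le> d" "d \<le> N * N" using \<open>y \<le> k + N * N\<close> \<open>k < l\<close> \<open>d = l - k\<close> by linarith+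
qed

lemma finite_distance_set: "finite distance_set"
  by (rule finite_subset[of _ "{..N * N}"]) (use distance_set_bounds(2) in blast, simp)

lemma distance_exists:
  assumes "k \<in> length_set S" "l \<in> length_set S" "k < l"
  obtains d where "d \<in> distance_set" "k + d \<in> length_set S"
proof -
  define y where "y = (LEAST y. y \<in> length_set S \<and> k < y)"
  have y: "y \<in> length_set S" "k < y" using LeastI[of "\<lambda>y. y \<in> length_set S \<and> k < y" l] assms y_def by auto
  have "\<not> (x \<in> length_set S \<and> k < x)" if "x < y" for x using not_less_Least that unfolding y_def by blast
  then have "length_set S \<inter> {k<..<y} = {}" by auto
  with y assms have "y - k \<in> distance_set" using length_set_memB unfolding distance_set_def set_distances_def by blast
  with y that[of "y - k"] show ?thesis by simp
qed

text \<open>If every small divisor had only one length, no exchange would change the length.\<close>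

lemma small_flexible_divisor:
  assumes "k \<in> length_set S" "l \<in> length_set S" "k < l"
  obtains c x d where "c \<subseteq># S" "size c \<le> N * N" "x \<in> length_set c" "x + d \<in> length_set c" "d \<in> distance_set"
proof (rule ccontr)
  assume neg: "\<not> thesis"
  from assms obtain z z' where z: "z \<in> factorizations S" "z' \<in> factorizations S" "size z = k" "size z' = l"
    by (auto simp: length_set_def)
  have "size z = size z'"
  proof (rule swap_chain[OF z(1,2), where R = "(=)"])
    fix c s s' w assume *: "s \<in> factorizations c" "s' \<in> factorizations c" "w \<in> factorizations (S - c)" "c \<subseteq># S" "size c \<le> N * N"
    then have "size s \<in> length_set c" "size s' \<in> length_set c" by (auto simp: length_set_def)
    then have "size s = size s'"
      using neg that *(4,5) distance_exists by (metis linorder_neqE_nat)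
    then show "size s + size w = size s' + size w" by simp
  qed auto
  then show False using assms z by simp
qed

end

section \<open>Arithmetical progressions and residues of lengths\<close>

context saturated_multisets begin

text \<open>Flexible divisors are split off one at a time. The width of the set of lengths drops by a bounded
amount in each step, because of \<open>length_set_diff\<close>. For each distance \<open>d\<close>, the product \<open>b d\<close> of the
\<open>m d\<close> divisors found so far with distance \<open>d\<close> has a progression of \<open>m d\<close> steps among its lengths.\<close>

lemma disjoint_progressions:
  assumes "k \<in> length_set S" "l \<in> length_set S" "k + T * ((N + 1) * (N * N) + 1) \<le> l"
  shows "\<exists>b m y. (\<Sum>d\<in>distance_set. b d) \<subseteq># S \<and> (\<Sum>d\<in>distance_set. m d) = T \<and>
    (\<forall>d\<in>distance_set. size (b d) \<le> m d * (N * N) \<and> (\<forall>i\<le>m d. y d + i * d \<in> length_set (b d)))"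
  using assms
proof (induction T arbitrary: S k l)
  case 0
  show ?case
    by (rule exI[of _ "\<lambda>_. {#}"], rule exI[of _ "\<lambda>_. 0"], rule exI[of _ "\<lambda>_. 0"]) (simp add: length_set_empty)
next
  case (Suc T)
  have "k < l" using Suc.prems(3) by simp
  from small_flexible_divisor[OF Suc.prems(1,2) this] obtain c x d where
    c: "c \<subseteq># S" "size c \<le> N * N" "x \<in> length_set c" "x + d \<in> length_set c" "d \<in> distance_set" by metis
  have "c \<in> B" using c(3) length_set_memB by blast
  obtain k' where k': "k' \<in> length_set (S - c)" "k' \<le> k + N * size c"
    using length_set_diff[OF Suc.prems(1) \<open>c \<in> B\<close> c(1)] by metis
  obtain l' where l': "l' \<in> length_set (S - c)" "l \<le> l' + size c"
    using length_set_diff[OF Suc.prems(2) \<open>c \<in> B\<close> c(1)] by metis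
  have "N * size c \<le> N * (N * N)" using c(2) by (rule mult_le_mono2)
  moreover have "k + ((N * N + N * (N * N) + 1) + T * ((N + 1) * (N * N) + 1)) \<le> l"
    using Suc.prems(3) by (simp add: algebra_simps)
  ultimately have "k' + T * ((N + 1) * (N * N) + 1) \<le> l'"
    using k'(2) l'(2) c(2) by linarith
  from Suc.IH[OF k'(1) l'(1) this] obtain b m y where IH: "(\<Sum>d\<in>distance_set. b d) \<subseteq># S - c"
    "(\<Sum>d\<in>distance_set. m d) = T" "\<And>d. d \<in> distance_set \<Longrightarrow> size (b d) \<le> m d * (N * N)"
    "\<And>d i. d \<in> distance_set \<Longrightarrow> i \<le> m d \<Longrightarrow> y d + i * d \<in> length_set (b d)" by metis
  define b' where "b' = (\<lambda>e. b e + (if e = d then c else {#}))"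
  define m' where "m' = (\<lambda>e. m e + (if e = d then 1 else 0))"
  define y' where "y' = (\<lambda>e. y e + (if e = d then x else 0))"
  have "(\<Sum>d\<in>distance_set. b' d) = (\<Sum>d\<in>distance_set. b d) + c"
    unfolding b'_def sum.distrib using finite_distance_set c(5) by (simp add: sum.delta)
  moreover have "(\<Sum>d\<in>distance_set. b d) + c \<subseteq># (S - c) + c" using IH(1) by (rule subset_mset.add_right_mono)
  ultimately have 1: "(\<Sum>d\<in>distance_set. b' d) \<subseteq># S" using c(1) by simp
  have 2: "(\<Sum>d\<in>distance_set. m' d) = Suc T"
    unfolding m'_def sum.distrib using finite_distance_set c(5) IH(2) by (simp add: sum.delta)
  have 3: "size (b' e) \<le> m' e * (N * N)" if "e \<in> distance_set" for e
    using IH(3)[OF that] c(2) by (auto simp: b'_def m'_def)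
  have 4: "y' e + i * e \<in> length_set (b' e)" if e: "e \<in> distance_set" and i: "i \<le> m' e" for e i
  proof (cases "e = d")
    case False
    then show ?thesis using IH(4)[OF e, of i] i by (simp add: b'_def m'_def y'_def)
  next
    case True
    show ?thesis
    proof (cases "i \<le> m e")
      case True
      have "y e + i * e + x \<in> length_set (b e + c)" using length_set_add[OF IH(4)[OF e True] c(3)] .
      then show ?thesis using \<open>e = d\<close> by (simp add: b'_def y'_def ac_simps)
    next
      case False
      then have i: "i = Suc (m e)" using i \<open>e = d\<close> by (simp add: m'_def)
      have "y e + m e * e + (x + d) \<in> length_set (b e + c)" using length_set_add[OF IH(4)[OF e le_refl] c(4)] .
      moreover have "y e + m e * e + (x + d) = y' e + i * e" using i \<open>e = d\<close> by (simp add: y'_def)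
      ultimately show ?thesis using \<open>e = d\<close> by (simp add: b'_def)
    qed
  qed
  show ?case using 1 2 3 4 by blast
qed

lemma long_progression:
  assumes "k \<in> length_set S" "l \<in> length_set S" "r \<ge> 1"
    and "k + (N * N + 1) * r * ((N + 1) * (N * N) + 1) \<le> l"
  obtains d b y where "d \<in> distance_set" "b \<subseteq># S" "b \<in> B" "size b \<le> (N * N + 1) * r * (N * N)"
    "\<And>i. i \<le> r \<Longrightarrow> y + i * d \<in> length_set b"
proof -
  obtain b m y where b: "(\<Sum>d\<in>distance_set. b d) \<subseteq># S" "(\<Sum>d\<in>distance_set. m d) = (N * N + 1) * r"
    "\<And>d. d \<in> distance_set \<Longrightarrow> size (b d) \<le> m d * (N * N)"
    "\<And>d i. d \<in> distance_set \<Longrightarrow> i \<le> m d \<Longrightarrow> y d + i * d \<in> length_set (b d)"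
    using disjoint_progressions[OF assms(1,2,4)] by metis
  have "\<exists>d\<in>distance_set. r \<le> m d"
  proof (rule ccontr)
    assume "\<not> ?thesis"
    then have "(\<Sum>d\<in>distance_set. m d) \<le> card distance_set * r"
      using sum_bounded_above[of distance_set m r] by force
    moreover have "distance_set \<subseteq> {1..N * N}" using distance_set_bounds by auto
    then have "card distance_set \<le> N * N" using card_mono[of "{1..N * N}" distance_set] by simp
    then have "card distance_set * r \<le> N * N * r" by simp
    ultimately show False using b(2) assms(3) by simp
  qed
  then obtain d where d: "d \<in> distance_set" "r \<le> m d" by blast
  have "m d \<le> (N * N + 1) * r" using member_le_sum[OF d(1), of m] finite_distance_set b(2) by simp
  then have "m d * (N * N) \<le> (N * N + 1) * r * (N * N)" by (rule mult_le_mono1)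
  then have "size (b d) \<le> (N * N + 1) * r * (N * N)" using b(3)[OF d(1)] by (rule le_trans[rotated])
  moreover have "b d \<subseteq># (\<Sum>d\<in>distance_set. b d)"
    using finite_distance_set d(1) by (simp add: sum.remove)
  then have "b d \<subseteq># S" using b(1) by (rule subset_mset.order_trans)
  moreover have "b d \<in> B" using b(4)[OF d(1) le0] length_set_memB by blast
  ultimately show ?thesis using that[of d "b d" "y d"] d b(4) by simp
qed

text \<open>A bounded functional cannot grow more than \<open>m\<close> times. Starting with the empty sequence and passing
to a larger divisor of controlled size as long as the functional grows, the process stops after
at most \<open>m\<close> steps. The sizes are bounded by iterating \<open>g\<close>, independently of \<open>S\<close>.\<close>

lemma bounded_maximizer:
  fixes f :: "'g multiset \<Rightarrow> nat" and g :: "nat \<Rightarrow> nat"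
  assumes f: "\<And>b. f b \<le> m" and g: "mono g"
  shows "\<exists>K. \<forall>S\<in>B. \<exists>b\<in>B. b \<subseteq># S \<and> size b \<le> K \<and>
    (\<forall>b'\<in>B. b \<subseteq># b' \<longrightarrow> b' \<subseteq># S \<longrightarrow> size b' \<le> g (size b) \<longrightarrow> f b' \<le> f b)"
proof -
  (* Iterating g alone could decrease the bound. *)
  define G where "G = (\<lambda>n. max n (g n))"
  have G: "mono G" "n \<le> G n" "g n \<le> G n" for n
    using g unfolding G_def mono_def by (auto simp: max_def intro: le_trans) (meson le_trans linear)
  let ?max = "\<lambda>S b. \<forall>b'\<in>B. b \<subseteq># b' \<longrightarrow> b' \<subseteq># S \<longrightarrow> size b' \<le> g (size b) \<longrightarrow> f b' \<le> f b"
  have step: "\<exists>b\<in>B. b \<subseteq># S \<and> size b \<le> (G ^^ i) 0 \<and> (i \<le> f b \<or> ?max S b)" if S: "S \<in> B" for S i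
  proof (induction i)
    case 0
    show ?case using empty_mem by (intro bexI[of _ "{#}"]) auto
  next
    case (Suc i)
    then obtain b where b: "b \<in> B" "b \<subseteq># S" "size b \<le> (G ^^ i) 0" "i \<le> f b \<or> ?max S b" by blast
    show ?case
    proof (cases "?max S b")
      case True
      have "size b \<le> (G ^^ Suc i) 0" using b(3) G(2)[of "(G ^^ i) 0"] by simp
      then show ?thesis using b True by blast
    next
      case False
      then obtain b' where b': "b' \<in> B" "b' \<subseteq># S" "size b' \<le> g (size b)" "f b < f b'"
        by (meson not_le)
      have "g (size b) \<le> G ((G ^^ i) 0)" using G(3) monoD[OF G(1) b(3)] le_trans by blast
      then have "size b' \<le> (G ^^ Suc i) 0" using b'(3) by simp
      moreover have "Suc i \<le> f b'" using b(4) False b'(4) by simp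
      ultimately show ?thesis using b' by blast
    qed
  qed
  show ?thesis
  proof (intro exI[of _ "(G ^^ Suc m) 0"] ballI)
    fix S assume "S \<in> B"
    from step[OF this, of "Suc m"] obtain b where
      "b \<in> B" "b \<subseteq># S" "size b \<le> (G ^^ Suc m) 0" "Suc m \<le> f b \<or> ?max S b" by blast
    moreover have "\<not> Suc m \<le> f b" using f[of b] by simp
    ultimately show "\<exists>b\<in>B. b \<subseteq># S \<and> size b \<le> (G ^^ Suc m) 0 \<and> ?max S b" by blast
  qed
qed

text \<open>For every length \<open>u\<close> of a cofactor of \<open>b\<close> inside a slightly larger divisor \<open>b'\<close>, the residues of
lengths of \<open>b\<close>, shifted by \<open>u\<close>, are residues of lengths of \<open>b'\<close>; by maximality they are all of them.
With \<open>b' = b + c\<close> for the small divisors \<open>c\<close> of \<open>swap_chain\<close> this shows that the shifted residue set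
does not depend on the length of the cofactor \<open>S - b\<close> chosen. With the divisor provided by \<open>absorb\<close> it
shows that an arbitrary length of \<open>S\<close> has a residue of this form.\<close>

lemma length_residues:
  fixes m :: nat
  defines "res \<equiv> (\<lambda>b. (\<lambda>x. x mod m) ` length_set b)"
  assumes m: "m > 0" and b: "b \<in> B" "b \<subseteq># S"
    and max: "\<And>b'. b' \<in> B \<Longrightarrow> b \<subseteq># b' \<Longrightarrow> b' \<subseteq># S \<Longrightarrow>
      size b' \<le> (N + 1) * size b + N * N \<Longrightarrow> card (res b') \<le> card (res b)"
    and w: "w \<in> length_set (S - b)" and x: "x \<in> length_set S"
  shows "\<exists>t\<in>length_set b. x mod m = (t + w) mod m"
proof -
  define sh where "sh = (\<lambda>u. (\<lambda>t. (t + u) mod m) ` length_set b)"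
  have sh_eq: "sh u = res b'" if b': "b' \<in> B" "b \<subseteq># b'" "b' \<subseteq># S" "size b' \<le> (N + 1) * size b + N * N"
    and u: "u \<in> length_set (b' - b)" for b' u
  proof (rule card_seteq)
    show "finite (res b')" by (simp add: res_def finite_length_set)
    show "sh u \<subseteq> res b'"
      using length_set_add[OF _ u, where S = b] b'(2) by (auto simp: sh_def res_def)
    (* Shifting by u is undone modulo m by shifting by (m - 1) * u. *)
    have "(t + u + (m - 1) * u) mod m = t mod m" for t
    proof -
      have "t + u + (m - 1) * u = t + m * u" using m by (cases m) auto
      then show ?thesis by (simp only: mod_mult_self2)
    qed
    then have "res b = (\<lambda>r. (r + (m - 1) * u) mod m) ` sh u"
      unfolding res_def sh_def image_image by (simp add: mod_add_left_eq)
    then have "card (res b) \<le> card (sh u)" by (metis card_image_le finite_imageI finite_length_set sh_def)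
    with max[OF b'] show "card (res b') \<le> card (sh u)" by simp
  qed
  have sh_shift: "sh (u + v) = (\<lambda>r. (r + v) mod m) ` sh u" for u v
    unfolding sh_def image_image by (simp add: mod_add_left_eq add.assoc)
  have const: "sh w = sh w'" if w': "w' \<in> length_set (S - b)" for w'
  proof -
    from w w' obtain z z' where z: "z \<in> factorizations (S - b)" "z' \<in> factorizations (S - b)" "w = size z" "w' = size z'"
      by (auto simp: length_set_def)
    have "sh (size z) = sh (size z')"
    proof (rule swap_chain[OF z(1,2), where R = "\<lambda>x y. sh x = sh y"])
      fix c s s' v assume *: "s \<in> factorizations c" "s' \<in> factorizations c" "c \<subseteq># S - b" "size c \<le> N * N"
      have c: "size s \<in> length_set c" "size s' \<in> length_set c" using * by (auto simp: length_set_def)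
      have "b + c \<subseteq># S" using *(3) b(2)
        by (metis subset_mset.add_diff_inverse mset_subset_eq_mono_add_left_cancel)
      then have "sh j = res (b + c)" if "j \<in> length_set c" for j
        using that *(4) length_set_memB[OF that] b(1) add_mem by (intro sh_eq) auto
      then have "sh (size s) = res (b + c)" "sh (size s') = res (b + c)" using c by blast+
      then show "sh (size s + size v) = sh (size s' + size v)" unfolding sh_shift by simp
    qed auto
    with z show ?thesis by simp
  qed
  from x obtain z where z: "z \<in> factorizations S" "x = size z" by (auto simp: length_set_def)
  from absorb[OF z(1) b] obtain s u v where s: "z = s + v" "b \<subseteq># \<Sum>\<^sub># s"
    "size (\<Sum>\<^sub># s) \<le> N * size b" "u \<in> factorizations (\<Sum>\<^sub># s - b)" "u + v \<in> factorizations (S - b)" by metis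
  have irr: "set_mset s \<subseteq> irr" "\<Sum>\<^sub># s \<subseteq># S" using z s(1) by (auto simp: factorizations_def)
  have "sh (size u) = res (\<Sum>\<^sub># s)"
    using s irr sum_irr_mem by (intro sh_eq) (auto simp: length_set_def)
  moreover have "size s mod m \<in> res (\<Sum>\<^sub># s)"
    using factorizationsI[OF irr(1)] by (auto simp: res_def length_set_def)
  ultimately have "(size s mod m + size v) mod m \<in> sh (size u + size v)"
    unfolding sh_shift by auto
  moreover have "size u + size v \<in> length_set (S - b)" unfolding length_set_def using s(5) by (intro image_eqI) auto
  then have "sh w = sh (size u + size v)" by (rule const)
  moreover have "(size s mod m + size v) mod m = x mod m" using z s(1) by (simp add: mod_add_left_eq)
  ultimately show ?thesis unfolding sh_def by auto
qed

text \<open>Write \<open>S = b + c + e\<close>, where \<open>b\<close> has the maximal number of residues and \<open>c\<close> carries a progression of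
\<open>r\<close> steps with difference \<open>d\<close>. The lengths of \<open>b\<close> provide the residue, the progression the multiples
of \<open>d\<close>, and the lengths of \<open>e\<close>, which have gaps at most \<open>N\<^sup>2\<close>, the position. The modulus \<open>(N\<^sup>2)!\<close>
is a multiple of every distance, so that \<open>b\<close> can be chosen before \<open>d\<close> is known; choosing it first keeps its
size \<open>K\<close> independent of \<open>r\<close>, which has to exceed \<open>K + N\<^sup>2\<close>.\<close>

lemma middle_periodic:
  "\<exists>M. \<forall>S\<in>B. (\<forall>k\<in>length_set S. \<forall>l\<in>length_set S. l \<le> k + M) \<or>
     (\<exists>d\<in>distance_set. \<exists>p q. \<forall>x\<in>length_set S. p \<le> x + M \<and> x \<le> q + M \<and>
        (\<forall>n. p \<le> n \<longrightarrow> n \<le> q \<longrightarrow> n mod d = x mod d \<longrightarrow> n \<in> length_set S))"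
proof -
  (* Distances are at most N * N, so all of them divide m. *)
  define m where "m = (fact (N * N) :: nat)"
  have m: "m > 0" by (simp add: m_def)
  define res where "res = (\<lambda>b. (\<lambda>x. x mod m) ` length_set b)"
  have card_res: "card (res b) \<le> m" for b
  proof -
    have "res b \<subseteq> {..<m}" using m by (auto simp: res_def)
    then show ?thesis using card_mono[of "{..<m}" "res b"] by simp
  qed
  have "mono (\<lambda>n. (N + 1) * n + N * N)"
    by (intro monoI add_right_mono mult_le_mono2)
  from bounded_maximizer[of "\<lambda>b. card (res b)", OF card_res this] obtain K where
    K: "\<And>S. S \<in> B \<Longrightarrow> \<exists>b\<in>B. b \<subseteq># S \<and> size b \<le> K \<and> (\<forall>b'\<in>B. b \<subseteq># b' \<longrightarrow> b' \<subseteq># S \<longrightarrow>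
        size b' \<le> (N + 1) * size b + N * N \<longrightarrow> card (res b') \<le> card (res b))" by metis
  (* Long enough for the windows coming from neighbouring lengths of e to overlap. *)
  define r where "r = K + N * N + 1"
  define V where "V = (N * N + 1) * r * ((N + 1) * (N * N) + 1)"
  define K1 where "K1 = (N * N + 1) * r * (N * N)"
  define M where "M = V + N * K + N * K1 + K + K1"
  show ?thesis
  proof (intro exI[of _ M] ballI)
    fix S assume S: "S \<in> B"
    show "(\<forall>k\<in>length_set S. \<forall>l\<in>length_set S. l \<le> k + M) \<or>
     (\<exists>d\<in>distance_set. \<exists>p q. \<forall>x\<in>length_set S. p \<le> x + M \<and> x \<le> q + M \<and>
        (\<forall>n. p \<le> n \<longrightarrow> n \<le> q \<longrightarrow> n mod d = x mod d \<longrightarrow> n \<in> length_set S))"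
    proof (rule disjCI[THEN disj_commute[THEN iffD1]])
      assume "\<not> (\<forall>k\<in>length_set S. \<forall>l\<in>length_set S. l \<le> k + M)"
      then obtain k l where kl: "k \<in> length_set S" "l \<in> length_set S" "k + M < l" by force
      obtain b where b: "b \<in> B" "b \<subseteq># S" "size b \<le> K"
        and b_max: "\<And>b'. b' \<in> B \<Longrightarrow> b \<subseteq># b' \<Longrightarrow> b' \<subseteq># S \<Longrightarrow>
          size b' \<le> (N + 1) * size b + N * N \<Longrightarrow> card (res b') \<le> card (res b)"
        using K[OF S] by blast
      have length_set_b: "\<exists>j\<in>length_set (S - b). x \<le> j + K \<and> j \<le> x + N * K" if x: "x \<in> length_set S" for x
      proof -
        obtain j where j: "j \<in> length_set (S - b)" "x \<le> j + size b" "j \<le> x + N * size b"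
          using length_set_diff[OF x b(1,2)] by blast
        have "N * size b \<le> N * K" using b(3) by (rule mult_le_mono2)
        then have "x \<le> j + K" "j \<le> x + N * K" using j b(3) by linarith+
        with j(1) show ?thesis by blast
      qed
      obtain k' l' where "k' \<in> length_set (S - b)" "k' \<le> k + N * K" "l' \<in> length_set (S - b)" "l \<le> l' + K"
        using length_set_b kl by metis
      moreover have "k' + V \<le> l'" using calculation(2,4) kl(3) unfolding M_def by linarith
      ultimately obtain d c y where c: "d \<in> distance_set" "c \<subseteq># S - b" "c \<in> B" "size c \<le> K1"
        and prog: "\<And>i. i \<le> r \<Longrightarrow> y + i * d \<in> length_set c"
        using long_progression[of k' "S - b" l' r] unfolding V_def K1_def r_def by (metis le_add2)
      have y: "y \<in> length_set c" using prog[of 0] by simp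
      define e where "e = S - b - c"
      have "c + e = S - b" unfolding e_def using c(2) by (rule subset_mset.add_diff_inverse)
      then have S_eq: "S = b + (c + e)" using b(2) by (simp add: subset_mset.add_diff_inverse)
      have e: "length_set e \<noteq> {}" "finite (length_set e)"
        using diff_mem[OF c(3) diff_mem[OF b(1) S b(2)] c(2)] length_set_nonempty finite_length_set by (auto simp: e_def)
      have length_set_e: "\<exists>j\<in>length_set e. x \<le> j + (K + K1) \<and> j \<le> x + N * K + N * K1" if x: "x \<in> length_set S" for x
      proof -
        obtain x1 where x1: "x1 \<in> length_set (S - b)" "x \<le> x1 + K" "x1 \<le> x + N * K" using length_set_b[OF x] by blast
        obtain x2 where x2: "x2 \<in> length_set e" "x1 \<le> x2 + size c" "x2 \<le> x1 + N * size c"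
          using length_set_diff[OF x1(1) c(3,2)] unfolding e_def by metis
        have "N * size c \<le> N * K1" using c(4) by (rule mult_le_mono2)
        then have "x \<le> x2 + (K + K1)" "x2 \<le> x + N * K + N * K1" using x1 x2 c(4) by linarith+
        with x2(1) show ?thesis by blast
      qed
      define p where "p = Min (length_set e) + y + K"
      define q where "q = Max (length_set e) + y + r * d"
      have "y \<le> K1" using length_set_bounds(1)[OF y] c(4) by simp
      have "p \<le> x + M \<and> x \<le> q + M" if x: "x \<in> length_set S" for x
      proof -
        obtain j where j: "j \<in> length_set e" "x \<le> j + (K + K1)" "j \<le> x + N * K + N * K1"
          using length_set_e[OF x] by blast
        have "Min (length_set e) \<le> j" "j \<le> Max (length_set e)" using e j(1) by simp_all
        then show ?thesis using j \<open>y \<le> K1\<close> unfolding p_def q_def M_def by linarith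
      qed
      moreover have "n \<in> length_set S" if x: "x \<in> length_set S" and n: "p \<le> n" "n \<le> q" "n mod d = x mod d" for x n
      proof -
        (* v is the last length of e whose window starts at or before n. *)
        define A where "A = {v \<in> length_set e. v + y + K \<le> n}"
        define v where "v = Max A"
        have "Min (length_set e) \<in> A" using Min_in[OF e(2,1)] n(1) by (simp add: A_def p_def)
        then have A: "finite A" "A \<noteq> {}" using e(2) by (auto simp: A_def)
        then have v: "v \<in> length_set e" "v + y + K \<le> n" using Max_in[OF A] by (auto simp: v_def A_def)
        have "1 \<le> d" using distance_set_bounds c(1) by blast
        then have "K + N * N < r * d" unfolding r_def by (cases d) auto
        have n_le: "n \<le> v + y + r * d"
        proof (cases "v = Max (length_set e)")
          case True
          then show ?thesis using n(2) by (simp add: q_def)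
        next
          case False
          then have "v < Max (length_set e)" using e v(1) by (simp add: less_le)
          then obtain v' where v': "v' \<in> length_set e" "v < v'" "v' \<le> v + N * N"
            using length_set_gap[OF v(1) Max_in[OF e(2,1)]] by blast
          have "v' \<notin> A" using Max_ge[OF A(1)] v'(2) unfolding v_def by (meson not_less)
          then have "n < v' + y + K" using v'(1) by (simp add: A_def)
          then show ?thesis using v'(3) \<open>K + N * N < r * d\<close> by linarith
        qed
        have yv: "y + v \<in> length_set (S - b)" using length_set_add[OF y v(1)] S_eq by simp
        obtain t where t: "t \<in> length_set b" "x mod m = (t + (y + v)) mod m"
          using length_residues[OF m b(1,2) b_max[unfolded res_def] yv x] by blast
        have "d dvd m" unfolding m_def using distance_set_bounds[OF c(1)] by (intro dvd_fact)
        then have "x mod d = (t + (y + v)) mod d" using t(2) by (metis mod_mod_cancel)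
        then have "n mod d = (t + (y + v)) mod d" using n(3) by simp
        moreover have "t \<le> K" using length_set_bounds(1)[OF t(1)] b(3) by simp
        then have "t + (y + v) \<le> n" using v(2) by simp
        ultimately have "d dvd n - (t + (y + v))" by (metis mod_eq_dvd_iff_nat)
        then obtain i where i: "n - (t + (y + v)) = d * i" by (rule dvdE)
        have "d * i \<le> d * r" using i n_le unfolding mult.commute[of r d] by linarith
        then have "i \<le> r" using \<open>1 \<le> d\<close> by simp
        have "t + (y + i * d + v) \<in> length_set S"
          unfolding S_eq using length_set_add[OF t(1) length_set_add[OF prog[OF \<open>i \<le> r\<close>] v(1)]] .
        moreover have "t + (y + i * d + v) = n" using i \<open>t + (y + v) \<le> n\<close> by (simp add: mult.commute)
        ultimately show ?thesis by simp
      qed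
      ultimately show "\<exists>d\<in>distance_set. \<exists>p q. \<forall>x\<in>length_set S. p \<le> x + M \<and> x \<le> q + M \<and>
        (\<forall>n. p \<le> n \<longrightarrow> n \<le> q \<longrightarrow> n mod d = x mod d \<longrightarrow> n \<in> length_set S)"
        using c(1) by blast
    qed
  qed
qed

end

section \<open>Almost arithmetical multiprogressions\<close>

lemma AAMP_I:
  assumes "d \<ge> 1" "{0, int d} \<subseteq> D" "D \<subseteq> {0..int d}" "L = (+) y ` (P \<union> C \<union> E)"
    "L \<subseteq> (+) y ` periodic_set D d" "finite C" "C \<noteq> {}" "Min C = 0"
    "C = periodic_set D d \<inter> {0..Max C}" "P \<subseteq> {- int M..-1}" "E \<subseteq> {Max C + 1..Max C + int M}"
  shows "AAMP d D M L"
  unfolding AAMP_def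
  by (intro conjI, fact, fact, fact, rule exI[of _ y], rule exI[of _ P], rule exI[of _ C],
      rule exI[of _ E], intro conjI) fact+

text \<open>A set of width at most \<open>M\<close> is an AAMP with full period: the central part is its maximum alone and all
other elements belong to the initial part.\<close>

lemma AAMP_short:
  assumes L: "finite L" "L \<noteq> {}" and M: "\<And>x y. x \<in> L \<Longrightarrow> y \<in> L \<Longrightarrow> y \<le> x + int M" and d: "d \<ge> 1"
  shows "AAMP d {0..int d} M L"
proof -
  have P: "periodic_set {0..int d} d = UNIV"
  proof -
    have "\<exists>x k. t = x + int d * k \<and> x \<in> {0..int d}" for t
      using d by (intro exI[of _ "t mod int d"] exI[of _ "t div int d"]) (simp add: less_imp_le)
    then show ?thesis unfolding periodic_set_def by blast
  qed
  define y where "y = Max L"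
  have y: "y \<in> L" "x \<in> L \<Longrightarrow> x \<le> y" for x using L by (auto simp: y_def)
  have "L = (+) y ` ({t. t < 0 \<and> y + t \<in> L} \<union> {0} \<union> {})" (is "_ = ?R")
  proof (intro equalityI subsetI)
    fix x assume "x \<in> L"
    then have "x - y \<in> {t. t < 0 \<and> y + t \<in> L} \<union> {0} \<union> {}" using y(2)[of x] by auto
    then show "x \<in> ?R" by (intro image_eqI[of _ _ "x - y"]) auto
  qed (use y in auto)
  moreover have "L \<subseteq> (+) y ` periodic_set {0..int d} d"
    unfolding P by (metis subset_UNIV surj_plus)
  moreover have "{t. t < 0 \<and> y + t \<in> L} \<subseteq> {- int M..-1}"
    using M[OF _ y(1)] by force
  ultimately show ?thesis
    using d P by (intro AAMP_I[where y = y and P = "{t. t < 0 \<and> y + t \<in> L}" and C = "{0}" and E = "{}"]) simp_all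
qed

text \<open>If \<open>[p, q]\<close> is longer than \<open>d\<close>, take as base point an element \<open>y\<close> of \<open>L\<close> among the first \<open>d\<close> integers of
\<open>[p, q]\<close> and as period the residues of \<open>L - y\<close>; otherwise \<open>L\<close> is short.\<close>

lemma AAMP_periodic_middle:
  fixes L :: "int set" and p q :: int
  assumes L: "finite L" "L \<noteq> {}" and d: "d \<ge> 1" and M': "2 * M + d \<le> M'"
    and ends: "\<And>x. x \<in> L \<Longrightarrow> p \<le> x + int M" "\<And>x. x \<in> L \<Longrightarrow> x \<le> q + int M"
    and mid: "\<And>x n. x \<in> L \<Longrightarrow> p \<le> n \<Longrightarrow> n \<le> q \<Longrightarrow> int d dvd n - x \<Longrightarrow> n \<in> L"
  shows "\<exists>D. AAMP d D M' L"
proof (cases "p + int d \<le> q")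
  case False
  have "y \<le> x + int M'" if "x \<in> L" "y \<in> L" for x y
    using ends(1)[OF that(1)] ends(2)[OF that(2)] False M' by linarith
  then show ?thesis using AAMP_short[OF L _ d] by blast
next
  case True
  obtain x0 where x0: "x0 \<in> L" using L by blast
  define y where "y = p + (x0 - p) mod int d"
  have y_bd: "p \<le> y" "y < p + int d" using d by (simp_all add: y_def)
  have "int d dvd y - x0"
  proof -
    have "y - x0 = - ((x0 - p) - (x0 - p) mod int d)" by (simp add: y_def)
    then show ?thesis by (simp only: dvd_minus_iff dvd_minus_mod)
  qed
  then have y: "y \<in> L" using mid[OF x0] y_bd True by simp
  define W where "W = {t. \<exists>x\<in>L. int d dvd y + t - x}"
  define D where "D = W \<inter> {0..int d}"
  have P: "periodic_set D d = W"
  proof (intro equalityI subsetI)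
    fix t assume "t \<in> periodic_set D d"
    then obtain s k where s: "t = s + int d * k" "s \<in> W" by (auto simp: periodic_set_def D_def)
    then obtain x where x: "x \<in> L" "int d dvd y + s - x" by (auto simp: W_def)
    have "y + t - x = (y + s - x) + int d * k" using s(1) by simp
    then have "int d dvd y + t - x" using x(2) by (metis dvd_add dvd_triv_left)
    with x(1) show "t \<in> W" by (auto simp: W_def)
  next
    fix t assume "t \<in> W"
    then obtain x where x: "x \<in> L" "int d dvd y + t - x" by (auto simp: W_def)
    have "y + t mod int d - x = (y + t - x) - (t - t mod int d)" by simp
    then have "int d dvd y + t mod int d - x" using x(2) by (metis dvd_diff dvd_minus_mod)
    then have "t mod int d \<in> D" using x(1) d by (auto simp: D_def W_def less_imp_le)
    then show "t \<in> periodic_set D d"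
      unfolding periodic_set_def by (intro CollectI exI[of _ "t mod int d"] exI[of _ "t div int d"]) simp
  qed
  define L2 where "L2 = {t. 0 \<le> t \<and> y + t \<le> q \<and> y + t \<in> L}"
  have L2: "0 \<in> L2" "finite L2"
  proof -
    show "0 \<in> L2" using y y_bd True by (simp add: L2_def)
    have "L2 \<subseteq> {0..q - y}" by (auto simp: L2_def)
    then show "finite L2" by (rule finite_subset) simp
  qed
  have Min: "Min L2 = 0" using L2 by (intro Min_eqI) (auto simp: L2_def)
  define e where "e = Max L2"
  have "L2 \<noteq> {}" using L2(1) by blast
  then have e: "e \<in> L2" "\<And>t. t \<in> L2 \<Longrightarrow> t \<le> e"
    using L2(2) by (simp_all add: e_def Max_in[OF L2(2)])
  have "\<not> y + (e + int d) \<le> q"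
  proof
    assume "y + (e + int d) \<le> q"
    moreover have "int d dvd (y + (e + int d)) - (y + e)" by simp
    ultimately have "e + int d \<in> L2"
      using e(1) y_bd mid[of "y + e" "y + (e + int d)"] by (auto simp: L2_def)
    then show False using e(2) d by fastforce
  qed
  note e_large = this
  define L1 where "L1 = {t. t < 0 \<and> y + t \<in> L}"
  define L3 where "L3 = {t. e < t \<and> y + t \<in> L}"
  have L2_eq: "L2 = periodic_set D d \<inter> {0..Max L2}"
    unfolding P e_def[symmetric]
  proof (intro equalityI subsetI)
    fix t assume "t \<in> L2"
    then show "t \<in> W \<inter> {0..e}" using e(2) by (force simp: L2_def W_def)
  next
    fix t assume t: "t \<in> W \<inter> {0..e}"
    then obtain x where x: "x \<in> L" "int d dvd y + t - x" by (auto simp: W_def)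
    have "y + t \<le> q" using t e(1) by (auto simp: L2_def)
    then show "t \<in> L2" using mid[OF x(1) _ _ x(2)] t y_bd by (auto simp: L2_def)
  qed
  have "L = (+) y ` (L1 \<union> L2 \<union> L3)" (is "_ = ?R")
  proof (intro equalityI subsetI)
    fix x assume x: "x \<in> L"
    have "x \<le> q" if "x - y \<le> e" using that e(1) by (simp add: L2_def)
    then have "x - y \<in> L1 \<union> L2 \<union> L3" using x by (force simp: L1_def L2_def L3_def)
    then show "x \<in> ?R" by (intro image_eqI[of _ _ "x - y"]) auto
  qed (auto simp: L1_def L2_def L3_def)
  moreover have "L \<subseteq> (+) y ` periodic_set D d"
  proof
    fix x assume "x \<in> L"
    then have "x - y \<in> W" unfolding W_def by (intro CollectI bexI[of _ x]) simp_all
    then show "x \<in> (+) y ` periodic_set D d" unfolding P by (intro image_eqI[of _ _ "x - y"]) auto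
  qed
  moreover have "L1 \<subseteq> {- int M'..-1}"
    using ends(1) y_bd M' by (force simp: L1_def)
  moreover have "L3 \<subseteq> {Max L2 + 1..Max L2 + int M'}"
  proof
    fix t assume t: "t \<in> L3"
    then have "y + t \<le> q + int M" using ends(2) by (simp add: L3_def)
    with t e_large M' show "t \<in> {Max L2 + 1..Max L2 + int M'}"
      unfolding e_def[symmetric] by (auto simp: L3_def)
  qed
  moreover have "{0, int d} \<subseteq> D" "D \<subseteq> {0..int d}" using y by (auto simp: D_def W_def intro!: bexI[of _ y])
  moreover have "L2 \<noteq> {}" using L2 by blast
  ultimately have "AAMP d D M' L" using d L2(2) Min L2_eq by (intro AAMP_I)
  then show ?thesis ..
qed

context saturated_multisets begin

lemma structure_of_length_set: 
  "\<exists>M. \<forall>S\<in>B. \<exists>d\<in>(if distance_set = {} then {1} else distance_set). \<exists>D. AAMP d D M (int ` length_set S)"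
proof -
  obtain M where M: "\<And>S. S \<in> B \<Longrightarrow> (\<forall>k\<in>length_set S. \<forall>l\<in>length_set S. l \<le> k + M) \<or>
     (\<exists>d\<in>distance_set. \<exists>p q. \<forall>x\<in>length_set S. p \<le> x + M \<and> x \<le> q + M \<and>
        (\<forall>n. p \<le> n \<longrightarrow> n \<le> q \<longrightarrow> n mod d = x mod d \<longrightarrow> n \<in> length_set S))"
    using middle_periodic by blast
  define M' where "M' = 2 * M + N * N"
  show ?thesis
  proof (intro exI[of _ M'] ballI)
    fix S assume S: "S \<in> B"
    define \<Delta> where "\<Delta> = (if distance_set = {} then {1} else distance_set)"
    have fin: "finite (int ` length_set S)" "int ` length_set S \<noteq> {}"
      using finite_length_set length_set_nonempty[OF S] by auto
    have "\<exists>d\<in>\<Delta>. \<exists>D. AAMP d D M' (int ` length_set S)"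
    proof (cases "\<forall>k\<in>length_set S. \<forall>l\<in>length_set S. l \<le> k + M")
      case True
      have "\<exists>d\<in>\<Delta>. d \<ge> 1"
      proof (cases "distance_set = {}")
        case True
        then show ?thesis by (simp add: \<Delta>_def)
      next
        case False
        then obtain d where "d \<in> distance_set" by blast
        then have "d \<in> \<Delta>" "1 \<le> d" using False distance_set_bounds(1) by (simp_all add: \<Delta>_def)
        then show ?thesis by blast
      qed
      then obtain d where d: "d \<in> \<Delta>" "d \<ge> 1" by blast
      have "y \<le> x + int M'" if "x \<in> int ` length_set S" "y \<in> int ` length_set S" for x y
      proof -
        from that obtain i j where "i \<in> length_set S" "j \<in> length_set S" "x = int i" "y = int j" by blast
        then have "j \<le> i + M" "x = int i" "y = int j" using True by auto
        then show ?thesis unfolding M'_def by linarith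
      qed
      then have "AAMP d {0..int d} M' (int ` length_set S)" by (rule AAMP_short[OF fin _ d(2)])
      then show ?thesis using d(1) by blast
    next
      case False
      then obtain d p q where d: "d \<in> distance_set"
        and *: "\<And>x. x \<in> length_set S \<Longrightarrow> p \<le> x + M \<and> x \<le> q + M \<and>
        (\<forall>n. p \<le> n \<longrightarrow> n \<le> q \<longrightarrow> n mod d = x mod d \<longrightarrow> n \<in> length_set S)" using M[OF S] by blast
      have "\<exists>D. AAMP d D M' (int ` length_set S)"
      proof (rule AAMP_periodic_middle[OF fin, of d M M' "int p" "int q"])
        show "1 \<le> d" "2 * M + d \<le> M'" using distance_set_bounds[OF d] by (simp_all add: M'_def)
        show "int p \<le> x + int M" "x \<le> int q + int M" if "x \<in> int ` length_set S" for x
        proof -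
          from that obtain i where "x = int i" "i \<in> length_set S" by blast
          then show "int p \<le> x + int M" "x \<le> int q + int M" using *[of i] by linarith+
        qed
        fix x n assume x: "x \<in> int ` length_set S" and n: "int p \<le> n" "n \<le> int q" "int d dvd n - x"
        then obtain j where j: "x = int j" "j \<in> length_set S" by blast
        obtain i where i: "n = int i" using n(1) by (metis nonneg_int_cases of_nat_0_le_iff order_trans)
        have "int i mod int d = int j mod int d" using n(3) i j by (simp add: mod_eq_dvd_iff)
        then have "i mod d = j mod d" by (metis of_nat_eq_iff zmod_int)
        then have "i \<in> length_set S" using *[OF j(2)] n i by simp
        then show "n \<in> int ` length_set S" using i by blast
      qed
      moreover have "distance_set \<noteq> {}" using d by blast
      then have "d \<in> \<Delta>" using d by (simp add: \<Delta>_def)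
      ultimately show ?thesis by blast
    qed
    then show "\<exists>d\<in>(if distance_set = {} then {1} else distance_set). \<exists>D. AAMP d D M' (int ` length_set S)"
      by (simp only: \<Delta>_def)
  qed
qed

end

section \<open>Transfer homomorphisms preserve sets of lengths\<close>

lemma transfer_hom_atoms:
  assumes "monoid H" "transfer_hom H B f" "a \<in> carrier H"
  shows "f a \<in> atoms B \<longleftrightarrow> a \<in> atoms H"
proof -
  interpret H: monoid H by fact
  interpret B: ore_monoid B using assms(2) by (simp add: transfer_hom_def)
  have hom: "f (x \<otimes>\<^bsub>H\<^esub> y) = f x \<otimes>\<^bsub>B\<^esub> f y" "f x \<in> carrier B" if "x \<in> carrier H" "y \<in> carrier H" for x y
    using assms(2) that unfolding transfer_hom_def monoid_hom_def hom_def by auto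
  have unit: "f x \<in> Units B \<longleftrightarrow> x \<in> Units H" if "x \<in> carrier H" for x
    using assms(2) that unfolding transfer_hom_def reduced_def by blast
  have split: "\<exists>u\<in>carrier H. \<exists>v\<in>carrier H. a = u \<otimes>\<^bsub>H\<^esub> v \<and> f u = b \<and> f v = c"
    if "b \<in> carrier B" "c \<in> carrier B" "f a = b \<otimes>\<^bsub>B\<^esub> c" for b c
    using assms(2,3) that unfolding transfer_hom_def by blast
  show ?thesis
  proof
    assume L: "f a \<in> atoms B"
    show "a \<in> atoms H"
      unfolding atoms_def
    proof (intro CollectI conjI DiffI ballI impI)
      show "a \<in> carrier H" by fact
      show "a \<notin> Units H" using L unit assms(3) by (auto simp: atoms_def)
      fix u v assume uv: "u \<in> carrier H" "v \<in> carrier H" "a = u \<otimes>\<^bsub>H\<^esub> v"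
      then have "f u \<in> carrier B" "f v \<in> carrier B" "f a = f u \<otimes>\<^bsub>B\<^esub> f v" using hom by blast+
      then have "f u \<in> Units B \<or> f v \<in> Units B" using L unfolding atoms_def by blast
      then show "u \<in> Units H \<or> v \<in> Units H" using unit uv by blast
    qed
  next
    assume R: "a \<in> atoms H"
    show "f a \<in> atoms B"
      unfolding atoms_def
    proof (intro CollectI conjI DiffI ballI impI)
      show "f a \<in> carrier B" "f a \<notin> Units B" using R hom unit by (auto simp: atoms_def)
      fix b c assume "b \<in> carrier B" "c \<in> carrier B" "f a = b \<otimes>\<^bsub>B\<^esub> c"
      from split[OF this] obtain u v where "u \<in> carrier H" "v \<in> carrier H" "a = u \<otimes>\<^bsub>H\<^esub> v" "f u = b" "f v = c"
        by blast
      then show "b \<in> Units B \<or> c \<in> Units B" using R unit by (auto simp: atoms_def)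
    qed
  qed
qed

text \<open>A factorization of the image lifts atom by atom from the left. The last factor is the lift of a single
atom, so no unit is left over.\<close>

lemma transfer_hom_lengths:
  assumes "monoid H" "transfer_hom H B f" "a \<in> carrier H"
  shows "lengths H a = lengths B (f a)"
proof -
  interpret H: monoid H by fact
  interpret B: ore_monoid B using assms(2) by (simp add: transfer_hom_def)
  have hom: "f (x \<otimes>\<^bsub>H\<^esub> y) = f x \<otimes>\<^bsub>B\<^esub> f y" if "x \<in> carrier H" "y \<in> carrier H" for x y
    using assms(2) that unfolding transfer_hom_def monoid_hom_def hom_def by auto
  have f1: "f \<one>\<^bsub>H\<^esub> = \<one>\<^bsub>B\<^esub>" using assms(2) unfolding transfer_hom_def monoid_hom_def by auto
  have unit: "f a \<in> Units B \<longleftrightarrow> a \<in> Units H"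
    using assms(2,3) unfolding transfer_hom_def reduced_def by blast
  have atoms: "atoms H \<subseteq> carrier H" "atoms B \<subseteq> carrier B" by (auto simp: atoms_def)
  have fwd: "f (foldr (\<otimes>\<^bsub>H\<^esub>) us \<one>\<^bsub>H\<^esub>) = foldr (\<otimes>\<^bsub>B\<^esub>) (map f us) \<one>\<^bsub>B\<^esub>" if "set us \<subseteq> carrier H" for us
    using that
  proof (induction us)
    case Nil show ?case using f1 by simp
  next
    case (Cons u us)
    then show ?case using hom[of u "foldr (\<otimes>\<^bsub>H\<^esub>) us \<one>\<^bsub>H\<^esub>"] foldr_mult_closed[OF assms(1), of us] by simp
  qed
  have bwd: "\<exists>us. length us = length bs \<and> map f us = bs \<and> set us \<subseteq> carrier H \<and> x = foldr (\<otimes>\<^bsub>H\<^esub>) us \<one>\<^bsub>H\<^esub>"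
    if "bs \<noteq> []" "set bs \<subseteq> carrier B" "x \<in> carrier H" "f x = foldr (\<otimes>\<^bsub>B\<^esub>) bs \<one>\<^bsub>B\<^esub>" for bs x
    using that
  proof (induction bs arbitrary: x rule: list_nonempty_induct)
    case (single b)
    then show ?case by (intro exI[of _ "[x]"]) simp
  next
    case (cons b bs)
    then have "foldr (\<otimes>\<^bsub>B\<^esub>) bs \<one>\<^bsub>B\<^esub> \<in> carrier B"
      using foldr_mult_closed[OF B.monoid_axioms] by simp
    moreover have "b \<in> carrier B" "f x = b \<otimes>\<^bsub>B\<^esub> foldr (\<otimes>\<^bsub>B\<^esub>) bs \<one>\<^bsub>B\<^esub>"
      using cons.prems by simp_all
    ultimately obtain u v where uv: "u \<in> carrier H" "v \<in> carrier H" "x = u \<otimes>\<^bsub>H\<^esub> v" "f u = b"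
      "f v = foldr (\<otimes>\<^bsub>B\<^esub>) bs \<one>\<^bsub>B\<^esub>"
      using assms(2) cons.prems(2) unfolding transfer_hom_def by blast
    from cons.IH[OF _ uv(2,5)] cons.prems obtain us where
      "length us = length bs" "map f us = bs" "set us \<subseteq> carrier H" "v = foldr (\<otimes>\<^bsub>H\<^esub>) us \<one>\<^bsub>H\<^esub>" by auto
    with uv show ?case by (intro exI[of _ "u # us"]) simp
  qed
  have "(\<exists>us. length us = k \<and> set us \<subseteq> atoms H \<and> a = foldr (\<otimes>\<^bsub>H\<^esub>) us \<one>\<^bsub>H\<^esub>) \<longleftrightarrow>
        (\<exists>bs. length bs = k \<and> set bs \<subseteq> atoms B \<and> f a = foldr (\<otimes>\<^bsub>B\<^esub>) bs \<one>\<^bsub>B\<^esub>)" if k: "1 \<le> k" for k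
  proof
    assume "\<exists>us. length us = k \<and> set us \<subseteq> atoms H \<and> a = foldr (\<otimes>\<^bsub>H\<^esub>) us \<one>\<^bsub>H\<^esub>"
    then obtain us where us: "length us = k" "set us \<subseteq> atoms H" "a = foldr (\<otimes>\<^bsub>H\<^esub>) us \<one>\<^bsub>H\<^esub>" by blast
    have "set (map f us) \<subseteq> atoms B" using us(2) atoms(1) transfer_hom_atoms[OF assms(1,2)] by auto
    moreover have "f a = foldr (\<otimes>\<^bsub>B\<^esub>) (map f us) \<one>\<^bsub>B\<^esub>" using fwd us atoms(1) by blast
    ultimately show "\<exists>bs. length bs = k \<and> set bs \<subseteq> atoms B \<and> f a = foldr (\<otimes>\<^bsub>B\<^esub>) bs \<one>\<^bsub>B\<^esub>"
      using us(1) by (intro exI[of _ "map f us"]) simp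
  next
    assume "\<exists>bs. length bs = k \<and> set bs \<subseteq> atoms B \<and> f a = foldr (\<otimes>\<^bsub>B\<^esub>) bs \<one>\<^bsub>B\<^esub>"
    then obtain bs where bs: "length bs = k" "set bs \<subseteq> atoms B" "f a = foldr (\<otimes>\<^bsub>B\<^esub>) bs \<one>\<^bsub>B\<^esub>" by blast
    have "bs \<noteq> []" using bs(1) k by auto
    then obtain us where us: "length us = length bs" "map f us = bs" "set us \<subseteq> carrier H" "a = foldr (\<otimes>\<^bsub>H\<^esub>) us \<one>\<^bsub>H\<^esub>"
      using bwd[of bs a] bs atoms(2) assms(3) by blast
    have "set us \<subseteq> atoms H"
    proof
      fix u assume "u \<in> set us"
      then have "f u \<in> atoms B" "u \<in> carrier H" using us(2,3) bs(2) by auto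
      then show "u \<in> atoms H" using transfer_hom_atoms[OF assms(1,2)] by blast
    qed
    then show "\<exists>us. length us = k \<and> set us \<subseteq> atoms H \<and> a = foldr (\<otimes>\<^bsub>H\<^esub>) us \<one>\<^bsub>H\<^esub>"
      using us bs(1) by auto
  qed
  then show ?thesis unfolding lengths_def using unit by auto
qed

lemma transfer_hom_length_sets:
  assumes "monoid H" "transfer_hom H B f"
  shows "length_sets H = length_sets B"
proof -
  have "f ` carrier H = carrier B" using assms(2) by (simp add: transfer_hom_def)
  then have "length_sets B = (\<lambda>a. lengths B (f a)) ` carrier H"
    unfolding length_sets_def by (metis image_image)
  also have "\<dots> = length_sets H"
    unfolding length_sets_def by (rule image_cong[OF refl], rule transfer_hom_lengths[OF assms, symmetric])
  finally show ?thesis ..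
qed

section \<open>Monoids of zero-sum sequences\<close>

lemma (in comm_group) sigma_empty [simp]: "sigma G {#} = \<one>"
  by (simp add: sigma_def)

text \<open>The product over the support is compared with the product over the support without \<open>x\<close>, which is the
same for \<open>S\<close> and \<open>add_mset x S\<close>, whether or not \<open>x\<close> occurs in \<open>S\<close>.\<close>

lemma (in comm_group) sigma_add_mset:
  assumes "x \<in> carrier G" "set_mset S \<subseteq> carrier G"
  shows "sigma G (add_mset x S) = x \<otimes> sigma G S"
proof -
  define A where "A = set_mset S - {x}"
  have A: "finite A" "x \<notin> A" "A \<subseteq> carrier G" using assms by (auto simp: A_def)
  have [simp]: "(\<lambda>g. g [^] (n g :: nat)) \<in> A \<rightarrow> carrier G" for n using A(3) by auto
  have eq: "sigma G T = x [^] count T x \<otimes> (\<Otimes>g\<in>A. g [^] count S g)"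
    if "set_mset T - {x} = A" "\<And>g. g \<noteq> x \<Longrightarrow> count T g = count S g" for T
  proof -
    have cong: "(\<Otimes>g\<in>A. g [^] count T g) = (\<Otimes>g\<in>A. g [^] count S g)"
    proof (rule finprod_cong')
      show "i [^] count T i = i [^] count S i" if "i \<in> A" for i
        using A(2) that \<open>\<And>g. g \<noteq> x \<Longrightarrow> count T g = count S g\<close> by metis
    qed (use A in auto)
    show ?thesis
    proof (cases "x \<in> set_mset T")
      case True
      then have "set_mset T = insert x A" using that(1) by blast
      then show ?thesis unfolding sigma_def using A assms(1) cong by simp
    next
      case False
      then have "set_mset T = A" "count T x = 0" using that(1) by (auto simp: count_eq_zero_iff)
      then show ?thesis unfolding sigma_def using cong A(3) by (simp add: finprod_closed)
    qed
  qed
  have "sigma G (add_mset x S) = x [^] Suc (count S x) \<otimes> (\<Otimes>g\<in>A. g [^] count S g)"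
    by (subst eq) (auto simp: A_def)
  also have "\<dots> = x \<otimes> (x [^] count S x \<otimes> (\<Otimes>g\<in>A. g [^] count S g))"
    using assms(1) by (simp add: finprod_closed m_ac)
  also have "\<dots> = x \<otimes> sigma G S" by (subst eq[of S]) (auto simp: A_def)
  finally show ?thesis .
qed

lemma (in comm_group) sigma_closed: "set_mset S \<subseteq> carrier G \<Longrightarrow> sigma G S \<in> carrier G"
  by (induction S) (auto simp: sigma_add_mset)

lemma (in comm_group) sigma_union:
  "set_mset S \<subseteq> carrier G \<Longrightarrow> set_mset T \<subseteq> carrier G \<Longrightarrow> sigma G (S + T) = sigma G S \<otimes> sigma G T"
  by (induction S) (auto simp: sigma_add_mset sigma_closed m_assoc)

lemma block_monoid_simps [simp]:
  "carrier (block_monoid G G0) = {S. set_mset S \<subseteq> G0 \<and> sigma G S = \<one>\<^bsub>G\<^esub>}"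
  "S \<otimes>\<^bsub>block_monoid G G0\<^esub> T = S + T"
  "\<one>\<^bsub>block_monoid G G0\<^esub> = {#}"
  by (simp_all add: block_monoid_def)

locale block_monoid_over = comm_group G for G (structure) +
  fixes G0 assumes sub: "G0 \<subseteq> carrier G"
begin

abbreviation "BM \<equiv> block_monoid G G0"

lemma block_add: "S \<in> carrier BM \<Longrightarrow> T \<in> carrier BM \<Longrightarrow> S + T \<in> carrier BM"
  using sub by (auto simp: sigma_union)

lemma block_cancel: "S \<in> carrier BM \<Longrightarrow> S + T \<in> carrier BM \<Longrightarrow> T \<in> carrier BM"
proof -
  assume "S \<in> carrier BM" "S + T \<in> carrier BM"
  moreover from this have "set_mset T \<subseteq> carrier G" "set_mset S \<subseteq> carrier G" using sub by auto
  ultimately show ?thesis using sigma_union[of S T] sigma_closed[of T] by simp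
qed

lemma block_comm_monoid: "comm_monoid BM"
proof (rule comm_monoidI)
  show "x \<otimes>\<^bsub>BM\<^esub> y \<in> carrier BM" if "x \<in> carrier BM" "y \<in> carrier BM" for x y
    using block_add[OF that] by simp
qed (simp_all add: ac_simps)

lemma block_ore: "ore_monoid BM"
proof -
  interpret M: comm_monoid BM by (rule block_comm_monoid)
  show ?thesis
  proof unfold_locales
    fix S T assume ST: "S \<in> carrier BM" "T \<in> carrier BM"
    have "S + T \<in> carrier BM #>\<^bsub>BM\<^esub> S" "S + T \<in> carrier BM #>\<^bsub>BM\<^esub> T"
      "S + T \<in> S <#\<^bsub>BM\<^esub> carrier BM" "S + T \<in> T <#\<^bsub>BM\<^esub> carrier BM"
      using ST unfolding r_coset_def l_coset_def
      by (auto simp del: block_monoid_simps(1) simp: add.commute[of S T])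
    then show "(carrier BM #>\<^bsub>BM\<^esub> S) \<inter> (carrier BM #>\<^bsub>BM\<^esub> T) \<noteq> {}"
      "(S <#\<^bsub>BM\<^esub> carrier BM) \<inter> (T <#\<^bsub>BM\<^esub> carrier BM) \<noteq> {}" by blast+
  qed auto
qed

lemma block_units: "Units BM = {{#}}"
  by (auto simp: Units_def)

lemma block_reduced: "reduced BM"
  by (simp add: reduced_def block_units)

end

context block_monoid_over begin

context
  fixes N assumes bound: "\<And>U. U \<in> atoms BM \<Longrightarrow> size U \<le> N"
begin

interpretation S: saturated_multisets "carrier BM" N
proof
  show "{#} \<in> carrier BM" by simp
  show "S + T \<in> carrier BM" if "S \<in> carrier BM" "T \<in> carrier BM" for S T
    using block_add[OF that] .
  show "T \<in> carrier BM" if "S \<in> carrier BM" "S + T \<in> carrier BM" for S T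
    using block_cancel[OF that] .
  fix U assume "U \<in> carrier BM" "U \<noteq> {#}"
    "\<And>S T. S \<in> carrier BM \<Longrightarrow> T \<in> carrier BM \<Longrightarrow> U = S + T \<Longrightarrow> S = {#} \<or> T = {#}"
  then have "U \<in> atoms BM" unfolding atoms_def block_units by auto
  then show "size U \<le> N" by (rule bound)
qed

declare block_monoid_simps(1) [simp del]

lemma atoms_eq_irr: "atoms BM = S.irr"
  unfolding atoms_def S.irr_def block_units by auto

lemma lengths_eq_length_set:
  assumes "S \<in> carrier BM" shows "lengths BM S = S.length_set S"
proof (cases "S = {#}")
  case True
  then show ?thesis by (simp add: lengths_def block_units S.length_set_empty del: block_monoid_simps(1))
next
  case False
  have fold: "foldr (\<otimes>\<^bsub>BM\<^esub>) us \<one>\<^bsub>BM\<^esub> = \<Sum>\<^sub># (mset us)" for us by (induction us) auto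
  have "k \<in> lengths BM S \<longleftrightarrow> k \<in> S.length_set S" for k
  proof
    assume "k \<in> lengths BM S"
    then obtain us where us: "length us = k" "set us \<subseteq> atoms BM" "S = \<Sum>\<^sub># (mset us)"
      using False by (auto simp: lengths_def block_units fold simp del: block_monoid_simps)
    then have "mset us \<in> S.factorizations S" by (simp add: S.factorizations_def atoms_eq_irr del: block_monoid_simps)
    then show "k \<in> S.length_set S" unfolding S.length_set_def using us(1) by (intro image_eqI[of _ _ "mset us"]) simp_all
  next
    assume k: "k \<in> S.length_set S"
    then obtain z where z: "z \<in> S.factorizations S" "k = size z" by (auto simp: S.length_set_def)
    obtain us where us: "mset us = z" using ex_mset by blast
    have "k \<noteq> 0" using k False S.zero_in_length_set_iff by metis
    moreover have "length us = k" "set us \<subseteq> atoms BM" "S = foldr (\<otimes>\<^bsub>BM\<^esub>) us \<one>\<^bsub>BM\<^esub>"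
      using z us unfolding fold by (auto simp: S.factorizations_def atoms_eq_irr simp del: block_monoid_simps)
    ultimately show "k \<in> lengths BM S"
      using False by (auto simp: lengths_def block_units simp del: block_monoid_simps)
  qed
  then show ?thesis by blast
qed

lemma length_sets_eq: "length_sets BM = S.length_set ` carrier BM"
  unfolding length_sets_def by (rule image_cong[OF refl lengths_eq_length_set])

lemma distances_eq: "distances BM = S.distance_set"
  unfolding distances_def length_sets_eq S.distance_set_def by simp

lemma bounded_block_arithmetic:
  "elasticity BM < \<infinity>" "finite (distances BM)" "{} \<notin> length_sets BM" "0 \<notin> distances BM"
  "\<exists>M. \<forall>L\<in>length_sets BM. \<exists>d\<in>(if distances BM = {} then {1} else distances BM). \<exists>D. AAMP d D M (int ` L)"
proof -
  have "set_elasticity L \<le> real (max N 1)" if L: "L \<in> length_sets BM" for L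
  proof -
    obtain S where S: "S \<in> carrier BM" "L = S.length_set S" using L unfolding length_sets_eq by blast
    show ?thesis
    proof (cases "S = {#}")
      case True
      then show ?thesis using S by (simp add: set_elasticity_def S.length_set_empty)
    next
      case False
      have L: "finite L" "L \<noteq> {}" "0 \<notin> L"
        using S.finite_length_set S.length_set_nonempty S.zero_in_length_set_iff S False by auto
      have in_L: "Max L \<in> S.length_set S" "Min L \<in> S.length_set S" using L S by auto
      have "Min L > 0" using in_L(2) L(3) S(2) by (metis gr0I)
      have "Max L \<le> N * Min L" using S.length_set_bounds in_L le_trans by blast
      then have "real (Max L) \<le> real N * real (Min L)" by (metis of_nat_le_iff of_nat_mult)
      then have "real (Max L) / real (Min L) \<le> real N" using \<open>Min L > 0\<close> by (simp add: divide_le_eq)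
      then show ?thesis using L(3) by (auto simp: set_elasticity_def)
    qed
  qed
  then have "elasticity BM \<le> ereal (real (max N 1))"
    unfolding elasticity_def by (intro SUP_least) simp
  then show "elasticity BM < \<infinity>" by (rule le_less_trans) simp
  show "finite (distances BM)" unfolding distances_eq by (rule S.finite_distance_set)
  show "{} \<notin> length_sets BM" unfolding length_sets_eq using S.length_set_nonempty by blast
  show "0 \<notin> distances BM" unfolding distances_eq using S.distance_set_bounds(1) by fastforce
  show "\<exists>M. \<forall>L\<in>length_sets BM. \<exists>d\<in>(if distances BM = {} then {1} else distances BM). \<exists>D. AAMP d D M (int ` L)"
    unfolding distances_eq length_sets_eq using S.structure_of_length_set by simp
qed

end

lemma davenport_bound:
  assumes "davenport G G0 < \<infinity>"
  shows "\<exists>N. \<forall>U\<in>atoms BM. size U \<le> N"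
proof -
  from assms obtain N where N: "davenport G G0 = enat N" by (cases "davenport G G0") auto
  have "enat (size U) \<le> enat N" if "U \<in> atoms BM" for U
    unfolding N[symmetric] davenport_def using that by (rule SUP_upper)
  then show ?thesis by auto
qed

end

section \<open>Class groups and the transfer homomorphism\<close>

lemma class_kernel_subgroup:
  assumes "monoid H" and f: "monoid_hom H (free_monoid P) f"
  shows "subgroup (class_kernel H (free_monoid P) f) (quot_group (free_monoid P))"
proof -
  interpret H: monoid H by fact
  interpret F: ore_monoid "free_monoid P" by (rule ore_monoid_free_monoid)
  interpret Q: comm_group "quot_group (free_monoid P)" by (rule quot_group_free_monoid)
  let ?Q = "quot_group (free_monoid P)"
  let ?e = "\<lambda>a. quot_emb (free_monoid P) (f a)"
  have cl: "?e a \<in> carrier ?Q" if "a \<in> carrier H" for a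
    using that f F.quot_emb_closed unfolding monoid_hom_def hom_def by blast
  have mu: "?e (a \<otimes>\<^bsub>H\<^esub> b) = ?e a \<otimes>\<^bsub>?Q\<^esub> ?e b" if "a \<in> carrier H" "b \<in> carrier H" for a b
  proof -
    have "f (a \<otimes>\<^bsub>H\<^esub> b) = f a \<otimes>\<^bsub>free_monoid P\<^esub> f b"
      "f a \<in> carrier (free_monoid P)" "f b \<in> carrier (free_monoid P)"
      using f that unfolding monoid_hom_def hom_def by blast+
    then show ?thesis using F.quot_emb_mult by metis
  qed
  have mem: "?e a \<otimes>\<^bsub>?Q\<^esub> inv\<^bsub>?Q\<^esub> ?e b \<in> class_kernel H (free_monoid P) f"
    if "a \<in> carrier H" "b \<in> carrier H" for a b
    using that unfolding class_kernel_def by blast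
  have cases: "\<exists>a\<in>carrier H. \<exists>b\<in>carrier H. X = ?e a \<otimes>\<^bsub>?Q\<^esub> inv\<^bsub>?Q\<^esub> ?e b"
    if "X \<in> class_kernel H (free_monoid P) f" for X
    using that unfolding class_kernel_def by blast
  show ?thesis
  proof (rule Q.subgroupI)
    show "class_kernel H (free_monoid P) f \<subseteq> carrier ?Q" using cases cl by fastforce
    show "class_kernel H (free_monoid P) f \<noteq> {}" using mem by blast
  next
    fix X assume "X \<in> class_kernel H (free_monoid P) f"
    then obtain a b where ab: "a \<in> carrier H" "b \<in> carrier H" "X = ?e a \<otimes>\<^bsub>?Q\<^esub> inv\<^bsub>?Q\<^esub> ?e b"
      using cases by blast
    then have "inv\<^bsub>?Q\<^esub> X = ?e b \<otimes>\<^bsub>?Q\<^esub> inv\<^bsub>?Q\<^esub> ?e a" using cl by (simp add: Q.inv_mult_group)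
    then show "inv\<^bsub>?Q\<^esub> X \<in> class_kernel H (free_monoid P) f" using mem ab by simp
  next
    fix X Y assume "X \<in> class_kernel H (free_monoid P) f" "Y \<in> class_kernel H (free_monoid P) f"
    then obtain a b c d where *: "a \<in> carrier H" "b \<in> carrier H" "c \<in> carrier H" "d \<in> carrier H"
      "X = ?e a \<otimes>\<^bsub>?Q\<^esub> inv\<^bsub>?Q\<^esub> ?e b" "Y = ?e c \<otimes>\<^bsub>?Q\<^esub> inv\<^bsub>?Q\<^esub> ?e d"
      using cases by metis
    then have "X \<otimes>\<^bsub>?Q\<^esub> Y = ?e (a \<otimes>\<^bsub>H\<^esub> c) \<otimes>\<^bsub>?Q\<^esub> inv\<^bsub>?Q\<^esub> ?e (b \<otimes>\<^bsub>H\<^esub> d)"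
      using cl by (simp add: mu Q.inv_mult Q.m_ac)
    then show "X \<otimes>\<^bsub>?Q\<^esub> Y \<in> class_kernel H (free_monoid P) f"
      using mem[of "a \<otimes>\<^bsub>H\<^esub> c" "b \<otimes>\<^bsub>H\<^esub> d"] * by simp
  qed
qed

locale free_divisor_hom = H: ore_monoid H for H (structure) +
  fixes P :: "'p set" and \<phi>
  assumes divisor_hom: "divisor_hom H (free_monoid P) \<phi>"
begin

abbreviation "F \<equiv> free_monoid P"
abbreviation "K \<equiv> class_kernel H F \<phi>"
abbreviation "C \<equiv> class_group H P \<phi>"
abbreviation "emb \<equiv> quot_emb F"
abbreviation "bt \<equiv> beta_tilde H P \<phi>"
abbreviation "BG \<equiv> block_monoid C (prime_classes H P \<phi>)"

sublocale F: ore_monoid "free_monoid P" by (rule ore_monoid_free_monoid)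
sublocale Q: comm_group "quot_group (free_monoid P)" by (rule quot_group_free_monoid)

lemma hom: "monoid_hom H F \<phi>"
  using divisor_hom by (simp add: divisor_hom_def)

sublocale C: comm_group C
  by (rule class_group_is_comm_group[OF H.monoid_axioms hom])

lemma kernel_subgroup: "subgroup K (quot_group F)"
  by (rule class_kernel_subgroup[OF H.monoid_axioms hom])

lemma phi_closed: "a \<in> carrier H \<Longrightarrow> set_mset (\<phi> a) \<subseteq> P"
  and phi_mult: "a \<in> carrier H \<Longrightarrow> b \<in> carrier H \<Longrightarrow> \<phi> (a \<otimes> b) = \<phi> a + \<phi> b"
  and phi_one: "\<phi> \<one> = {#}"
  using hom unfolding monoid_hom_def hom_def by auto

text \<open>In the free abelian monoid divisibility is inclusion of multisets and has no sides; \<open>\<phi>\<close> reflects it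
to both one-sided divisibility relations of \<open>H\<close>.\<close>

lemma phi_dvd:
  assumes "a \<in> carrier H" "b \<in> carrier H" "\<phi> a \<subseteq># \<phi> b"
  shows "\<exists>c\<in>carrier H. b = a \<otimes> c" "\<exists>c\<in>carrier H. b = c \<otimes> a"
proof -
  obtain T where T: "\<phi> b = \<phi> a + T" using assms(3) by (auto simp: mset_subset_eq_exists_conv)
  then have "set_mset T \<subseteq> P" using phi_closed[OF assms(2)] by auto
  then have "ldivides F (\<phi> a) (\<phi> b)" "rdivides F (\<phi> a) (\<phi> b)"
    using T by (auto simp: ldivides_def rdivides_def l_coset_def r_coset_def add.commute)
  then have "ldivides H a b" "rdivides H a b"
    using divisor_hom assms(1,2) unfolding divisor_hom_def by blast+
  then show "\<exists>c\<in>carrier H. b = a \<otimes> c" "\<exists>c\<in>carrier H. b = c \<otimes> a"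
    by (auto simp: ldivides_def rdivides_def l_coset_def r_coset_def)
qed

lemma emb_closed: "set_mset S \<subseteq> P \<Longrightarrow> emb S \<in> carrier (quot_group F)"
  using F.quot_emb_closed by simp

lemma emb_add: "set_mset S \<subseteq> P \<Longrightarrow> set_mset T \<subseteq> P \<Longrightarrow> emb (S + T) = emb S \<otimes>\<^bsub>quot_group F\<^esub> emb T"
  using F.quot_emb_mult[of S T] by simp

lemma emb_empty: "emb {#} = \<one>\<^bsub>quot_group F\<^esub>"
  by (simp add: quot_group_def quot_emb_def)

text \<open>If \<open>S + \<phi> b = \<phi> a\<close>, then \<open>b\<close> divides \<open>a\<close> in \<open>H\<close>, and \<open>S\<close> is the image of the quotient.\<close>

lemma mem_kernel_iff:
  assumes S: "set_mset S \<subseteq> P"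
  shows "emb S \<in> K \<longleftrightarrow> S \<in> \<phi> ` carrier H"
proof
  assume "emb S \<in> K"
  then obtain a b where ab: "a \<in> carrier H" "b \<in> carrier H"
    "emb S = emb (\<phi> a) \<otimes>\<^bsub>quot_group F\<^esub> inv\<^bsub>quot_group F\<^esub> emb (\<phi> b)"
    unfolding class_kernel_def by blast
  note c = emb_closed[OF S] phi_closed[OF ab(1)] phi_closed[OF ab(2)]
  have "emb (S + \<phi> b) = emb (\<phi> a)"
    using c ab(3) by (simp add: emb_add S emb_closed Q.m_assoc)
  then have eq: "S + \<phi> b = \<phi> a"
    using F.quot_emb_inj S c by (auto simp: inj_on_def)
  then have "\<phi> b \<subseteq># \<phi> a" by (metis mset_subset_eq_add_right)
  then obtain d where "d \<in> carrier H" "a = b \<otimes> d" using phi_dvd ab by blast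
  then show "S \<in> \<phi> ` carrier H" using eq phi_mult ab by (metis add.commute add_left_cancel imageI)
next
  assume "S \<in> \<phi> ` carrier H"
  then obtain a where a: "a \<in> carrier H" "S = \<phi> a" by blast
  have "emb S = emb (\<phi> a) \<otimes>\<^bsub>quot_group F\<^esub> inv\<^bsub>quot_group F\<^esub> emb (\<phi> \<one>)"
    using a emb_closed[OF S] by (simp add: phi_one emb_empty)
  then show "emb S \<in> K" using a(1) H.one_closed unfolding class_kernel_def by blast
qed

lemma prime_class_closed: "p \<in> P \<Longrightarrow> prime_class H P \<phi> p \<in> carrier C"
  unfolding class_group_def FactGroup_def RCOSETS_def prime_class_def using emb_closed by auto

lemma prime_classes_subset: "prime_classes H P \<phi> \<subseteq> carrier C"
  using prime_class_closed by (auto simp: prime_classes_def)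

lemma class_group_one: "\<one>\<^bsub>C\<^esub> = K"
  by (simp add: class_group_def FactGroup_def)

lemma sigma_beta_tilde:
  assumes "set_mset S \<subseteq> P"
  shows "sigma C (bt S) = K #>\<^bsub>quot_group F\<^esub> emb S"
  using assms
proof (induction S)
  case empty
  have "K #>\<^bsub>quot_group F\<^esub> emb {#} = K"
    unfolding emb_empty by (rule Q.coset_mult_one[OF subgroup.subset[OF kernel_subgroup]])
  then show ?case by (simp add: beta_tilde_def class_group_one)
next
  case (add p S)
  interpret N: normal K "quot_group F" by (rule Q.subgroup_imp_normal[OF kernel_subgroup])
  have "sigma C (bt (add_mset p S)) = prime_class H P \<phi> p \<otimes>\<^bsub>C\<^esub> sigma C (bt S)"
    using add.prems prime_class_closed by (simp add: beta_tilde_def) (subst C.sigma_add_mset; auto)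
  also have "\<dots> = (K #>\<^bsub>quot_group F\<^esub> emb {#p#}) <#>\<^bsub>quot_group F\<^esub> (K #>\<^bsub>quot_group F\<^esub> emb S)"
    using add by (simp add: prime_class_def class_group_def)
  also have "\<dots> = K #>\<^bsub>quot_group F\<^esub> (emb {#p#} \<otimes>\<^bsub>quot_group F\<^esub> emb S)"
    using add.prems emb_closed by (intro N.rcos_sum) auto
  also have "emb {#p#} \<otimes>\<^bsub>quot_group F\<^esub> emb S = emb (add_mset p S)"
    using emb_add[of "{#p#}" S] add.prems by simp
  finally show ?case .
qed

lemma beta_tilde_mem_iff:
  assumes S: "set_mset S \<subseteq> P"
  shows "bt S \<in> carrier BG \<longleftrightarrow> S \<in> \<phi> ` carrier H"
proof -
  have "bt S \<in> carrier BG \<longleftrightarrow> K #>\<^bsub>quot_group F\<^esub> emb S = K"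
    using S sigma_beta_tilde[OF S] by (auto simp: beta_tilde_def prime_classes_def class_group_one)
  also have "\<dots> \<longleftrightarrow> emb S \<in> K"
    using Q.coset_join1 Q.coset_join2 kernel_subgroup emb_closed[OF S] subgroup.subset[OF kernel_subgroup] by metis
  finally show ?thesis using mem_kernel_iff[OF S] by simp
qed

lemma phi_unit_iff:
  assumes a: "a \<in> carrier H" shows "\<phi> a = {#} \<longleftrightarrow> a \<in> Units H"
proof
  assume "\<phi> a = {#}"
  then have "\<phi> a \<subseteq># \<phi> \<one>" by simp
  then obtain b c where bc: "b \<in> carrier H" "\<one> = a \<otimes> b" "c \<in> carrier H" "\<one> = c \<otimes> a"
    using phi_dvd[OF a H.one_closed] by blast
  then have "b = c" using a by (metis H.l_one H.m_assoc H.r_one)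
  then show "a \<in> Units H" using bc a by (auto simp: Units_def)
next
  assume "a \<in> Units H"
  then obtain b where "b \<in> carrier H" "a \<otimes> b = \<one>" by (auto simp: Units_def)
  then show "\<phi> a = {#}" using phi_mult[OF a] phi_one by (metis empty_eq_union)
qed

text \<open>A decomposition of the image of \<open>a\<close> splits \<open>\<phi> a\<close> as a multiset, and the parts are images of elements
of \<open>H\<close> because their classes sum to zero; the first of them divides \<open>a\<close>, and cancelling it from
\<open>\<phi> a\<close> identifies the image of the cofactor.\<close>

theorem transfer: "transfer_hom H BG (bt \<circ> \<phi>)"
proof -
  interpret BO: block_monoid_over C "prime_classes H P \<phi>"
    by unfold_locales (rule prime_classes_subset)
  have mem: "bt (\<phi> a) \<in> carrier BG" if "a \<in> carrier H" for a
    using beta_tilde_mem_iff[OF phi_closed[OF that]] that by blast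
  have hom': "monoid_hom H BG (bt \<circ> \<phi>)"
    unfolding monoid_hom_def
  proof
    show "bt \<circ> \<phi> \<in> hom H BG"
      by (rule homI) (use mem in \<open>simp_all add: phi_mult beta_tilde_def del: block_monoid_simps(1)\<close>)
    show "(bt \<circ> \<phi>) \<one> = \<one>\<^bsub>BG\<^esub>" by (simp add: phi_one beta_tilde_def)
  qed
  have lift: "\<exists>a\<in>carrier H. \<phi> a = S" if "set_mset S \<subseteq> P" "bt S \<in> carrier BG" for S
    using beta_tilde_mem_iff[OF that(1)] that(2) by blast
  have surj: "T \<in> (bt \<circ> \<phi>) ` carrier H" if T: "T \<in> carrier BG" for T
  proof -
    have "set_mset T \<subseteq> prime_class H P \<phi> ` P" using T by (simp add: prime_classes_def)
    then obtain S where S: "set_mset S \<subseteq> P" "bt S = T"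
    proof (induction T arbitrary: thesis)
      case empty
      show ?case by (rule empty(1)[of "{#}"]) (simp_all add: beta_tilde_def)
    next
      case (add x T)
      obtain S where S: "set_mset S \<subseteq> P" "bt S = T" using add.IH add.prems(2) by auto
      obtain p where "p \<in> P" "x = prime_class H P \<phi> p" using add.prems(2) by auto
      with S show ?case by (intro add.prems(1)[of "add_mset p S"]) (auto simp: beta_tilde_def)
    qed
    then show ?thesis using lift[of S] T by auto
  qed
  have unit: "{a \<in> carrier H. (bt \<circ> \<phi>) a = \<one>\<^bsub>BG\<^esub>} = Units H"
    using phi_unit_iff by (auto simp: beta_tilde_def)
  have split: "\<exists>a1\<in>carrier H. \<exists>a2\<in>carrier H. a = a1 \<otimes> a2 \<and> (bt \<circ> \<phi>) a1 = T1 \<and> (bt \<circ> \<phi>) a2 = T2"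
    if a: "a \<in> carrier H" and T: "T1 \<in> carrier BG" "T2 \<in> carrier BG"
      and eq: "(bt \<circ> \<phi>) a = T1 \<otimes>\<^bsub>BG\<^esub> T2" for a T1 T2
  proof -
    have "image_mset (prime_class H P \<phi>) (\<phi> a) = T1 + T2" using eq by (simp add: beta_tilde_def)
    from image_mset_eq_plusD[OF this] obtain S1 S2 where
      S: "\<phi> a = S1 + S2" "bt S1 = T1" "bt S2 = T2" by (auto simp: beta_tilde_def)
    have "set_mset S1 \<subseteq> P" using S(1) phi_closed[OF a] by auto
    then obtain a1 where a1: "a1 \<in> carrier H" "\<phi> a1 = S1" using lift S(2) T(1) by blast
    then have "\<phi> a1 \<subseteq># \<phi> a" using S(1) by simp
    then obtain a2 where a2: "a2 \<in> carrier H" "a = a1 \<otimes> a2" using phi_dvd a1(1) a by blast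
    then have "\<phi> a2 = S2" using S(1) a1 phi_mult by simp
    then show ?thesis using a1 a2 S by auto
  qed
  show ?thesis
    unfolding transfer_hom_def
  proof (intro conjI ballI impI)
    show "ore_monoid BG" "reduced BG" by (rule BO.block_ore, rule BO.block_reduced)
    show "(bt \<circ> \<phi>) ` carrier H = carrier BG" using surj mem by auto
  qed (use hom' unit split in blast)+
qed

end

section \<open>Arithmetic of Krull monoids\<close>

theorem theorem6p5:
  fixes H :: "('a, 'm) monoid_scheme"
  assumes "krull_monoid H"
  shows "((\<forall>a\<in>carrier H - Units H. \<exists>I. divisorial_ideal H I \<and> I \<noteq> carrier H \<and> a \<in> I)
            \<longrightarrow> bf_monoid H)
    \<and> (\<forall>(P :: 'p set) \<phi>. divisor_hom H (free_monoid P) \<phi> \<longrightarrow>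
        (let G = class_group H P \<phi>; G\<^sub>P = prime_classes H P \<phi>; B = block_monoid G G\<^sub>P in
          (\<forall>\<alpha>\<in>carrier (free_monoid P).
             beta_tilde H P \<phi> \<alpha> \<in> carrier B \<longleftrightarrow> \<alpha> \<in> \<phi> ` carrier H)
          \<and> transfer_hom H B (beta_tilde H P \<phi> \<circ> \<phi>)
          \<and> (davenport G G\<^sub>P < \<infinity> \<longrightarrow>
               elasticity H < \<infinity> \<and> finite (distances H)
               \<and> (distances H \<noteq> {} \<longrightarrow> (\<exists>M. structure_theorem_holds H M (distances H)))
               \<and> (distances H = {} \<longrightarrow> (\<exists>M. structure_theorem_holds H M {1})))))"
proof (intro conjI allI impI)
  interpret H: ore_monoid H using assms by (simp add: krull_monoid_def)
  show "bf_monoid H"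
    if "\<forall>a\<in>carrier H - Units H. \<exists>I. divisorial_ideal H I \<and> I \<noteq> carrier H \<and> a \<in> I"
    using H.krull_bf_monoid[OF assms] that by blast
  fix P :: "'p set" and \<phi>
  assume "divisor_hom H (free_monoid P) \<phi>"
  then interpret D: free_divisor_hom H P \<phi> by unfold_locales
  interpret B: block_monoid_over D.C "prime_classes H P \<phi>"
    by unfold_locales (rule D.prime_classes_subset)
  have same: "length_sets H = length_sets D.BG"
    by (rule transfer_hom_length_sets[OF H.monoid_axioms D.transfer])
  have arith: "elasticity H < \<infinity> \<and> finite (distances H)
      \<and> (distances H \<noteq> {} \<longrightarrow> (\<exists>M. structure_theorem_holds H M (distances H)))
      \<and> (distances H = {} \<longrightarrow> (\<exists>M. structure_theorem_holds H M {1}))"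
    if dav: "davenport D.C (prime_classes H P \<phi>) < \<infinity>"
  proof -
    obtain N where N: "\<And>U. U \<in> atoms D.BG \<Longrightarrow> size U \<le> N"
      using B.davenport_bound[OF dav] by blast
    note block = B.bounded_block_arithmetic[OF N]
    have eq: "elasticity H = elasticity D.BG" "distances H = distances D.BG"
      by (simp_all add: elasticity_def distances_def same)
    have atomic: "atomic_monoid H"
      using block(3) same unfolding atomic_monoid_def length_sets_def by (metis imageI)
    obtain M where M: "\<forall>L\<in>length_sets H. \<exists>d\<in>(if distances H = {} then {1} else distances H).
        \<exists>D. AAMP d D M (int ` L)"
      using block(5) unfolding same eq by blast
    have "structure_theorem_holds H M (if distances H = {} then {1} else distances H)"
      unfolding structure_theorem_holds_def using M atomic block(2,4) eq(2) by auto
    then show ?thesis using block(1,2) eq by (auto split: if_splits)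
  qed
  show "let G = class_group H P \<phi>; G\<^sub>P = prime_classes H P \<phi>; B = block_monoid G G\<^sub>P in
          (\<forall>\<alpha>\<in>carrier (free_monoid P).
             beta_tilde H P \<phi> \<alpha> \<in> carrier B \<longleftrightarrow> \<alpha> \<in> \<phi> ` carrier H)
          \<and> transfer_hom H B (beta_tilde H P \<phi> \<circ> \<phi>)
          \<and> (davenport G G\<^sub>P < \<infinity> \<longrightarrow>
               elasticity H < \<infinity> \<and> finite (distances H)
               \<and> (distances H \<noteq> {} \<longrightarrow> (\<exists>M. structure_theorem_holds H M (distances H)))
               \<and> (distances H = {} \<longrightarrow> (\<exists>M. structure_theorem_holds H M {1})))"
    unfolding Let_def
  proof (intro conjI ballI impI)
    fix \<alpha> assume "\<alpha> \<in> carrier (free_monoid P)"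
    then have "set_mset \<alpha> \<subseteq> P" by simp
    then show "D.bt \<alpha> \<in> carrier D.BG \<longleftrightarrow> \<alpha> \<in> \<phi> ` carrier H" by (rule D.beta_tilde_mem_iff)
  next
    show "transfer_hom H D.BG (D.bt \<circ> \<phi>)" by (rule D.transfer)
  qed (use arith in blast)+
qed

end
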